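(* (i) Let $\Delta\subset\mathbb{R}^2$ be any triangle. For every $T\in\mathcal{T}_\Delta$ one has $\mathrm{vol}(\Delta\times T)=\frac{c_{EHZ}(\Delta\times T)^2}{2}$. Moreover, for a convex body $T\subset\mathbb{R}^2$, equality $\mathrm{vol}(\Delta\times T)=\frac{c_{EHZ}(\Delta\times T)^2}{2}$ holds if and only if $T=\lambda T^*+s$ for some $\lambda>0$, $s\in\mathbb{R}^2$ and $T^*\in\mathcal{T}_\Delta$. (ii) Let $\square\subset\mathbb{R}^2$ be any square whose sides are parallel to the coordinate axes. For all $a_1,a_2\in[0,1]$ one has $\mathrm{vol}(\square\times\diamondsuit(a_1,a_2))=\frac{c_{EHZ}(\square\times\diamondsuit(a_1,a_2))^2}{2}$. Moreover, for a convex body $T\subset\mathbb{R}^2$, equality $\mathrm{vol}(\square\times T)=\frac{c_{EHZ}(\square\times T)^2}{2}$ holds if and only if $T=\lambda\diamondsuit(a_1,a_2)+s$ for some $\lambda>0$, $s\in\mathbb{R}^2$, $a_1,a_2\in[0,1]$. (iii) Let $Q\subset\mathbb{R}^2$ be a trapezoid which is neither a triangle nor a parallelogram, and write $Q=M(\diamondsuit(a_1,a_2))+c$ with $M\in GL_2(\mathbb{R})$, $c\in\mathbb{R}^2$, $a_1,a_2\in[0,1]$. Let $P=(M^T)^{-1}([0,1]^2)$. Then $\mathrm{vol}(Q\times P)=\frac{c_{EHZ}(Q\times P)^2}{2}$, and for a convex body $T\subset\mathbb{R}^2$ equality $\mathrm{vol}(Q\times T)=\frac{c_{EHZ}(Q\times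 T)^2}{2}$ holds if and only if $T=\lambda P+s$ for some $\lambda>0$, $s\in\mathbb{R}^2$.
   Context: Identify $\mathbb{R}^4=\mathbb{R}^2(x)\times\mathbb{R}^2(y)$ with the standard symplectic form $\omega=dx_1\wedge dy_1+dx_2\wedge dy_2$ and let $J=\begin{pmatrix}0&I_2\\-I_2&0\end{pmatrix}$. A convex body is a compact convex set with nonempty interior. For a convex body $C\subset\mathbb{R}^4$ with $0$ in its interior let $\mu_C(z)=\min\{t\ge 0: z\in tC\}$ and $\partial\mu_C$ its subdifferential. A closed characteristic on $\partial C$ is an absolutely continuous loop $x:\mathbb{R}/\mathbb{Z}\to\mathbb{R}^4$ with $\mu_C(x(t))=1$ for all $t$ and $\dot x(t)\in\mathbb{R}_{>0}J\partial\mu_C(x(t))$ for a.e. $t$; its action is $\mathbb{A}(x)=-\frac12\int_0^1\langle J\dot x,x\rangle dt$, and $c_{EHZ}(C)$ is the minimal action of a closed characteristic on $\partial C$ (translation invariant, hence defined for all convex bodies). $\mathrm{vol}$ is Lebesgue measure. On $\mathbb{R}^2$, $J$ also denotes the linear map $J(a,b)=(b,-a)$. For a triangle $\Delta\subset\mathbb{R}^2$, $\mathcal{T}_\Delta$ is the set of convex bodies $\mathrm{conv}(J\Delta\cup(-J\Delta+t))$ where $t\in\mathbb{R}^2$ ranges over the minimizers of $t\mapsto\mathrm{vol}(\mathrm{conv}(J\Delta\cup(-J\Delta+t)))$. For $a_1,a_2\in[0,1]$, $\diamondsuit(a_1,a_2)=\mathrm{conv}(([0,1]\times\{a_2\})\cup(\{a_1\}\times[0,1]))\subset\mathbb{R}^2$.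 A trapezoid is a convex quadrilateral with at least one pair of parallel sides (triangles counted as degenerate trapezoids). Every convex quadrilateral can be written as $M(\diamondsuit(a_1,a_2))+c$ as in (iii). *)

theory Defs
  imports "HOL-Analysis.Analysis"
begin

type_synonym R2 = "real^2"
type_synonym R4 = "R2 \<times> R2"

definition convex_body :: "'a::euclidean_space set \<Rightarrow> bool" where
  "convex_body C \<longleftrightarrow> compact C \<and> convex C \<and> interior C \<noteq> {}"

definition Jmap :: "R4 \<Rightarrow> R4" where
  "Jmap z = (snd z, - fst z)"

definition J2 :: "R2 \<Rightarrow> R2" where
  "J2 v = vector [v$2, - (v$1)]"

definition gauge :: "'a::real_vector set \<Rightarrow> 'a \<Rightarrow> real" where
  "gauge C z = Inf {t. t \<ge> 0 \<and> z \<in> (\<lambda>w. t *\<^sub>R w) ` C}"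

definition subdiff :: "('a::real_inner \<Rightarrow> real) \<Rightarrow> 'a \<Rightarrow> 'a set" where
  "subdiff f z = {p. \<forall>w. f w \<ge> f z + inner p (w - z)}"

definition abs_continuous_on :: "real \<Rightarrow> real \<Rightarrow> (real \<Rightarrow> 'a::real_normed_vector) \<Rightarrow> bool" where
  "abs_continuous_on a b f \<longleftrightarrow>
     (\<forall>e>0. \<exists>d>0. \<forall>I :: (real \<times> real) set.
        finite I \<and> (\<forall>(u,v)\<in>I. a \<le> u \<and> u \<le> v \<and> v \<le> b)
        \<and> (\<forall>(u,v)\<in>I. \<forall>(u',v')\<in>I. (u,v) \<noteq> (u',v') \<longrightarrow> v \<le> u' \<or> v' \<le> u)
        \<and> (\<Sum>(u,v)\<in>I. v - u) < d
        \<longrightarrow> (\<Sum>(u,v)\<in>I. norm (f v - f u)) < e)"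

(* closed characteristic on the boundary of C (0 in interior C), parametrised by R/Z *)
definition closed_characteristic :: "R4 set \<Rightarrow> (real \<Rightarrow> R4) \<Rightarrow> bool" where
  "closed_characteristic C x \<longleftrightarrow>
     (\<forall>t. x (t + 1) = x t)
     \<and> abs_continuous_on 0 1 x
     \<and> (\<forall>t. gauge C (x t) = 1)
     \<and> (AE t in lborel. t \<in> {0..1} \<longrightarrow>
          (\<exists>v. (x has_vector_derivative v) (at t)
               \<and> (\<exists>c>0. \<exists>p\<in>subdiff (gauge C) (x t). v = c *\<^sub>R Jmap p)))"

definition action :: "(real \<Rightarrow> R4) \<Rightarrow> real" where
  "action x = - (1/2) * integral {0..1}
      (\<lambda>t. inner (Jmap (vector_derivative x (at t))) (x t))"

(* c_EHZ, after translating an interior point to the origin (translation invariant) *)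
definition c_EHZ :: "R4 set \<Rightarrow> real" where
  "c_EHZ C = (let c = (SOME c. c \<in> interior C); C0 = (\<lambda>z. z - c) ` C in
      Inf {action x | x. closed_characteristic C0 x})"

definition vol :: "'a::euclidean_space set \<Rightarrow> real" where
  "vol S = measure lebesgue S"

definition triangle :: "R2 set \<Rightarrow> bool" where
  "triangle S \<longleftrightarrow> (\<exists>a b c. \<not> collinear {a, b, c} \<and> S = convex hull {a, b, c})"

definition conv_refl :: "R2 set \<Rightarrow> R2 \<Rightarrow> R2 set" where
  "conv_refl D t = convex hull (J2 ` D \<union> (\<lambda>v. - J2 v + t) ` D)"

definition T_Delta :: "R2 set \<Rightarrow> R2 set set" where
  "T_Delta D = {conv_refl D t | t. \<forall>t'. vol (conv_refl D t) \<le> vol (conv_refl D t')}"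

definition diamond :: "real \<Rightarrow> real \<Rightarrow> R2 set" where
  "diamond a1 a2 = convex hull ({x. 0 \<le> x$1 \<and> x$1 \<le> 1 \<and> x$2 = a2}
                                \<union> {x. x$1 = a1 \<and> 0 \<le> x$2 \<and> x$2 \<le> 1})"

definition det2 :: "R2 \<Rightarrow> R2 \<Rightarrow> real" where
  "det2 u v = u$1 * v$2 - u$2 * v$1"

definition ccw_quad :: "R2 \<Rightarrow> R2 \<Rightarrow> R2 \<Rightarrow> R2 \<Rightarrow> bool" where
  "ccw_quad a b c d \<longleftrightarrow> det2 (b - a) (c - b) > 0 \<and> det2 (c - b) (d - c) > 0
                       \<and> det2 (d - c) (a - d) > 0 \<and> det2 (a - d) (b - a) > 0"

definition parallel2 :: "R2 \<Rightarrow> R2 \<Rightarrow> bool" where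
  "parallel2 u v \<longleftrightarrow> det2 u v = 0"

definition trapezoid :: "R2 set \<Rightarrow> bool" where
  "trapezoid Q \<longleftrightarrow> triangle Q \<or>
     (\<exists>a b c d. ccw_quad a b c d \<and> Q = convex hull {a, b, c, d}
        \<and> (parallel2 (b - a) (d - c) \<or> parallel2 (c - b) (a - d)))"

definition parallelogram :: "R2 set \<Rightarrow> bool" where
  "parallelogram Q \<longleftrightarrow>
     (\<exists>a b c d. ccw_quad a b c d \<and> Q = convex hull {a, b, c, d} \<and> b - a = c - d)"

definition axis_square :: "R2 set \<Rightarrow> bool" where
  "axis_square S \<longleftrightarrow> (\<exists>p (s::real). s > 0 \<and> S = cbox p (p + s *\<^sub>R (1::R2)))"

end

theory Submission
  imports Defs
begin

text \<open>
A closed characteristic on the boundary of \<open>K \<times> T\<close> is a pair of loops \<open>(q, p)\<close> whose action is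
the integral of \<open>\<langle>q', p\<rangle>\<close>, and \<open>q\<close> cannot be translated into the interior of \<open>K\<close>. Since \<open>q'\<close> is
normal to \<open>T\<close> at \<open>p\<close>, replacing \<open>p\<close> by arbitrary points of \<open>T\<close> on finitely many time intervals can
only lower that integral. If \<open>K\<close> is a triangle with outer normals \<open>n1 + n2 + n3 = 0\<close>, then \<open>q\<close> visits
all three sides, and choosing the points of \<open>T\<close> as vertices of a triangle with edges proportional to
the \<open>n\<^sub>i\<close> bounds the action below by the scale of that triangle. Conversely, a largest inscribed
triangle of this shape is certified by a supporting hyperplane, and the components of its normal
vector are the edges of a polygonal closed characteristic that attains the bound. So the capacity of
\<open>\<Delta> \<times> T\<close> measures the largest scale at which \<open>T\<close> contains translates of both \<open>J \<Delta>\<close> and \<open>- J \<Delta>\<close>; for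
a square the triangles degenerate to a horizontal and a vertical chord, and for a trapezoid one chord
and two triangles occur. Viterbo's equality thus says that \<open>T\<close> has minimal area among the bodies that
contain such pieces, a planar problem that is settled by cutting \<open>T\<close> into parallel slabs.
\<close>


section \<open>Absolutely continuous functions\<close>

text \<open>Characteristics are merely absolutely continuous and are never reduced to polygons: the
  lower bound uses only that the loop touches certain sides at certain times. Three sides can be
  visited in two cyclic orders, and each order needs its own inscribed triangle; the two are point
  reflections of each other, which is where the hull of J \<Delta> and a translate of -J \<Delta>
  comes from. That the infimum is attained follows from an explicit orbit whose action equals the
  lower bound. A trapezoid is a triangle cut off parallel to one side: a loop that reaches the cut
  is bounded by a chord of T, any other loop by the two triangles, and the shortest of the competing
  orbits automatically stays inside the trapezoid. In the dual area problem of the trapezoid, two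
  area bounds that vary in opposite directions are averaged with weights that cancel the free
  parameter. Uniqueness comes from the equality cases, because a compact subset of full area in a
  convex body is the whole body.\<close>

definition nonoverlapping :: "real \<Rightarrow> real \<Rightarrow> (real \<times> real) set \<Rightarrow> bool" where
  "nonoverlapping a b I \<longleftrightarrow> finite I \<and> (\<forall>(u,v)\<in>I. a \<le> u \<and> u \<le> v \<and> v \<le> b) \<and>
     (\<forall>(u,v)\<in>I. \<forall>(u',v')\<in>I. (u,v) \<noteq> (u',v') \<longrightarrow> v \<le> u' \<or> v' \<le> u)"

lemma abs_continuous_on_iff:
  "abs_continuous_on a b f \<longleftrightarrow> (\<forall>e>0. \<exists>d>0. \<forall>I. nonoverlapping a b I \<and> (\<Sum>(u,v)\<in>I. v - u) < d
      \<longrightarrow> (\<Sum>(u,v)\<in>I. norm (f v - f u)) < e)"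
  unfolding abs_continuous_on_def nonoverlapping_def by (simp only: conj_assoc)

lemma abs_continuous_onE:
  assumes "abs_continuous_on a b f" "e > 0"
  obtains d where "d > 0" "\<And>I. nonoverlapping a b I \<Longrightarrow> (\<Sum>(u,v)\<in>I. v - u) < d \<Longrightarrow> (\<Sum>(u,v)\<in>I. norm (f v - f u)) < e"
  using assms unfolding abs_continuous_on_iff by blast

lemma abs_continuous_on_subset:
  assumes "abs_continuous_on a b f" "a \<le> c" "d \<le> b"
  shows "abs_continuous_on c d f"
proof -
  have "nonoverlapping a b I" if "nonoverlapping c d I" for I
    using that assms(2,3) unfolding nonoverlapping_def by fastforce
  then show ?thesis using assms(1) unfolding abs_continuous_on_iff by meson
qed

lemma abs_continuous_on_division:
  fixes f :: "real \<Rightarrow> 'a::real_normed_vector"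
  assumes "abs_continuous_on a b f" "e > 0"
  obtains d where "d > 0" "\<And>D S. D division_of S \<Longrightarrow> S \<subseteq> {a..b} \<Longrightarrow> sum (measure lborel) D < d \<Longrightarrow>
     (\<Sum>k\<in>D. norm (f (Sup k) - f (Inf k))) < e"
proof -
  obtain d where d: "d > 0"
    "\<And>I. nonoverlapping a b I \<Longrightarrow> (\<Sum>(u,v)\<in>I. v - u) < d \<Longrightarrow> (\<Sum>(u,v)\<in>I. norm (f v - f u)) < e"
    using abs_continuous_onE[OF assms] by metis
  show thesis
  proof (rule that[OF d(1)])
    fix D S assume D: "D division_of S" and S: "S \<subseteq> {a..b}" and c: "sum (measure lborel) D < d"
    have rep: "\<exists>u v. k = {u..v} \<and> u \<le> v \<and> a \<le> u \<and> v \<le> b" if kD: "k \<in> D" for k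
    proof -
      obtain u v where k: "k = cbox u v" using division_ofD(4)[OF D kD] by blast
      have "k \<noteq> {}" "k \<subseteq> S" using division_ofD(2,3)[OF D kD] by auto
      then have "u \<le> v" using k by (metis box_real(2) atLeastatMost_empty_iff)
      then have "u \<in> k" "v \<in> k" using k by auto
      then have "a \<le> u" "v \<le> b" using S \<open>k \<subseteq> S\<close> by auto
      then show ?thesis using k \<open>u \<le> v\<close> by (metis box_real(2))
    qed
    define E where "E = (\<lambda>k::real set. (Inf k, Sup k))"
    \<comment> \<open>A point interval inside another member has interior disjoint from it and yet
      overlaps it in the sense of \<open>nonoverlapping\<close>. Such intervals contribute nothing
      to either sum and are removed.\<close>
    define D' where "D' = {k \<in> D. Inf k < Sup k}"
    have fin: "finite D" using D by auto
    have sub: "D' \<subseteq> D" "finite D'" using fin by (auto simp: D'_def)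
    have deg: "measure lborel k = 0 \<and> norm (f (Sup k) - f (Inf k)) = 0" if "k \<in> D - D'" for k
      using rep[of k] that by (auto simp: D'_def)
    have inj: "inj_on E D'"
    proof (rule inj_onI)
      fix k l assume "k \<in> D'" "l \<in> D'" "E k = E l"
      then show "k = l" using rep[of k] rep[of l] by (auto simp: E_def D'_def)
    qed
    have "(\<Sum>(u,v)\<in>E ` D'. norm (f v - f u)) < e"
    proof (rule d(2))
      have "\<forall>(u,v)\<in>E ` D'. a \<le> u \<and> u \<le> v \<and> v \<le> b" using rep sub by (force simp: E_def)
      moreover have "\<forall>(u,v)\<in>E ` D'. \<forall>(u',v')\<in>E ` D'. (u,v) \<noteq> (u',v') \<longrightarrow> v \<le> u' \<or> v' \<le> u"
      proof -
        have "snd (E k) \<le> fst (E l) \<or> snd (E l) \<le> fst (E k)"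
          if kl: "k \<in> D'" "l \<in> D'" and "E k \<noteq> E l" for k l
        proof -
          have "k \<noteq> l" using that by auto
          then have int: "interior k \<inter> interior l = {}" using division_ofD(5)[OF D] kl sub by blast
          obtain s t where s: "k = {s..t}" "s \<le> t" using rep kl sub by blast
          obtain s' t' where s': "l = {s'..t'}" "s' \<le> t'" using rep kl sub by blast
          have e: "E k = (s,t)" "E l = (s',t')" using s s' by (auto simp: E_def)
          have l: "s < t" "s' < t'" using kl s s' by (auto simp: D'_def)
          show ?thesis
          proof (rule ccontr)
            assume "\<not> ?thesis"
            then have "(max s s' + min t t')/2 \<in> {s<..<t} \<inter> {s'<..<t'}"
              using e l by (auto simp: max_def min_def)
            then show False using int s s' by auto
          qed
        qed
        then have "\<forall>x\<in>E ` D'. \<forall>y\<in>E ` D'. x \<noteq> y \<longrightarrow> snd x \<le> fst y \<or> snd y \<le> fst x" by blast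
        then show ?thesis by (simp add: case_prod_beta prod_eq_iff)
      qed
      ultimately show "nonoverlapping a b (E ` D')" using sub(2) unfolding nonoverlapping_def by blast
      have "(\<Sum>(u,v)\<in>E ` D'. v - u) = (\<Sum>k\<in>D'. measure lborel k)"
        unfolding sum.reindex[OF inj] unfolding o_def E_def prod.case
        by (rule sum.cong) (use rep sub in force)+
      also have "\<dots> = (\<Sum>k\<in>D. measure lborel k)"
        by (rule sum.mono_neutral_left) (use fin sub deg in auto)
      finally show "(\<Sum>(u,v)\<in>E ` D'. v - u) < d" using c by simp
    qed
    also have "(\<Sum>(u,v)\<in>E ` D'. norm (f v - f u)) = (\<Sum>k\<in>D'. norm (f (Sup k) - f (Inf k)))"
      unfolding sum.reindex[OF inj] unfolding o_def E_def by simp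
    also have "\<dots> = (\<Sum>k\<in>D. norm (f (Sup k) - f (Inf k)))"
      by (rule sum.mono_neutral_left) (use fin sub deg in auto)
    finally show "(\<Sum>k\<in>D. norm (f (Sup k) - f (Inf k))) < e" .
  qed
qed

text \<open>Riemann sums over a fine tagged division are split by tag. Tags outside \<open>N\<close>
  are controlled by differentiability, as in the straddle lemma. Tags in \<open>N\<close> are forced
  by the gauge into an open set of small measure, where absolute continuity bounds the increments of
  \<open>f\<close>. Each group costs at most half of the error.\<close>

lemma AC_FTC:
  fixes f :: "real \<Rightarrow> 'a::euclidean_space"
  assumes ac: "abs_continuous_on a b f" and ab: "a \<le> b" and neg: "negligible N"
    and der: "\<And>t. t \<in> {a..b} - N \<Longrightarrow> (f has_vector_derivative g t) (at t)"
  shows "(g has_integral (f b - f a)) {a..b}"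
proof -
  \<comment> \<open>With the value 0 on \<open>N\<close>, a tag in \<open>N\<close> contributes only
    the increment of \<open>f\<close>, whatever \<open>g\<close> is there.\<close>
  define h where "h = (\<lambda>t. if t \<in> N then 0 else g t)"
  have "(h has_integral (f b - f a)) {a..b}"
    unfolding has_integral_factor_content_real
  proof (intro allI impI)
    have Nsets: "N \<in> sets lebesgue" using neg by (simp add: negligible_imp_sets)
    fix e0 :: real assume "e0 > 0"
    show "\<exists>d. Tagged_Division.gauge d \<and> (\<forall>p. p tagged_division_of {a..b} \<and> d fine p \<longrightarrow>
      norm (sum (\<lambda>(x,k). measure lborel k *\<^sub>R h x) p - (f b - f a)) \<le> e0 * measure lborel {a..b})"
    proof (cases "a = b")
      case True
      have "Tagged_Division.gauge (\<lambda>x. ball x 1)" by (rule gauge_ball) simp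
      moreover have "norm (sum (\<lambda>(x,k). measure lborel k *\<^sub>R h x) p - (f b - f a)) \<le> e0 * measure lborel {a..b}"
        if p: "p tagged_division_of {a..b}" for p
      proof -
        have "sum (\<lambda>(x,k). measure lborel k *\<^sub>R h x) p = 0"
          by (rule sum_content_null[of a b]) (use p True in auto)
        then show ?thesis using True by simp
      qed
      ultimately show ?thesis by (intro exI[of _ "\<lambda>x. ball x 1"] conjI allI impI) auto
    next
      case False
      then have ab': "a < b" using ab by simp
      define e where "e = e0/2"
      have e: "e > 0" using \<open>e0 > 0\<close> by (simp add: e_def)
      have "e * (b - a) > 0" using e ab' by simp
      obtain r where r: "r > 0"
        "\<And>D S. D division_of S \<Longrightarrow> S \<subseteq> {a..b} \<Longrightarrow> sum (measure lborel) D < r \<Longrightarrow>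
           (\<Sum>k\<in>D. norm (f (Sup k) - f (Inf k))) < e * (b - a)"
        using abs_continuous_on_division[OF ac \<open>e * (b - a) > 0\<close>] by metis
      obtain G where G: "open G" "N \<subseteq> G" "G - N \<in> lmeasurable" "emeasure lebesgue (G - N) < ennreal r"
        using sets_lebesgue_outer_open[OF Nsets r(1)] by blast
      have NN: "N \<in> null_sets lebesgue" using neg by (simp add: negligible_iff_null_sets)
      have Gs: "G \<in> sets lebesgue" using G(1) by simp
      have "emeasure lebesgue G = emeasure lebesgue (G - N)"
        using emeasure_Diff_null_set[OF NN Gs] by simp
      then have Gm: "emeasure lebesgue G < ennreal r" using G(4) by simp
      have "\<forall>x. \<exists>d>0. x \<in> {a..b} - N \<longrightarrow>
         (\<forall>y. norm (y-x) < d \<longrightarrow> norm (f y - f x - (y-x) *\<^sub>R h x) \<le> e * norm (y-x))"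
      proof (intro allI)
          fix x
          show "\<exists>d>0. x \<in> {a..b} - N \<longrightarrow>
           (\<forall>y. norm (y-x) < d \<longrightarrow> norm (f y - f x - (y-x) *\<^sub>R h x) \<le> e * norm (y-x))"
          proof (cases "x \<in> {a..b} - N")
            case True
            then show ?thesis using der[OF True] e
              unfolding has_vector_derivative_def has_derivative_at_alt h_def by auto
          qed (auto intro: zero_less_one)
        qed
      then obtain d where d: "\<And>x. 0 < d x"
                 "\<And>x y. \<lbrakk>x \<in> {a..b} - N; norm (y-x) < d x\<rbrakk>
                        \<Longrightarrow> norm (f y - f x - (y-x) *\<^sub>R h x) \<le> e * norm (y-x)"
        by metis
      define \<gamma> where "\<gamma> = (\<lambda>x. if x \<in> N then G else ball x (d x))"
      have gau: "Tagged_Division.gauge \<gamma>"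
        using G d(1) by (auto simp: Tagged_Division.gauge_def \<gamma>_def)
      moreover have "norm (sum (\<lambda>(x,k). measure lborel k *\<^sub>R h x) p - (f b - f a)) \<le> e0 * measure lborel {a..b}"
        if p: "p tagged_division_of {a..b}" and fine: "\<gamma> fine p" for p
      proof -
        note pD = tagged_division_ofD[OF p]
        define P where "P = {xk \<in> p. fst xk \<in> N}"
        have Pp: "P \<subseteq> p" by (auto simp: P_def)
        have finp: "finite p" using pD by blast
        have rep: "\<exists>u v. k = {u..v} \<and> u \<le> v \<and> u \<in> k \<and> v \<in> k" if xkp: "(x,k) \<in> p" for x k
        proof -
          obtain u v where k: "k = cbox u v" using pD(4)[OF xkp] by blast
          moreover have "x \<in> k" using pD(2)[OF xkp] by blast
          ultimately have "k = {u..v} \<and> u \<le> v \<and> u \<in> k \<and> v \<in> k" by auto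
          then show ?thesis by blast
        qed
        have ba: "(\<Sum>(x,K)\<in>p. measure lborel K) = b - a"
          using additive_content_tagged_division[of p a b] p ab by (simp only: box_real measure_lborel_Icc)
        have fba: "f b - f a = (\<Sum>(x,K)\<in>p. f(Sup K) - f(Inf K))"
          by (rule additive_tagged_division_1[OF ab p, symmetric])
        have Ptd: "P tagged_division_of (\<Union>(snd ` P))"
        proof -
          have "p tagged_partial_division_of {a..b}" using p unfolding tagged_division_of_def by simp
          from tagged_partial_division_of_Union_self[OF tagged_partial_division_subset[OF this Pp]]
          show ?thesis .
        qed
        have Pdiv: "(snd ` P) division_of (\<Union>(snd ` P))"
          by (rule division_of_tagged_division[OF Ptd])
        have PG: "\<Union>(snd ` P) \<subseteq> G" using fine by (force simp: P_def \<gamma>_def fine_def)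
        have Pab: "\<Union>(snd ` P) \<subseteq> {a..b}" using pD(3) Pp by force
        have "sum (measure lborel) (snd ` P) = measure lebesgue (\<Union>(snd ` P))"
        proof -
          have "measure lborel k = measure lebesgue k" if k: "k \<in> snd ` P" for k
          proof -
            obtain u v where "k = cbox u v" using division_ofD(4)[OF Pdiv k] by blast
            then show ?thesis by simp
          qed
          then have "sum (measure lborel) (snd ` P) = sum (measure lebesgue) (snd ` P)" by (rule sum.cong[OF refl])
          then show ?thesis using content_division[OF Pdiv] by (rule trans)
        qed
        also have "\<dots> < r"
        proof -
          have "emeasure lebesgue (\<Union>(snd ` P)) \<le> emeasure lebesgue G"
            by (rule emeasure_mono[OF PG Gs])
          then have *: "emeasure lebesgue (\<Union>(snd ` P)) < ennreal r" using Gm by simp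
          then have "emeasure lebesgue (\<Union>(snd ` P)) \<noteq> top" by auto
          then have "emeasure lebesgue (\<Union>(snd ` P)) = ennreal (measure lebesgue (\<Union>(snd ` P)))"
            by (rule emeasure_eq_ennreal_measure)
          then show ?thesis using * by (simp add: ennreal_less_iff)
        qed
        finally have 1: "(\<Sum>k\<in>snd ` P. norm (f (Sup k) - f (Inf k))) < e * (b - a)"
          using r(2)[OF Pdiv Pab] by blast
        have 2: "(\<Sum>(x,k)\<in>P. norm (f (Sup k) - f (Inf k))) = (\<Sum>k\<in>snd ` P. norm (f (Sup k) - f (Inf k)))"
        proof -
          define d' where "d' = (\<lambda>k. if k = {} then 0 else norm (f (Sup k) - f (Inf k)))"
          have ne: "k \<noteq> {}" if "k \<in> snd ` P" for k using that Pp pD(2) by force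
          have "(\<Sum>(x,k)\<in>P. d' k) = (\<Sum>k\<in>snd ` P. d' k)"
          proof (rule sum.over_tagged_division_lemma[OF Ptd])
            fix u v :: real assume "box u v = {}"
            then show "d' (cbox u v) = 0" by (cases "u = v") (auto simp: d'_def)
          qed
          moreover have "(\<Sum>(x,k)\<in>P. d' k) = (\<Sum>(x,k)\<in>P. norm (f (Sup k) - f (Inf k)))"
            by (rule sum.cong) (use ne in \<open>force simp: d'_def\<close>)+
          moreover have "(\<Sum>k\<in>snd ` P. d' k) = (\<Sum>k\<in>snd ` P. norm (f (Sup k) - f (Inf k)))"
            by (rule sum.cong) (use ne in \<open>auto simp: d'_def\<close>)
          ultimately show ?thesis by simp
        qed
        have 3: "norm (measure lborel k *\<^sub>R h x - (f (Sup k) - f (Inf k))) \<le> e * measure lborel k"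
          if xk: "(x,k) \<in> p - P" for x k
        proof -
          obtain u v where k: "k = {u..v}" "u \<le> v" "u \<in> k" "v \<in> k" using rep xk by blast
          have xp: "(x,k) \<in> p" using xk by simp
          have "x \<in> k" "k \<subseteq> {a..b}" using pD(2)[OF xp] pD(3)[OF xp] by auto
          then have xN: "x \<in> {a..b} - N" "x \<in> k" using xk by (auto simp: P_def)
          have "k \<subseteq> ball x (d x)" using fineD[OF fine xp] xN by (simp add: \<gamma>_def)
          then have "norm (u - x) < d x" "norm (v - x) < d x" using k by (auto simp: dist_norm norm_minus_commute)
          note * = d(2)[OF xN(1) this(1)] d(2)[OF xN(1) this(2)]
          have "norm ((v - u) *\<^sub>R h x - (f v - f u)) = norm ((f u - f x - (u - x) *\<^sub>R h x) - (f v - f x - (v - x) *\<^sub>R h x))"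
            by (simp add: algebra_simps)
          also have "\<dots> \<le> e * norm (u-x) + e * norm (v-x)"
            by (rule order_trans[OF norm_triangle_ineq4 add_mono[OF *]])
          also have "\<dots> = e * (v - u)" using xN(2) k by (simp add: algebra_simps)
          finally show ?thesis using k by simp
        qed
        have "sum (\<lambda>(x,k). measure lborel k *\<^sub>R h x) p - (f b - f a) = (\<Sum>(x,k)\<in>p. measure lborel k *\<^sub>R h x - (f (Sup k) - f (Inf k)))"
          unfolding fba by (simp add: sum_subtractf split_def)
        also have "\<dots> = (\<Sum>(x,k)\<in>p-P. measure lborel k *\<^sub>R h x - (f (Sup k) - f (Inf k))) + (\<Sum>(x,k)\<in>P. measure lborel k *\<^sub>R h x - (f (Sup k) - f (Inf k)))"
          using sum.subset_diff[OF Pp finp] by blast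
        also have "norm \<dots> \<le> (\<Sum>(x,k)\<in>p-P. e * measure lborel k) + (\<Sum>(x,k)\<in>P. norm (f (Sup k) - f (Inf k)))"
        proof (rule norm_triangle_mono)
          show "norm (\<Sum>(x,k)\<in>p-P. measure lborel k *\<^sub>R h x - (f (Sup k) - f (Inf k))) \<le> (\<Sum>(x,k)\<in>p-P. e * measure lborel k)"
            by (rule sum_norm_le) (use 3 in auto)
          show "norm (\<Sum>(x,k)\<in>P. measure lborel k *\<^sub>R h x - (f (Sup k) - f (Inf k))) \<le> (\<Sum>(x,k)\<in>P. norm (f (Sup k) - f (Inf k)))"
            by (rule sum_norm_le) (auto simp: P_def h_def norm_minus_commute)
        qed
        also have "\<dots> \<le> (\<Sum>(x,k)\<in>p. e * measure lborel k) + e * (b - a)"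
        proof (rule add_mono)
          show "(\<Sum>(x,k)\<in>p-P. e * measure lborel k) \<le> (\<Sum>(x,k)\<in>p. e * measure lborel k)"
            by (rule sum_mono2) (use finp e in auto)
        qed (use 1 2 in simp)
        also have "(\<Sum>(x,k)\<in>p. e * measure lborel k) = e * (b - a)"
          using ba by (simp add: sum_distrib_left[symmetric] split_def)
        finally show ?thesis using ab by (simp add: e_def field_simps)
      qed
      ultimately show ?thesis by (intro exI[of _ \<gamma>] conjI allI impI) auto
    qed
  qed
  then show ?thesis
    by (rule has_integral_spike[OF neg, rotated]) (simp add: h_def)
qed


text \<open>Absolute integrability is what allows the velocity to be multiplied by the bounded curve
  in the action integral. On intervals shorter than \<open>r\<close> the modulus of absolute
  continuity bounds the variation of the primitive by 1, and finitely many such intervals fill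
  \<open>{a..b}\<close>.\<close>

lemma AC_absolutely_integrable:
  fixes f :: "real \<Rightarrow> 'a::euclidean_space"
  assumes ac: "abs_continuous_on a b f" and ab: "a \<le> b" and neg: "negligible N"
    and der: "\<And>t. t \<in> {a..b} - N \<Longrightarrow> (f has_vector_derivative g t) (at t)"
  shows "g absolutely_integrable_on {a..b}"
proof -
  obtain r where r: "r > 0"
    "\<And>D S. D division_of S \<Longrightarrow> S \<subseteq> {a..b} \<Longrightarrow> sum (measure lborel) D < r \<Longrightarrow>
           (\<Sum>k\<in>D. norm (f (Sup k) - f (Inf k))) < 1"
    using abs_continuous_on_division[OF ac zero_less_one] by metis
  have sub: "(g has_integral (f v - f u)) {u..v}" if "a \<le> u" "u \<le> v" "v \<le> b" for u v
    by (rule AC_FTC[OF abs_continuous_on_subset[OF ac] _ neg]) (use that der in auto)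
  have step: "g absolutely_integrable_on {u..v}" if uv: "a \<le> u" "u \<le> v" "v \<le> b" "v - u < r" for u v
  proof -
    have "g absolutely_integrable_on cbox u v"
    proof (rule bounded_variation_absolutely_integrable_interval[where B=1])
      show "g integrable_on cbox u v" using sub[of u v] uv by auto
      fix D assume D: "D division_of cbox u v"
      have "sum (measure lborel) D = v - u" using additive_content_division[OF D] uv by simp
      then have le: "(\<Sum>k\<in>D. norm (f (Sup k) - f (Inf k))) < 1"
        using r(2)[OF D] uv by auto
      have "norm (integral k g) = norm (f (Sup k) - f (Inf k))" if k: "k \<in> D" for k
      proof -
        obtain s t where st: "k = cbox s t" using division_ofD(4)[OF D k] by blast
        have "k \<noteq> {}" "k \<subseteq> cbox u v" using division_ofD(2,3)[OF D k] by auto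
        then have le: "s \<le> t" "u \<le> s" "t \<le> v" using st by auto
        then have "integral k g = f t - f s" using sub[of s t] uv st by (simp add: integral_unique)
        then show ?thesis using st le by simp
      qed
      then show "(\<Sum>k\<in>D. norm (integral k g)) \<le> 1" using le by simp
    qed
    then show ?thesis by simp
  qed
  have ind: "g absolutely_integrable_on {a..min b (a + real n * (r/2))}" for n
  proof (induction n)
    case 0
    show ?case using ab step[of a a] r(1) by simp
  next
    case (Suc n)
    define u where "u = min b (a + real n * (r/2))"
    define v where "v = min b (a + real (Suc n) * (r/2))"
    define w where "w = a + real n * (r/2)"
    have w: "a \<le> w" "u = min b w" "v = min b (w + r/2)"
      using r(1) by (auto simp: u_def v_def w_def algebra_simps add_divide_distrib)
    have uv: "a \<le> u" "u \<le> v" "v \<le> b" "v - u < r"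
      using ab r(1) w by (auto simp: min_def)
    have "g absolutely_integrable_on ({a..u} \<union> {u..v})"
      by (rule absolutely_integrable_Un) (use Suc step[OF uv] in \<open>auto simp: u_def\<close>)
    moreover have "{a..u} \<union> {u..v} = {a..v}" using uv by auto
    ultimately show ?case by (simp add: v_def)
  qed
  obtain n where "real n > (b - a) / (r/2)" using reals_Archimedean2 by blast
  then have "b - a < real n * (r/2)" using r(1) by (simp add: field_simps)
  then have "min b (a + real n * (r/2)) = b" by simp
  then show ?thesis using ind[of n] by simp
qed

lemma AC_imp_continuous_on:
  fixes f :: "real \<Rightarrow> 'a::real_normed_vector"
  assumes "abs_continuous_on a b f"
  shows "continuous_on {a..b} f"
  unfolding continuous_on_iff
proof (intro ballI allI impI)
  fix x e :: real assume x: "x \<in> {a..b}" and "e > 0"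
  then obtain d where d: "d > 0"
    "\<And>I. nonoverlapping a b I \<Longrightarrow> (\<Sum>(u,v)\<in>I. v - u) < d \<Longrightarrow> (\<Sum>(u,v)\<in>I. norm (f v - f u)) < e"
    using abs_continuous_onE[OF assms] by metis
  have "dist (f y) (f x) < e" if y: "y \<in> {a..b}" "dist y x < d" for y
    using d(2)[of "{(min x y, max x y)}"] x y
    by (cases "x \<le> y") (auto simp: nonoverlapping_def dist_norm min_def max_def norm_minus_commute)
  then show "\<exists>d>0. \<forall>y\<in>{a..b}. dist y x < d \<longrightarrow> dist (f y) (f x) < e" using d(1) by blast
qed

lemma AC_dominated:
  assumes "abs_continuous_on a b f" and "C \<ge> 0"
    and le: "\<And>u v. a \<le> u \<Longrightarrow> u \<le> v \<Longrightarrow> v \<le> b \<Longrightarrow> norm (g v - g u) \<le> C * norm (f v - f u)"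
  shows "abs_continuous_on a b g"
  unfolding abs_continuous_on_iff
proof (intro allI impI)
  fix e :: real assume "e > 0"
  then have "e / (C + 1) > 0" using assms(2) by simp
  then obtain r where r: "r > 0"
    "\<And>I. nonoverlapping a b I \<Longrightarrow> (\<Sum>(u,v)\<in>I. v - u) < r \<Longrightarrow> (\<Sum>(u,v)\<in>I. norm (f v - f u)) < e / (C + 1)"
    using abs_continuous_onE[OF assms(1)] by metis
  have "(\<Sum>(u,v)\<in>I. norm (g v - g u)) < e" if I: "nonoverlapping a b I \<and> (\<Sum>(u,v)\<in>I. v - u) < r" for I
  proof -
    have "(\<Sum>(u,v)\<in>I. norm (g v - g u)) \<le> (\<Sum>(u,v)\<in>I. C * norm (f v - f u))"
      by (rule sum_mono) (use I le in \<open>auto simp: nonoverlapping_def\<close>)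
    also have "\<dots> = C * (\<Sum>(u,v)\<in>I. norm (f v - f u))"
      by (simp add: sum_distrib_left split_def)
    also have "\<dots> \<le> C * (e / (C + 1))"
      by (rule mult_left_mono) (use r(2)[of I] I assms(2) in auto)
    also have "\<dots> < e" using assms(2) \<open>e > 0\<close> by (simp add: field_simps)
    finally show ?thesis .
  qed
  then show "\<exists>r>0. \<forall>I. nonoverlapping a b I \<and> (\<Sum>(u,v)\<in>I. v - u) < r \<longrightarrow> (\<Sum>(u,v)\<in>I. norm (g v - g u)) < e"
    using r(1) by blast
qed

lemma AC_lipschitz:
  assumes "C \<ge> 0"
    and le: "\<And>u v. a \<le> u \<Longrightarrow> u \<le> v \<Longrightarrow> v \<le> b \<Longrightarrow> norm (g v - g u) \<le> C * (v - u)"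
  shows "abs_continuous_on a b g"
proof (rule AC_dominated[where f="\<lambda>x::real. x" and C=C])
  show "abs_continuous_on a b (\<lambda>x::real. x)"
    unfolding abs_continuous_on_iff
  proof (intro allI impI)
    fix e :: real assume e: "e > 0"
    have "(\<Sum>(u,v)\<in>I. norm (v - u)) = (\<Sum>(u,v)\<in>I. v - u)" if "nonoverlapping a b I" for I
      by (rule sum.cong) (use that in \<open>auto simp: nonoverlapping_def\<close>)
    then show "\<exists>d>0. \<forall>I. nonoverlapping a b I \<and> (\<Sum>(u,v)\<in>I. v - u) < d \<longrightarrow> (\<Sum>(u,v)\<in>I. norm (v - u)) < e"
      using e by (intro exI[of _ e]) auto
  qed
qed (use assms in auto)

section \<open>Gauges and the lower bound for the action\<close>

lemma gauge_le_1:
  assumes "w \<in> C" shows "gauge C w \<le> 1"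
  unfolding gauge_def
proof (rule cInf_lower)
  show "1 \<in> {t. t \<ge> 0 \<and> w \<in> (\<lambda>w. t *\<^sub>R w) ` C}" using assms by auto
  show "bdd_below {t. t \<ge> 0 \<and> w \<in> (\<lambda>w. t *\<^sub>R w) ` C}" by (rule bdd_belowI[of _ 0]) auto
qed

lemma gauge_nonempty:
  fixes C :: "'a::real_normed_vector set"
  assumes "0 \<in> interior C"
  shows "{t. t \<ge> 0 \<and> z \<in> (\<lambda>w. t *\<^sub>R w) ` C} \<noteq> {}"
proof -
  obtain e where e: "e > 0" "ball 0 e \<subseteq> C" using assms by (auto simp: mem_interior)
  define t where "t = 2 * norm z / e + 1"
  have t: "t > 0" using e by (simp add: t_def add_nonneg_pos)
  have "norm z < e * t" using e by (simp add: t_def algebra_simps)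
     (smt (verit) norm_ge_zero)
  then have "norm (z /\<^sub>R t) < e" using t by (simp add: field_simps)
  then have "z /\<^sub>R t \<in> C" using e by auto
  moreover have "z = t *\<^sub>R (z /\<^sub>R t)" using t by simp
  ultimately show ?thesis using t by (metis (mono_tags, lifting) empty_iff image_eqI less_imp_le mem_Collect_eq)
qed

text \<open>Dividing \<open>z\<close> by admissible scales that tend to 1 gives points of
  \<open>C\<close> that tend to \<open>z\<close>, and \<open>C\<close> is closed.\<close>

lemma gauge_eq_1_mem:
  fixes C :: "'a::real_normed_vector set"
  assumes "closed C" "0 \<in> interior C" "gauge C z = 1"
  shows "z \<in> C"
proof (rule ccontr)
  assume "z \<notin> C"
  then have "z \<in> - C" "open (- C)" using assms(1) by auto
  then obtain e where e: "e > 0" "ball z e \<subseteq> - C" using open_contains_ball by blast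
  define d where "d = e / (norm z + 1)"
  have d: "d > 0" using e by (simp add: d_def add_nonneg_pos)
  let ?S = "{t. t \<ge> 0 \<and> z \<in> (\<lambda>w. t *\<^sub>R w) ` C}"
  have bdd: "bdd_below ?S" by (rule bdd_belowI[of _ 0]) auto
  have "Inf ?S < 1 + d" using assms(3) d by (simp add: gauge_def)
  then obtain t where t: "t \<in> ?S" "t < 1 + d"
    using cInf_less_iff[OF gauge_nonempty[OF assms(2)] bdd] by blast
  have "1 \<le> t" using cInf_lower[OF t(1) bdd] assms(3) by (simp add: gauge_def)
  obtain w where w: "w \<in> C" "z = t *\<^sub>R w" using t by auto
  have "norm (z - w) = (t - 1) * norm w"
    using w \<open>1 \<le> t\<close> by (metis abs_of_nonneg diff_ge_0_iff_ge norm_scaleR scaleR_left_diff_distrib scaleR_one)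
  also have "\<dots> \<le> (t - 1) * norm z"
    using w \<open>1 \<le> t\<close> by (intro mult_left_mono) (auto simp: mult_le_cancel_right1)
  also have "\<dots> \<le> d * norm z" using t by (intro mult_right_mono) auto
  also have "\<dots> < e"
  proof -
    have "e * norm z < e * (norm z + 1)" using e by simp
    then have "e * norm z / (norm z + 1) < e" by (subst pos_divide_less_eq) (auto intro: add_nonneg_pos)
    then show ?thesis by (simp add: d_def)
  qed
  finally have "w \<in> ball z e" by (simp add: dist_norm)
  then show False using e w by auto
qed

text \<open>An outer normal scaled to take the value 1 at \<open>z\<close> is a linear functional
  that lies below the gauge and agrees with it at \<open>z\<close>. This turns supporting
  hyperplanes into admissible velocities when orbits are constructed.\<close>

lemma support_gauge:
  fixes C :: "'a::real_inner set"
  assumes int: "0 \<in> interior C" and z: "z \<in> C" and n: "n \<noteq> 0" and sup: "\<And>w. w \<in> C \<Longrightarrow> inner n w \<le> inner n z"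
  shows "inner n z > 0" "gauge C z = 1" "n /\<^sub>R inner n z \<in> subdiff (gauge C) z"
proof -
  obtain e where e: "e > 0" "ball 0 e \<subseteq> C" using int by (auto simp: mem_interior)
  have "(e / (2 * norm n)) *\<^sub>R n \<in> C" using e n by (intro subsetD[OF e(2)]) simp
  from sup[OF this] have "e / 2 * norm n \<le> inner n z"
    using n by (simp add: dot_square_norm power2_eq_square)
  moreover have "e / 2 * norm n > 0" using e n by simp
  ultimately show pos: "inner n z > 0" by linarith
  have ge: "inner n w / inner n z \<le> gauge C w" for w
    unfolding gauge_def
  proof (rule cInf_greatest[OF gauge_nonempty[OF int]])
    fix t assume "t \<in> {t. t \<ge> 0 \<and> w \<in> (\<lambda>w. t *\<^sub>R w) ` C}"
    then obtain v where v: "t \<ge> 0" "v \<in> C" "w = t *\<^sub>R v" by auto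
    have "inner n w = t * inner n v" using v by simp
    also have "\<dots> \<le> t * inner n z" using v sup by (intro mult_left_mono) auto
    finally show "inner n w / inner n z \<le> t" using pos by (simp add: field_simps)
  qed
  show one: "gauge C z = 1"
    using ge[of z] gauge_le_1[OF z] pos by simp
  show "n /\<^sub>R inner n z \<in> subdiff (gauge C) z"
    unfolding subdiff_def
  proof (intro CollectI allI)
    fix w
    have "inner (n /\<^sub>R inner n z) (w - z) = inner n w / inner n z - 1"
      using pos by (simp add: inner_diff_right field_simps)
    then show "gauge C z + inner (n /\<^sub>R inner n z) (w - z) \<le> gauge C w"
      using ge[of w] one by simp
  qed
qed

text \<open>The function is nondecreasing by \<open>AC_FTC\<close> and returns to its initial value,
  so it is constant on the period. In \<open>characteristic_lower\<close> this is applied first to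
  the momentum and then to the position.\<close>

lemma AC_mono_const:
  fixes g :: "real \<Rightarrow> real"
  assumes ac: "abs_continuous_on 0 1 g" and neg: "negligible N"
    and der: "\<And>t. t \<in> {0..1} - N \<Longrightarrow> (g has_vector_derivative g' t) (at t)"
    and nn: "\<And>t. t \<in> {0..1} - N \<Longrightarrow> 0 \<le> g' t"
    and per: "g 1 = g 0" and t: "t \<in> {0<..<1} - N"
  shows "g' t = 0"
proof -
  define h where "h = (\<lambda>t. if t \<in> N then 0 else g' t)"
  have mono: "g u \<le> g v" if "0 \<le> u" "u \<le> v" "v \<le> 1" for u v
  proof -
    have "(g' has_integral (g v - g u)) {u..v}"
      by (rule AC_FTC[OF abs_continuous_on_subset[OF ac] _ neg]) (use that der in auto)
    then have "(h has_integral (g v - g u)) {u..v}"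
      by (rule has_integral_spike[OF neg, rotated]) (simp add: h_def)
    then have "0 \<le> g v - g u"
      by (rule has_integral_nonneg) (use nn that in \<open>auto simp: h_def\<close>)
    then show ?thesis by simp
  qed
  have const: "g s = g 0" if "s \<in> {0<..<1}" for s
    using mono[of 0 s] mono[of s 1] per that by auto
  have "((\<lambda>_. g 0) has_vector_derivative g' t) (at t)"
    by (rule has_vector_derivative_transform_within_open[of g _ _ "{0<..<1}"])
       (use der t const in auto)
  then show ?thesis
    using vector_derivative_unique_at has_vector_derivative_const by blast
qed

text \<open>A subgradient at a point where the gauge is 1 is an outer normal there. After applying
  J, the position velocity is normal to \<open>T\<close> at the momentum, and minus the momentum
  velocity is normal to \<open>K\<close> at the position.\<close>

lemma characteristic_derivative:
  assumes ch: "closed_characteristic (K \<times> T) x" and K: "compact K" "0 \<in> interior K"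
    and T: "compact T" "0 \<in> interior T"
  obtains N where "negligible N"
    "\<And>t. t \<in> {0..1} - N \<Longrightarrow> (x has_vector_derivative (vector_derivative x (at t))) (at t)"
    "\<And>t. t \<in> {0..1} - N \<Longrightarrow> vector_derivative x (at t) \<noteq> 0"
    "\<And>t y. t \<in> {0..1} - N \<Longrightarrow> y \<in> T \<Longrightarrow>
       inner (fst (vector_derivative x (at t))) y \<le> inner (fst (vector_derivative x (at t))) (snd (x t))"
    "\<And>t y. t \<in> {0..1} - N \<Longrightarrow> y \<in> K \<Longrightarrow>
       inner (snd (vector_derivative x (at t))) y \<ge> inner (snd (vector_derivative x (at t))) (fst (x t))"
proof -
  let ?C = "K \<times> T"
  have int: "(0::R4) \<in> interior ?C" using K T by (simp add: interior_Times zero_prod_def)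
  have cl: "closed ?C" using K T by (simp add: closed_Times compact_imp_closed)
  have g1: "gauge ?C (x t) = 1" for t using ch by (simp add: closed_characteristic_def)
  have mem: "x t \<in> ?C" for t by (rule gauge_eq_1_mem[OF cl int g1])
  let ?P = "\<lambda>t. t \<in> {0..1} \<longrightarrow> (\<exists>v. (x has_vector_derivative v) (at t)
               \<and> (\<exists>c>0. \<exists>p\<in>subdiff (gauge ?C) (x t). v = c *\<^sub>R Jmap p))"
  have "AE t in lborel. ?P t" using ch by (simp add: closed_characteristic_def)
  then obtain N where N: "N \<in> null_sets lborel" "{t \<in> space lborel. \<not> ?P t} \<subseteq> N"
    by (auto simp: eventually_ae_filter)
  have neg: "negligible N" using N(1) by (simp add: negligible_iff_null_sets null_sets_completionI)
  have key: "(x has_vector_derivative (vector_derivative x (at t))) (at t) \<and>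
     (\<exists>c>0. \<exists>p\<in>subdiff (gauge ?C) (x t). vector_derivative x (at t) = c *\<^sub>R Jmap p)"
    if tt: "t \<in> {0..1} - N" for t
  proof -
    have "?P t"
    proof (rule ccontr)
      assume np: "\<not> ?P t"
      have "t \<in> {t \<in> space lborel. \<not> ?P t}"
        by (rule CollectI, rule conjI[OF _ np]) simp
      then have "t \<in> N" by (rule subsetD[OF N(2)])
      then show False using tt by simp
    qed
    then obtain v where "(x has_vector_derivative v) (at t)"
       "\<exists>c>0. \<exists>p\<in>subdiff (gauge ?C) (x t). v = c *\<^sub>R Jmap p" using tt by blast
    then show ?thesis using vector_derivative_at[of x v t] by simp
  qed
  have sd: "inner p w \<le> inner p z" "inner p z \<ge> 1"
    if "p \<in> subdiff (gauge ?C) z" "gauge ?C z = 1" "w \<in> ?C" for p z w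
  proof -
    have *: "gauge ?C w \<ge> gauge ?C z + inner p (w - z)" for w using that(1) unfolding subdiff_def by blast
    have "gauge ?C w \<le> 1" by (rule gauge_le_1[OF that(3)])
    then show "inner p w \<le> inner p z" using *[of w] that(2) by (simp add: inner_diff_right)
    \<comment> \<open>Testing the subgradient at the origin gives \<open>inner p z \<ge> 1\<close>,
      which makes \<open>p\<close> and with it the velocity nonzero.\<close>
    have "gauge ?C 0 \<le> 0"
      unfolding gauge_def
    proof (rule cInf_lower)
      show "0 \<in> {t. t \<ge> 0 \<and> 0 \<in> (\<lambda>w. t *\<^sub>R w) ` ?C}"
        using that(3) by (auto intro!: image_eqI[where x=w])
      show "bdd_below {t. t \<ge> 0 \<and> 0 \<in> (\<lambda>w. t *\<^sub>R w) ` ?C}" by (rule bdd_belowI[of _ 0]) auto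
    qed
    then show "inner p z \<ge> 1" using *[of 0] that(2) by simp
  qed
  show thesis
  proof (rule that[OF neg])
    fix t assume t: "t \<in> {0..1} - N"
    obtain c p where cp: "c > 0" "p \<in> subdiff (gauge ?C) (x t)" "vector_derivative x (at t) = c *\<^sub>R Jmap p"
      using key[OF t] by blast
    have D: "fst (vector_derivative x (at t)) = c *\<^sub>R snd p" "snd (vector_derivative x (at t)) = - (c *\<^sub>R fst p)"
      using cp by (auto simp: Jmap_def)
    show "(x has_vector_derivative (vector_derivative x (at t))) (at t)" using key[OF t] by blast
    have "p \<noteq> 0" using sd(2)[OF cp(2) g1 mem[of t]] by auto
    then show "vector_derivative x (at t) \<noteq> 0"
      using D cp(1) by (metis fst_zero neg_equal_0_iff_equal order_less_irrefl prod.expand scaleR_eq_0_iff snd_zero)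
    show "inner (fst (vector_derivative x (at t))) y \<le> inner (fst (vector_derivative x (at t))) (snd (x t))"
      if "y \<in> T" for y
    proof -
      have "(fst (x t), y) \<in> ?C" using mem[of t] that by (simp add: mem_Times_iff)
      from sd(1)[OF cp(2) g1 this] have "inner (snd p) y \<le> inner (snd p) (snd (x t))"
        by (simp add: inner_prod_def)
      then show ?thesis using cp(1) D by simp
    qed
    show "inner (snd (vector_derivative x (at t))) y \<ge> inner (snd (vector_derivative x (at t))) (fst (x t))"
      if "y \<in> K" for y
    proof -
      have "(y, snd (x t)) \<in> ?C" using mem[of t] that by (simp add: mem_Times_iff)
      from sd(1)[OF cp(2) g1 this] have "inner (fst p) y \<le> inner (fst p) (fst (x t))"
        by (simp add: inner_prod_def)
      then show ?thesis using cp(1) D by simp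
    qed
  qed
qed

lemma interior_support_strict:
  fixes S :: "'a::real_inner set"
  assumes "y \<in> interior S" "n \<noteq> 0" "\<And>w. w \<in> S \<Longrightarrow> inner n w \<le> b"
  shows "inner n y < b"
proof -
  obtain e where e: "e > 0" "ball y e \<subseteq> S" using assms(1) by (auto simp: mem_interior)
  have "y + (e / (2 * norm n)) *\<^sub>R n \<in> S"
    by (rule subsetD[OF e(2)]) (use e assms(2) in \<open>simp add: dist_norm\<close>)
  from assms(3)[OF this] have "inner n y + e / 2 * norm n \<le> b"
    using assms(2) by (simp add: inner_add_right dot_square_norm power2_eq_square)
  moreover have "e / 2 * norm n > 0" using e assms(2) by simp
  ultimately show ?thesis by linarith
qed

text \<open>If a direction \<open>w\<close> pointed inward at every position, the momentum velocity
  would be 0 or have positive product with \<open>w\<close>. Periodicity would make the momentum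
  constant, and then the position velocity would be orthogonal to this constant at some time,
  although it is nonzero and normal to \<open>T\<close>, which has 0 inside. The length estimate
  holds because the momentum maximises the product with the position velocity over
  \<open>T\<close>.\<close>

lemma characteristic_lower:
  assumes ch: "closed_characteristic (K \<times> T) x" and K: "compact K" "0 \<in> interior K"
    and T: "compact T" "0 \<in> interior T"
  defines "q \<equiv> (\<lambda>t. fst (x t))"
  shows "\<And>t. q t \<in> K"
    "\<And>w. \<exists>t\<in>{0..1}. \<forall>e>0. q t + e *\<^sub>R w \<notin> interior K"
    "\<And>r s t p1 p2 p3. 0 \<le> r \<Longrightarrow> r \<le> s \<Longrightarrow> s \<le> t \<Longrightarrow> t \<le> 1 \<Longrightarrow> p1 \<in> T \<Longrightarrow> p2 \<in> T \<Longrightarrow> p3 \<in> T \<Longrightarrow>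
       action x \<ge> inner (q s - q r) p1 + inner (q t - q s) p2 + inner (q r - q t) p3"
proof -
  let ?C = "K \<times> T"
  have int: "(0::R4) \<in> interior ?C" using K T by (simp add: interior_Times zero_prod_def)
  have cl: "closed ?C" using K T by (simp add: closed_Times compact_imp_closed)
  have g1: "gauge ?C (x t) = 1" for t using ch by (simp add: closed_characteristic_def)
  have mem: "x t \<in> ?C" for t by (rule gauge_eq_1_mem[OF cl int g1])
  show qK: "q t \<in> K" for t using mem[of t] by (simp add: q_def mem_Times_iff)
  have ac: "abs_continuous_on 0 1 x" using ch by (simp add: closed_characteristic_def)
  have "x (0 + 1) = x 0" using ch unfolding closed_characteristic_def by blast
  then have per: "x 1 = x 0" by simp
  define p where "p = (\<lambda>t. snd (x t))"
  define Q where "Q = (\<lambda>t. fst (vector_derivative x (at t)))"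
  define P where "P = (\<lambda>t. snd (vector_derivative x (at t)))"
  obtain N where neg: "negligible N" and
    N: "\<And>t. t \<in> {0..1} - N \<Longrightarrow> (x has_vector_derivative (Q t, P t)) (at t)"
    "\<And>t. t \<in> {0..1} - N \<Longrightarrow> (Q t, P t) \<noteq> 0"
    "\<And>t y. t \<in> {0..1} - N \<Longrightarrow> y \<in> T \<Longrightarrow> inner (Q t) y \<le> inner (Q t) (p t)"
    "\<And>t y. t \<in> {0..1} - N \<Longrightarrow> y \<in> K \<Longrightarrow> inner (P t) y \<ge> inner (P t) (q t)"
    using characteristic_derivative[OF ch K T]
    unfolding Q_def P_def p_def q_def prod.collapse by metis
  have dq: "(q has_vector_derivative Q t) (at t)" and dp: "(p has_vector_derivative P t) (at t)"
    if "t \<in> {0..1} - N" for t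
    using bounded_linear.has_vector_derivative[OF bounded_linear_fst N(1)[OF that]]
      bounded_linear.has_vector_derivative[OF bounded_linear_snd N(1)[OF that]]
    by (simp_all add: q_def p_def)
  have acq: "abs_continuous_on 0 1 q"
    by (rule AC_dominated[OF ac, of 1]) (simp_all add: q_def flip: fst_diff, metis norm_fst_le prod.collapse)
  have acp: "abs_continuous_on 0 1 p"
    by (rule AC_dominated[OF ac, of 1]) (simp_all add: p_def flip: snd_diff, metis norm_snd_le prod.collapse)
  have acqw: "abs_continuous_on 0 1 (\<lambda>t. inner (q t) w)" for w
    by (rule AC_dominated[OF acq, of "norm w"])
       (simp_all add: flip: inner_diff_left, metis Cauchy_Schwarz_ineq2 mult.commute)
  have acpw: "abs_continuous_on 0 1 (\<lambda>t. inner (p t) w)" for w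
    by (rule AC_dominated[OF acp, of "norm w"])
       (simp_all add: flip: inner_diff_left, metis Cauchy_Schwarz_ineq2 mult.commute)
  have dqw: "((\<lambda>t. inner (q t) w) has_vector_derivative inner (Q t) w) (at t)"
    and dpw: "((\<lambda>t. inner (p t) w) has_vector_derivative inner (P t) w) (at t)"
    if "t \<in> {0..1} - N" for t w
    using bounded_linear.has_vector_derivative[OF bounded_linear_inner_left dq[OF that]]
      bounded_linear.has_vector_derivative[OF bounded_linear_inner_left dp[OF that]] by blast+

  show "\<exists>t\<in>{0..1}. \<forall>e>0. q t + e *\<^sub>R w \<notin> interior K" for w
  proof (rule ccontr)
    assume "\<not> (\<exists>t\<in>{0..1}. \<forall>e>0. q t + e *\<^sub>R w \<notin> interior K)"
    then have w: "\<And>t. t \<in> {0..1} \<Longrightarrow> \<exists>e>0. q t + e *\<^sub>R w \<in> interior K" by blast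
    have Pw: "P t = 0 \<or> inner (P t) w > 0" if t: "t \<in> {0..1} - N" for t
    proof (rule disjCI)
      assume nz: "\<not> inner (P t) w > 0"
      obtain e where e: "e > 0" "q t + e *\<^sub>R w \<in> interior K" using w t by blast
      show "P t = 0"
      proof (rule ccontr)
        assume "P t \<noteq> 0"
        have "inner (- P t) (q t + e *\<^sub>R w) < inner (- P t) (q t)"
          by (rule interior_support_strict[OF e(2)]) (use \<open>P t \<noteq> 0\<close> N(4)[OF t] in auto)
        then have "e * inner (P t) w > 0" by (simp add: inner_add_right)
        then show False using nz e by (simp add: zero_less_mult_iff)
      qed
    qed
    have P0: "P t = 0" if t: "t \<in> {0<..<1} - N" for t
    proof -
      have "inner (P t) w = 0"
        by (rule AC_mono_const[OF acpw neg dpw _ _ t]) (use Pw per in \<open>force simp: p_def\<close>)+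
      then show ?thesis using Pw[of t] t by auto
    qed
    have pc: "p t = p 0" if t: "t \<in> {0..1}" for t
    proof -
      have "(P has_integral (p t - p 0)) {0..t}"
        by (rule AC_FTC[OF abs_continuous_on_subset[OF acp] _ neg]) (use t dp in auto)
      moreover have "(P has_integral 0) {0..t}"
      proof (rule has_integral_spike[where S="N \<union> {0,1}" and f="\<lambda>_. 0"])
        show "negligible (N \<union> {0,1})" using neg by simp
      qed (use P0 t in auto)
      ultimately have "p t - p 0 = 0" by (rule has_integral_unique)
      then show ?thesis by simp
    qed
    have "\<not> negligible ({0<..<1} :: real set)" using open_not_negligible[of "{0<..<1::real}"] by auto
    then have "\<not> {0<..<1} \<subseteq> N" using neg negligible_subset by blast
    then obtain t where t: "t \<in> {0<..<1} - N" by blast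
    have Qp: "inner (Q s) (p 0) \<ge> 0" if "s \<in> {0..1} - N" for s
      using N(3)[OF that subsetD[OF interior_subset T(2)]] pc[of s] that by simp
    have "inner (Q t) (p 0) = 0"
      by (rule AC_mono_const[OF acqw neg dqw _ _ t]) (use Qp per in \<open>auto simp: q_def\<close>)
    moreover have "inner (Q t) 0 < inner (Q t) (p 0)"
      by (rule interior_support_strict[OF T(2)])
         (use N(2,3)[of t] P0[OF t] pc[of t] t in \<open>auto simp: zero_prod_def\<close>)
    ultimately show False by simp
  qed

  fix r s t :: real and p1 p2 p3 :: R2
  assume rst: "0 \<le> r" "r \<le> s" "s \<le> t" "t \<le> 1" and pT: "p1 \<in> T" "p2 \<in> T" "p3 \<in> T"
  have cont: "continuous_on {0..1} x" by (rule AC_imp_continuous_on[OF ac])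
  have xm: "x \<in> borel_measurable (lebesgue_on {0..1})"
    by (rule continuous_imp_measurable_on_sets_lebesgue[OF cont]) simp
  have xb: "bounded (x ` {0..1})"
    by (rule compact_imp_bounded[OF compact_continuous_image[OF cont]]) simp
  have Dint: "(\<lambda>t. (Q t, P t)) absolutely_integrable_on {0..1}"
    by (rule AC_absolutely_integrable[OF ac _ neg]) (use N in auto)
  have "bilinear (\<lambda>a b :: R4. inner (snd a) (fst b))"
    by (auto simp: bilinear_def linear_iff inner_add_left inner_add_right)
  from absolutely_integrable_bounded_measurable_product[OF this xm _ xb Dint]
  have i1: "(\<lambda>t. inner (Q t) (p t)) integrable_on {0..1}"
    by (simp add: p_def inner_commute set_lebesgue_integral_eq_integral(1))
  have "bilinear (\<lambda>a b :: R4. inner (fst a) (snd b))"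
    by (auto simp: bilinear_def linear_iff inner_add_left inner_add_right)
  from absolutely_integrable_bounded_measurable_product[OF this xm _ xb Dint]
  have i2: "(\<lambda>t. inner (P t) (q t)) integrable_on {0..1}"
    by (simp add: q_def inner_commute set_lebesgue_integral_eq_integral(1))
  \<comment> \<open>Integration by parts over the period turns the antisymmetric action into the
    integral of \<open>inner (Q t) (p t)\<close> alone.\<close>
  have sum0: "integral {0..1} (\<lambda>t. inner (q t) (P t) + inner (Q t) (p t)) = 0"
  proof -
    obtain B where B: "B > 0" "\<And>t. t \<in> {0..1} \<Longrightarrow> norm (x t) \<le> B"
      using xb bounded_pos[of "x ` {0..1}"] by auto
    have "abs_continuous_on 0 1 (\<lambda>t. inner (q t) (p t))"
    proof (rule AC_dominated[OF ac, of "2 * B"])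
      fix u v :: real assume uv: "0 \<le> u" "u \<le> v" "v \<le> 1"
      have "inner (q v) (p v) - inner (q u) (p u) = inner (q v - q u) (p v) + inner (q u) (p v - p u)"
        by (simp add: inner_diff_left inner_diff_right)
      also have "norm \<dots> \<le> norm (q v - q u) * norm (p v) + norm (q u) * norm (p v - p u)"
        by (smt (verit) Cauchy_Schwarz_ineq2 real_norm_def)
      also have "\<dots> \<le> norm (x v - x u) * B + B * norm (x v - x u)"
      proof (intro add_mono mult_mono)
        show "norm (q v - q u) \<le> norm (x v - x u)" unfolding q_def by (metis fst_diff norm_fst_le prod.collapse)
        show "norm (p v - p u) \<le> norm (x v - x u)" unfolding p_def by (metis snd_diff norm_snd_le prod.collapse)
        show "norm (p v) \<le> B" unfolding p_def using B(2)[of v] uv by (metis atLeastAtMost_iff norm_snd_le order_trans prod.collapse)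
        show "norm (q u) \<le> B" unfolding q_def using B(2)[of u] uv by (metis atLeastAtMost_iff norm_fst_le order_trans prod.collapse)
      qed (use B in auto)
      finally show "norm (inner (q v) (p v) - inner (q u) (p u)) \<le> 2 * B * norm (x v - x u)" by simp
    qed (use B in simp)
    moreover have "((\<lambda>t. inner (q t) (p t)) has_vector_derivative (inner (q t) (P t) + inner (Q t) (p t))) (at t)"
      if "t \<in> {0..1} - N" for t
      by (rule bounded_bilinear.has_vector_derivative[OF bounded_bilinear_inner dq[OF that] dp[OF that]])
    ultimately have "((\<lambda>t. inner (q t) (P t) + inner (Q t) (p t)) has_integral (inner (q 1) (p 1) - inner (q 0) (p 0))) {0..1}"
      by (intro AC_FTC[OF _ _ neg]) auto
    then show ?thesis using per by (simp add: integral_unique q_def p_def)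
  qed
  have act: "action x = integral {0..1} (\<lambda>t. inner (Q t) (p t))"
  proof -
    have "integral {0..1} (\<lambda>t. inner (Jmap (vector_derivative x (at t))) (x t))
       = integral {0..1} (\<lambda>t. inner (P t) (q t) - inner (Q t) (p t))"
      by (simp add: Jmap_def inner_prod_def P_def Q_def q_def p_def)
    also have "\<dots> = integral {0..1} (\<lambda>t. inner (P t) (q t)) - integral {0..1} (\<lambda>t. inner (Q t) (p t))"
      by (rule integral_diff[OF i2 i1])
    finally have 1: "action x = (integral {0..1} (\<lambda>t. inner (Q t) (p t)) - integral {0..1} (\<lambda>t. inner (P t) (q t))) / 2"
      by (simp add: action_def field_simps)
    have "integral {0..1} (\<lambda>t. inner (P t) (q t)) + integral {0..1} (\<lambda>t. inner (Q t) (p t)) = 0"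
      using sum0 integral_add[OF i2 i1] by (simp add: inner_commute)
    then show ?thesis using 1 by simp
  qed
  have seg: "integral {u..v} (\<lambda>t. inner (Q t) (p t)) \<ge> inner (q v - q u) y"
    if uv: "0 \<le> u" "u \<le> v" "v \<le> 1" and y: "y \<in> T" for u v y
  proof -
    have "((\<lambda>t. inner (Q t) y) has_integral (inner (q v) y - inner (q u) y)) {u..v}"
      by (rule AC_FTC[OF abs_continuous_on_subset[OF acqw] _ neg]) (use uv dqw in auto)
    moreover have "((\<lambda>t. inner (Q t) (p t)) has_integral integral {u..v} (\<lambda>t. inner (Q t) (p t))) {u..v}"
      by (rule integrable_integral, rule integrable_on_subinterval[OF i1]) (use uv in auto)
    then have "((\<lambda>t. if t \<in> N then inner (Q t) y else inner (Q t) (p t)) has_integral integral {u..v} (\<lambda>t. inner (Q t) (p t))) {u..v}"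
      by (rule has_integral_spike[OF neg, rotated]) simp
    ultimately have "inner (q v) y - inner (q u) y \<le> integral {u..v} (\<lambda>t. inner (Q t) (p t))"
      by (rule has_integral_le) (use uv N(3) y in auto)
    then show ?thesis by (simp add: inner_diff_left)
  qed
  have sub: "(\<lambda>t. inner (Q t) (p t)) integrable_on {u..1}" if "0 \<le> u" for u
    by (rule integrable_on_subinterval[OF i1]) (use that in auto)
  \<comment> \<open>The third arc passes through the base point of the parametrisation, so it is
    split into \<open>{t..1}\<close> and \<open>{0..r}\<close>, both with \<open>p3\<close>.\<close>
  have "action x = integral {0..r} (\<lambda>t. inner (Q t) (p t)) + integral {r..1} (\<lambda>t. inner (Q t) (p t))"
    unfolding act using Henstock_Kurzweil_Integration.integral_combine[OF _ _ i1, of r] rst by simp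
  also have "integral {r..1} (\<lambda>t. inner (Q t) (p t)) = integral {r..s} (\<lambda>t. inner (Q t) (p t)) + integral {s..1} (\<lambda>t. inner (Q t) (p t))"
    using Henstock_Kurzweil_Integration.integral_combine[OF _ _ sub, of r s] rst by simp
  also have "integral {s..1} (\<lambda>t. inner (Q t) (p t)) = integral {s..t} (\<lambda>t. inner (Q t) (p t)) + integral {t..1} (\<lambda>t. inner (Q t) (p t))"
    using Henstock_Kurzweil_Integration.integral_combine[OF _ _ sub, of s t] rst by simp
  finally have "action x \<ge> inner (q r - q 0) p3 + (inner (q s - q r) p1 + (inner (q t - q s) p2 + inner (q 1 - q t) p3))"
    using seg[of 0 r p3] seg[of r s p1] seg[of s t p2] seg[of t 1 p3] rst pT by linarith
  moreover have "q 1 = q 0" using per by (simp add: q_def)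
  ultimately show "action x \<ge> inner (q s - q r) p1 + inner (q t - q s) p2 + inner (q r - q t) p3"
    by (simp add: inner_diff_left algebra_simps)
qed

section \<open>Polygonal closed characteristics\<close>

text \<open>Since J squared is -1, the velocity \<open>d\<close> belongs to the normal
  \<open>- Jmap d\<close>, so the condition says that a step \<open>d\<close> may start at
  \<open>z\<close>. As \<open>Jmap d\<close> is orthogonal to \<open>d\<close>, the functional keeps
  its minimal value along the whole step.\<close>

definition normal_step :: "R4 set \<Rightarrow> R4 \<Rightarrow> R4 \<Rightarrow> bool" where
  "normal_step C z d \<longleftrightarrow> z \<in> C \<and> (\<forall>w\<in>C. inner (Jmap d) z \<le> inner (Jmap d) w)"

fun normal_path :: "R4 set \<Rightarrow> R4 \<Rightarrow> R4 list \<Rightarrow> bool" where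
  "normal_path C z [] \<longleftrightarrow> z \<in> C"
| "normal_path C z (d # ds) \<longleftrightarrow> normal_step C z d \<and> normal_path C (z + d) ds"

text \<open>The integrand of the action is constant along an edge, because \<open>Jmap d\<close> is
  orthogonal to \<open>d\<close>; hence the integral over a polygon is this finite sum.\<close>

fun path_action :: "R4 \<Rightarrow> R4 list \<Rightarrow> real" where
  "path_action z [] = 0"
| "path_action z (d # ds) = - inner (Jmap d) z / 2 + path_action (z + d) ds"

lemma Jmap_linear [simp]:
  "Jmap (a + b) = Jmap a + Jmap b" "Jmap (a - b) = Jmap a - Jmap b" "Jmap (- a) = - Jmap a"
  "Jmap (r *\<^sub>R a) = r *\<^sub>R Jmap a" "Jmap 0 = 0"
  by (simp_all add: Jmap_def zero_prod_def)

lemma Jmap_Jmap [simp]: "Jmap (Jmap d) = - d"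
  by (simp add: Jmap_def prod_eq_iff)

lemma inner_Jmap_self [simp]: "inner (Jmap d) d = 0"
  by (simp add: Jmap_def inner_prod_def inner_commute)

lemma Jmap_eq_0_iff [simp]: "Jmap d = 0 \<longleftrightarrow> d = 0"
  by (metis Jmap_Jmap Jmap_linear(5) neg_equal_0_iff_equal)

text \<open>A zero step has no admissible velocity (\<open>c > 0\<close> and \<open>p \<noteq> 0\<close>), so zero steps are dropped before a
  path is parametrised.\<close>

lemma normal_path_nonzero:
  "normal_path C z ds \<Longrightarrow> normal_path C z (filter (\<lambda>d. d \<noteq> 0) ds)"
  "path_action z (filter (\<lambda>d. d \<noteq> 0) ds) = path_action z ds"
  by (induction ds arbitrary: z) auto

lemma sum_list_nonzero: "sum_list (filter (\<lambda>d. d \<noteq> 0) ds) = sum_list (ds :: R4 list)"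
  by (induction ds) auto

lemma normal_path_nth:
  "normal_path C z ds \<Longrightarrow> j < length ds \<Longrightarrow> normal_step C (z + (\<Sum>i<j. ds ! i)) (ds ! j)"
proof (induction ds arbitrary: z j)
  case (Cons d ds)
  then show ?case
  proof (cases j)
    case (Suc k)
    have "(\<Sum>i<Suc k. (d # ds) ! i) = d + (\<Sum>i<k. ds ! i)" by (subst sum.lessThan_Suc_shift) simp
    then show ?thesis using Cons.IH[of "z + d" k] Cons.prems Suc by (simp add: add.assoc)
  qed simp
qed simp

lemma normal_path_last: "normal_path C z ds \<Longrightarrow> z + (\<Sum>i<length ds. ds ! i) \<in> C"
proof (induction ds arbitrary: z)
  case (Cons d ds)
  then show ?case using Cons.IH[of "z + d"]
    by (simp add: sum.lessThan_Suc_shift add.assoc del: sum.lessThan_Suc)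
qed simp

lemma path_action_sum:
  "path_action z ds = (\<Sum>j<length ds. - inner (Jmap (ds ! j)) (z + (\<Sum>i<j. ds ! i)) / 2)"
proof (induction ds arbitrary: z)
  case (Cons d ds)
  have "(\<Sum>i<Suc k. (d # ds) ! i) = d + (\<Sum>i<k. ds ! i)" for k by (subst sum.lessThan_Suc_shift) simp
  then show ?case using Cons.IH[of "z + d"]
    by (simp add: sum.lessThan_Suc_shift add.assoc del: sum.lessThan_Suc)
qed simp

text \<open>Each edge is run through in time \<open>1/N\<close>. Its endpoints lie in
  \<open>C\<close> and in one supporting hyperplane whose normal is minus \<open>Jmap\<close> of the
  edge, so the gauge stays 1 and the velocity has the required form outside the finitely many corner
  times.\<close>

lemma polygonal_characteristic:
  fixes ds :: "R4 list"
  assumes C: "convex C" "0 \<in> interior C" and path: "normal_path C z ds"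
    and nz: "\<And>d. d \<in> set ds \<Longrightarrow> d \<noteq> 0" and ne: "ds \<noteq> []" and cl: "sum_list ds = 0"
  shows "\<exists>x. closed_characteristic C x \<and> action x = path_action z ds"
proof -
  define N where "N = length ds"
  have N: "N > 0" using ne by (simp add: N_def)
  \<comment> \<open>Clamped progress of edge \<open>j\<close>: 0 before its time interval, 1 after
    it. This gives a single Lipschitz formula for the whole polygon.\<close>
  define c where "c = (\<lambda>j t. max 0 (min 1 (real N * t - real j)))"
  define y where "y = (\<lambda>t. z + (\<Sum>j<N. c j t *\<^sub>R ds ! j))"
  define Z where "Z = (\<lambda>j. z + (\<Sum>i<j. ds ! i))"
  define x where "x = (\<lambda>t. y (frac t))"
  have clN: "(\<Sum>i<N. ds ! i) = 0" using cl by (simp add: N_def sum_list_sum_nth atLeast0LessThan)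
  have step: "normal_step C (Z j) (ds ! j)" if "j < N" for j
    using normal_path_nth[OF path] that by (simp add: Z_def N_def)
  have ZC: "Z j \<in> C" if "j \<le> N" for j
    using step[of j] normal_path_last[OF path] that by (cases "j < N") (auto simp: normal_step_def Z_def N_def)
  have dnz: "ds ! j \<noteq> 0" if "j < N" for j using nz that by (simp add: N_def)
  have piece: "y t = Z j + (N * t - j) *\<^sub>R ds ! j" if j: "j < N" and t: "real j \<le> N * t" "N * t \<le> real j + 1" for j :: nat and t :: real
  proof -
    have "(\<Sum>i<N. c i t *\<^sub>R ds ! i) = (\<Sum>i<N. (if i < j then ds ! i else 0) + (if i = j then (N * t - j) *\<^sub>R ds ! j else 0))"
    proof (rule sum.cong)
      fix i assume "i \<in> {..<N}"
      consider "i < j" | "i = j" | "i > j" by linarith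
      then show "c i t *\<^sub>R ds ! i = (if i < j then ds ! i else 0) + (if i = j then (N * t - j) *\<^sub>R ds ! j else 0)"
      proof cases
        case 1
        then have "real i + 1 \<le> real j" by simp
        then have "c i t = 1" using t unfolding c_def by simp
        then show ?thesis using 1 by simp
      next
        case 2
        then have "c i t = N * t - j" using t unfolding c_def by simp
        then show ?thesis using 2 by simp
      next
        case 3
        then have "real j + 1 \<le> real i" by simp
        then have "c i t = 0" using t unfolding c_def by simp
        then show ?thesis using 3 by simp
      qed
    qed simp
    also have "\<dots> = (\<Sum>i<N. if i < j then ds ! i else 0) + (N * t - j) *\<^sub>R ds ! j"
      using j by (simp add: sum.distrib)
    also have "(\<Sum>i<N. if i < j then ds ! i else 0) = (\<Sum>i<j. ds ! i)"
    proof -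
      have "{..<N} \<inter> {i. i < j} = {..<j}" using j by auto
      then show ?thesis by (simp add: sum.If_cases)
    qed
    finally show ?thesis by (simp add: y_def Z_def)
  qed
  have y0: "y 0 = z" using piece[of 0 0] N by (simp add: Z_def)
  have y1: "y 1 = z"
    using piece[of "N - 1" 1] N clN sum.lessThan_Suc[of "\<lambda>i. ds ! i" "N - 1"]
    by (simp add: Z_def of_nat_diff add.assoc)
  have xy: "x t = y t" if "t \<in> {0..1}" for t
    using that y0 y1 frac_unique_iff[of t t] by (cases "t = 1") (auto simp: x_def frac_eq)
  have per: "x (t + 1) = x t" for t by (simp add: x_def frac_1_eq)
  have ex: "\<exists>j<N. real j \<le> N * t \<and> N * t \<le> real j + 1" if t: "0 \<le> t" "t < 1" for t :: real
  proof (intro exI[of _ "nat \<lfloor>N * t\<rfloor>"] conjI)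
    have "real N * t < real N * 1" by (rule mult_strict_left_mono) (use t N in auto)
    then have "\<lfloor>N * t\<rfloor> < int N" by (simp add: floor_less_iff)
    then show "nat \<lfloor>N * t\<rfloor> < N" using N by linarith
    have "0 \<le> N * t" using t by simp
    then have "real (nat \<lfloor>N * t\<rfloor>) = of_int \<lfloor>N * t\<rfloor>" by simp
    then show "real (nat \<lfloor>N * t\<rfloor>) \<le> N * t" "N * t \<le> real (nat \<lfloor>N * t\<rfloor>) + 1"
      using of_int_floor_le[of "N * t"] real_of_int_floor_add_one_ge[of "N * t"] by linarith+
  qed
  have sg: "inner (- Jmap (ds ! j)) (y t) > 0" "gauge C (y t) = 1"
      "(- Jmap (ds ! j)) /\<^sub>R inner (- Jmap (ds ! j)) (y t) \<in> subdiff (gauge C) (y t)"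
    if j: "j < N" and t: "real j \<le> N * t" "N * t \<le> real j + 1" for j :: nat and t :: real
  proof -
    define s where "s = N * t - j"
    have ys: "y t = Z j + s *\<^sub>R ds ! j" using piece[OF that] by (simp add: s_def)
    have "Z (Suc j) = Z j + ds ! j" by (simp add: Z_def add.assoc)
    then have "y t = (1 - s) *\<^sub>R Z j + s *\<^sub>R Z (Suc j)" using ys by (simp add: algebra_simps)
    also have "\<dots> \<in> C" using C(1) ZC[of j] ZC[of "Suc j"] j t by (intro convexD) (auto simp: s_def)
    finally have yC: "y t \<in> C" .
    have sup: "inner (- Jmap (ds ! j)) w \<le> inner (- Jmap (ds ! j)) (y t)" if "w \<in> C" for w
      using step[OF j] that by (simp add: ys normal_step_def inner_add_right)
    have n0: "- Jmap (ds ! j) \<noteq> 0" using dnz[OF j] by simp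
    show "inner (- Jmap (ds ! j)) (y t) > 0" "gauge C (y t) = 1"
      "(- Jmap (ds ! j)) /\<^sub>R inner (- Jmap (ds ! j)) (y t) \<in> subdiff (gauge C) (y t)"
      using support_gauge[OF C(2) yC n0 sup] by blast+
  qed
  have g1: "gauge C (x t) = 1" for t
    using ex[of "frac t"] sg(2) frac_ge_0[of t] frac_lt_1[of t] unfolding x_def by blast
  have ac: "abs_continuous_on 0 1 x"
  proof (rule AC_lipschitz[where C="\<Sum>j<N. N * norm (ds ! j)"])
    fix u v :: real assume uv: "0 \<le> u" "u \<le> v" "v \<le> 1"
    have "x v - x u = (\<Sum>j<N. (c j v - c j u) *\<^sub>R ds ! j)"
      using xy[of u] xy[of v] uv by (simp add: y_def scaleR_diff_left sum_subtractf)
    also have "norm \<dots> \<le> (\<Sum>j<N. (N * norm (ds ! j)) * (v - u))"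
    proof (rule sum_norm_le)
      fix j
      have "\<bar>c j v - c j u\<bar> \<le> \<bar>N * v - N * u\<bar>" by (auto simp: c_def max_def min_def)
      also have "\<dots> = N * (v - u)" using uv by (simp add: mult_left_mono flip: right_diff_distrib)
      finally have "\<bar>c j v - c j u\<bar> * norm (ds ! j) \<le> N * (v - u) * norm (ds ! j)" by (rule mult_right_mono) simp
      then show "norm ((c j v - c j u) *\<^sub>R ds ! j) \<le> (N * norm (ds ! j)) * (v - u)" by (simp add: mult_ac)
    qed
    finally show "norm (x v - x u) \<le> (\<Sum>j<N. N * norm (ds ! j)) * (v - u)" by (simp add: sum_distrib_right)
  qed (simp add: sum_nonneg)
  have der: "(x has_vector_derivative (real N *\<^sub>R ds ! j)) (at t)"
    if j: "j < N" and t: "t \<in> {real j / real N <..< (real j + 1) / real N}" for j :: nat and t :: real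
  proof (rule has_vector_derivative_transform_within_open[where S="{real j / real N <..< (real j + 1) / real N}"])
    show "((\<lambda>t. Z j + (N * t - j) *\<^sub>R ds ! j) has_vector_derivative (real N *\<^sub>R ds ! j)) (at t)"
      by (auto intro!: derivative_eq_intros simp: has_vector_derivative_def)
    fix u assume u: "u \<in> {real j / real N <..< (real j + 1) / real N}"
    then have *: "real j < N * u" "N * u < real j + 1" using N by (auto simp: field_simps)
    have "0 \<le> u" using u by (meson divide_nonneg_nonneg greaterThanLessThan_iff less_imp_le of_nat_0_le_iff order_trans)
    moreover have "real j + 1 \<le> N" using j by linarith
    then have "real N * u \<le> real N * 1" using * by linarith
    then have "u \<le> 1" using N by simp
    ultimately have "x u = y u" using xy by simp
    then show "Z j + (N * u - j) *\<^sub>R ds ! j = x u" using piece[OF j, of u] * by simp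
  qed (use t in auto)
  define G where "G = (\<lambda>j. real j / real N) ` {..N}"
  have cover: "\<exists>j<N. t \<in> {real j / real N <..< (real j + 1) / real N}" if t: "t \<in> {0..1}" "t \<notin> G" for t :: real
  proof -
    have "t \<noteq> 1" using t(2) N by (force simp: G_def intro!: image_eqI[of _ _ N])
    then obtain j where j: "j < N" "real j \<le> N * t" "N * t \<le> real j + 1" using ex[of t] t by auto
    have "t \<noteq> real j / real N" using t(2) j by (auto simp: G_def)
    moreover have "t \<noteq> (real j + 1) / real N" using t(2) j by (force simp: G_def intro!: image_eqI[of _ _ "Suc j"])
    ultimately have "t \<in> {real j / real N <..< (real j + 1) / real N}" using j N by (auto simp: field_simps less_le)
    then show ?thesis using j by blast
  qed
  have "closed_characteristic C x"
    unfolding closed_characteristic_def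
  proof (intro conjI allI)
    have "finite G" by (simp add: G_def)
    then have "G \<in> null_sets lborel" by (rule finite_imp_null_set_lborel)
    define P where "P = (\<lambda>t. \<exists>v. (x has_vector_derivative v) (at t)
               \<and> (\<exists>c>0. \<exists>p\<in>subdiff (gauge C) (x t). v = c *\<^sub>R Jmap p))"
    have PG: "t \<in> G" if t: "t \<in> {0..1}" and np: "\<not> P t" for t
    proof -
      show "t \<in> G"
      proof (rule ccontr)
        assume "t \<notin> G"
        then obtain j where j: "j < N" "t \<in> {real j / real N <..< (real j + 1) / real N}" using cover t by blast
        have jt: "real j \<le> N * t" "N * t \<le> real j + 1" using j N by (auto simp: field_simps)
        let ?a = "inner (- Jmap (ds ! j)) (x t)"
        have a: "?a > 0" "(- Jmap (ds ! j)) /\<^sub>R ?a \<in> subdiff (gauge C) (x t)"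
          using sg[OF j(1) jt] xy[OF t] by auto
        \<comment> \<open>The subgradient is the edge normal divided by its value \<open>?a\<close>
          at the point, so the factor \<open>c\<close> of the definition is
          \<open>N * ?a\<close>.\<close>
        have "real N *\<^sub>R ds ! j = (N * ?a) *\<^sub>R Jmap ((- Jmap (ds ! j)) /\<^sub>R ?a)"
          using a(1) by simp
        moreover have "N * ?a > 0" using a(1) N by (intro mult_pos_pos) simp_all
        ultimately show False using np der[OF j] a(2) unfolding P_def by blast
      qed
    qed
    have "AE t in lborel. t \<in> {0..1} \<longrightarrow> P t"
      by (rule AE_I'[OF \<open>G \<in> null_sets lborel\<close>]) (use PG in auto)
    then show "AE t in lborel. t \<in> {0..1} \<longrightarrow>
          (\<exists>v. (x has_vector_derivative v) (at t)
               \<and> (\<exists>c>0. \<exists>p\<in>subdiff (gauge C) (x t). v = c *\<^sub>R Jmap p))"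
      unfolding P_def .
  qed (use per g1 ac in auto)
  moreover have "action x = path_action z ds"
  proof -
    let ?f = "\<lambda>t. inner (Jmap (vector_derivative x (at t))) (x t)"
    have pc: "(?f has_integral (inner (Jmap (ds ! j)) (Z j))) {real j / real N..(real j + 1) / real N}" if j: "j < N" for j
    proof -
      have "((\<lambda>t. N * inner (Jmap (ds ! j)) (Z j)) has_integral (((real j + 1) / real N - real j / real N) *\<^sub>R (N * inner (Jmap (ds ! j)) (Z j)))) {real j / real N..(real j + 1) / real N}"
        using has_integral_const_real[of "N * inner (Jmap (ds ! j)) (Z j)" "real j / real N" "(real j + 1) / real N"]
        by (simp add: divide_right_mono measure_lborel_Icc)
      then have "((\<lambda>t. N * inner (Jmap (ds ! j)) (Z j)) has_integral (inner (Jmap (ds ! j)) (Z j))) {real j / real N..(real j + 1) / real N}"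
        using N by (simp add: field_simps flip: diff_divide_distrib)
      then show ?thesis
      proof (rule has_integral_spike_finite[of "{real j / real N, (real j + 1) / real N}", rotated 2])
        fix t assume "t \<in> {real j / real N..(real j + 1) / real N} - {real j / real N, (real j + 1) / real N}"
        then have t: "t \<in> {real j / real N <..< (real j + 1) / real N}" by auto
        then have jt: "real j \<le> N * t" "N * t \<le> real j + 1" using N by (auto simp: field_simps)
        have "0 \<le> t" using t by (meson divide_nonneg_nonneg greaterThanLessThan_iff less_imp_le of_nat_0_le_iff order_trans)
        moreover have "real j + 1 \<le> N" using j by linarith
        then have "real N * t \<le> real N * 1" using jt by linarith
        then have "t \<le> 1" using N by simp
        ultimately have "x t = y t" using xy by simp
        then show "?f t = N * inner (Jmap (ds ! j)) (Z j)"
          using vector_derivative_at[OF der[OF j t]] piece[OF j jt] by (simp add: inner_add_right)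
      qed simp
    qed
    have "(?f has_integral (\<Sum>j<m. inner (Jmap (ds ! j)) (Z j))) {0..real m / real N}" if "m \<le> N" for m
      using that
    proof (induction m)
      case (Suc m)
      then have "(?f has_integral ((\<Sum>j<m. inner (Jmap (ds ! j)) (Z j)) + inner (Jmap (ds ! m)) (Z m))) {0..(real m + 1) / real N}"
        by (intro has_integral_combine[OF _ _ _ pc]) (auto simp: divide_right_mono)
      then show ?case by (simp add: add.commute)
    qed (use has_integral_refl(2)[of ?f "0::real"] in simp)
    from this[of N] have "(?f has_integral (\<Sum>j<N. inner (Jmap (ds ! j)) (Z j))) {0..1}" using N by simp
    then have "action x = - (1/2) * (\<Sum>j<N. inner (Jmap (ds ! j)) (Z j))"
      unfolding action_def by (simp add: integral_unique)
    also have "\<dots> = path_action z ds"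
      by (simp add: path_action_sum N_def Z_def sum_distrib_left sum_negf)
    finally show ?thesis .
  qed
  ultimately show ?thesis by blast
qed

text \<open>The momentum is \<open>p\<^sub>i\<close> while the position runs from \<open>q\<^sub>i\<close> to \<open>q\<^sub>i\<^sub>+\<^sub>1\<close>, and it moves from \<open>p\<^sub>i\<close> to \<open>p\<^sub>i\<^sub>+\<^sub>1\<close>
  while the position rests at \<open>q\<^sub>i\<^sub>+\<^sub>1\<close>. Orbits with two bounces are the case \<open>q2 = q3\<close>, \<open>p2 = p3\<close>.\<close>

definition bounce :: "R2 set \<Rightarrow> R2 set \<Rightarrow> R2 \<Rightarrow> R2 \<Rightarrow> R2 \<Rightarrow> R2 \<Rightarrow> R2 \<Rightarrow> R2 \<Rightarrow> bool" where
  "bounce K T q1 q2 q3 p1 p2 p3 \<longleftrightarrow>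
     q1 \<in> K \<and> q2 \<in> K \<and> q3 \<in> K \<and> p1 \<in> T \<and> p2 \<in> T \<and> p3 \<in> T \<and>
     \<not> (q1 = q2 \<and> q2 = q3 \<and> p1 = p2 \<and> p2 = p3) \<and>
     (\<forall>y\<in>T. inner (q2 - q1) y \<le> inner (q2 - q1) p1) \<and>
     (\<forall>y\<in>T. inner (q3 - q2) y \<le> inner (q3 - q2) p2) \<and>
     (\<forall>y\<in>T. inner (q1 - q3) y \<le> inner (q1 - q3) p3) \<and>
     (\<forall>y\<in>K. inner (p1 - p2) y \<le> inner (p1 - p2) q2) \<and>
     (\<forall>y\<in>K. inner (p2 - p3) y \<le> inner (p2 - p3) q3) \<and>
     (\<forall>y\<in>K. inner (p3 - p1) y \<le> inner (p3 - p1) q1)"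

lemma bounce_characteristic:
  assumes K: "convex K" "0 \<in> interior K" and T: "convex T" "0 \<in> interior T"
    and b: "bounce K T q1 q2 q3 p1 p2 p3"
  shows "\<exists>x. closed_characteristic (K \<times> T) x \<and>
     action x = inner (q2 - q1) p1 + inner (q3 - q2) p2 + inner (q1 - q3) p3"
proof -
  define ds :: "R4 list" where
    "ds = [(q2 - q1, 0), (0, p2 - p1), (q3 - q2, 0), (0, p3 - p2), (q1 - q3, 0), (0, p1 - p3)]"
  have C: "convex (K \<times> T)" "(0::R4) \<in> interior (K \<times> T)"
    using K T by (simp_all add: convex_Times interior_Times zero_prod_def)
  have path: "normal_path (K \<times> T) (q1, p1) ds"
    using b by (auto simp: ds_def bounce_def normal_step_def Jmap_def inner_diff_left)
  let ?ds = "filter (\<lambda>d. d \<noteq> 0) ds"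
  have "\<exists>x. closed_characteristic (K \<times> T) x \<and> action x = path_action (q1, p1) ?ds"
  proof (rule polygonal_characteristic[OF C normal_path_nonzero(1)[OF path]])
    show "?ds \<noteq> []" using b by (auto simp: ds_def bounce_def zero_prod_def)
    show "sum_list ?ds = 0" unfolding sum_list_nonzero by (simp add: ds_def zero_prod_def)
  qed auto
  moreover have "path_action (q1, p1) ds = inner (q2 - q1) p1 + inner (q3 - q2) p2 + inner (q1 - q3) p3"
    by (simp add: ds_def Jmap_def inner_prod_def inner_diff_left inner_diff_right inner_commute field_simps)
  ultimately show ?thesis by (simp add: normal_path_nonzero(2))
qed

text \<open>The displacement \<open>e\<close> may depend on \<open>t\<close>: the condition forbids
  a common inward direction rather than a common translation. In this form the touched sides can be
  read off one direction at a time.\<close>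

definition untranslatable_loop :: "R2 set \<Rightarrow> (real \<Rightarrow> R2) \<Rightarrow> bool" where
  "untranslatable_loop K q \<longleftrightarrow>
     (\<forall>t. q t \<in> K) \<and> (\<forall>w. \<exists>t\<in>{0..1}. \<forall>e>0. q t + e *\<^sub>R w \<notin> interior K)"

text \<open>The lower bound for the action that results from freezing the momentum at \<open>y1\<close>, \<open>y2\<close>, \<open>y3\<close> on the
  three arcs into which the times \<open>r\<close>, \<open>s\<close>, \<open>t\<close> cut the loop.\<close>

definition length_bound :: "R2 set \<Rightarrow> (real \<Rightarrow> R2) \<Rightarrow> real \<Rightarrow> bool" where
  "length_bound T q A \<longleftrightarrow> (\<exists>r s t y1 y2 y3. 0 \<le> r \<and> r \<le> s \<and> s \<le> t \<and> t \<le> 1 \<and> y1 \<in> T \<and> y2 \<in> T \<and> y3 \<in> T \<and>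
     A \<le> inner (q s - q r) y1 + inner (q t - q s) y2 + inner (q r - q t) y3)"

text \<open>The orbit bounds the infimum from above and \<open>length_bound\<close> bounds every
  action from below. Both survive the centring in \<open>c_EHZ\<close>: position differences around
  the loop sum to 0, so a shift of the momenta cancels.\<close>

lemma c_EHZ_eqI:
  assumes K: "convex_body K" and T: "convex_body T"
    and b: "bounce K T q1 q2 q3 p1 p2 p3"
    and A: "A = inner (q2 - q1) p1 + inner (q3 - q2) p2 + inner (q1 - q3) p3"
    and low: "\<And>q. untranslatable_loop K q \<Longrightarrow> length_bound T q A"
  shows "c_EHZ (K \<times> T) = A"
proof -
  have "interior (K \<times> T) \<noteq> {}" using K T by (simp add: convex_body_def interior_Times)
  then have "(SOME c. c \<in> interior (K \<times> T)) \<in> interior (K \<times> T)" by (simp add: some_in_eq)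
  then obtain c1 c2 where c: "(SOME c. c \<in> interior (K \<times> T)) = (c1, c2)" "c1 \<in> interior K" "c2 \<in> interior T"
    by (metis interior_Times mem_Times_iff prod.collapse)
  define K0 where "K0 = (\<lambda>z. z - c1) ` K"
  define T0 where "T0 = (\<lambda>z. z - c2) ` T"
  have C0: "(\<lambda>z. z - (c1, c2)) ` (K \<times> T) = K0 \<times> T0"
    unfolding K0_def T0_def by force
  have KT: "compact K" "compact T" "convex K" "convex T" using K T by (auto simp: convex_body_def)
  have K0: "convex K0" "compact K0" "0 \<in> interior K0"
    using KT c by (auto simp: K0_def interior_translation_subtract convex_translation_subtract compact_translation_subtract)
  have T0: "convex T0" "compact T0" "0 \<in> interior T0"
    using KT c by (auto simp: T0_def interior_translation_subtract convex_translation_subtract compact_translation_subtract)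
  have b0: "bounce K0 T0 (q1 - c1) (q2 - c1) (q3 - c1) (p1 - c2) (p2 - c2) (p3 - c2)"
    using b by (auto simp: bounce_def K0_def T0_def inner_diff_right)
  obtain x where x: "closed_characteristic (K0 \<times> T0) x"
    "action x = inner (q2 - q1) (p1 - c2) + inner (q3 - q2) (p2 - c2) + inner (q1 - q3) (p3 - c2)"
    using bounce_characteristic[OF K0(1,3) T0(1,3) b0] by auto
  have xA: "action x = A" unfolding x(2) A by (simp add: inner_diff_left inner_diff_right)
  have lowA: "A \<le> action x" if ch: "closed_characteristic (K0 \<times> T0) x" for x
  proof -
    note L = characteristic_lower[OF ch K0(2,3) T0(2,3)]
    define q where "q = (\<lambda>t. fst (x t) + c1)"
    have "untranslatable_loop K q"
      unfolding untranslatable_loop_def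
    proof (intro conjI allI)
      fix t show "q t \<in> K" using L(1)[of t] by (auto simp: q_def K0_def)
    next
      fix w
      obtain t where t: "t \<in> {0..1}" "\<And>e. e > 0 \<Longrightarrow> fst (x t) + e *\<^sub>R w \<notin> interior K0" using L(2)[of w] by blast
      have "q t + e *\<^sub>R w \<notin> interior K" if "e > 0" for e
      proof
        assume "q t + e *\<^sub>R w \<in> interior K"
        then have "fst (x t) + e *\<^sub>R w \<in> interior K0"
          unfolding K0_def interior_translation_subtract q_def
          by (intro image_eqI) (auto simp: algebra_simps)
        then show False using t(2)[OF that] by simp
      qed
      then show "\<exists>t\<in>{0..1}. \<forall>e>0. q t + e *\<^sub>R w \<notin> interior K" using t(1) by blast
    qed
    from low[OF this, unfolded length_bound_def] obtain r s t y1 y2 y3 where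
      y: "0 \<le> r" "r \<le> s" "s \<le> t" "t \<le> 1" "y1 \<in> T" "y2 \<in> T" "y3 \<in> T"
      "A \<le> inner (q s - q r) y1 + inner (q t - q s) y2 + inner (q r - q t) y3" by blast
    have "inner (q s - q r) (y1 - c2) + inner (q t - q s) (y2 - c2) + inner (q r - q t) (y3 - c2) \<le> action x"
      using L(3)[of r s t "y1 - c2" "y2 - c2" "y3 - c2"] y by (simp add: q_def T0_def)
    then show ?thesis using y(8) by (simp add: inner_diff_left inner_diff_right)
  qed
  have "Inf {action x | x. closed_characteristic (K0 \<times> T0) x} = A"
    by (rule cInf_eq_minimum) (use x(1) xA lowA in auto)
  then show ?thesis unfolding c_EHZ_def Let_def c(1) C0 .
qed

section \<open>Duality between inscribed paths and bounce orbits\<close>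

text \<open>The pairs of differences \<open>(b - a, c - b)\<close> of points of \<open>T\<close>
  form a compact convex set \<open>W\<close> in dimension four with 0 inside. The largest multiple
  of \<open>(w1, w2)\<close> in \<open>W\<close> lies on its boundary, and a supporting functional
  there splits into one functional for each of the three points, with sum 0. Each of these is
  maximised over \<open>T\<close> at its own vertex.\<close>

lemma inscribed_path_dual:
  fixes T :: "R2 set"
  assumes T: "convex_body T" and w: "w1 \<noteq> 0 \<or> w2 \<noteq> 0"
  obtains \<alpha> p u1 u2 u3 where "\<alpha> > 0" "p \<in> T" "p + \<alpha> *\<^sub>R w1 \<in> T" "p + \<alpha> *\<^sub>R (w1 + w2) \<in> T"
    "u1 + u2 + u3 = 0" "inner u2 w1 + inner u3 (w1 + w2) > 0"
    "\<And>y. y \<in> T \<Longrightarrow> inner u1 y \<le> inner u1 p"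
    "\<And>y. y \<in> T \<Longrightarrow> inner u2 y \<le> inner u2 (p + \<alpha> *\<^sub>R w1)"
    "\<And>y. y \<in> T \<Longrightarrow> inner u3 y \<le> inner u3 (p + \<alpha> *\<^sub>R (w1 + w2))"
    "\<And>\<beta> y. y \<in> T \<Longrightarrow> y + \<beta> *\<^sub>R w1 \<in> T \<Longrightarrow> y + \<beta> *\<^sub>R (w1 + w2) \<in> T \<Longrightarrow> \<beta> \<le> \<alpha>"
proof -
  define f :: "R2 \<times> R2 \<times> R2 \<Rightarrow> R4" where "f = (\<lambda>(a, b, c). (b - a, c - b))"
  define W where "W = f ` (T \<times> T \<times> T)"
  define w where "w = (w1, w2)"
  have w0: "w \<noteq> 0" using assms(2) by (auto simp: w_def zero_prod_def)
  have cT: "compact T" "convex T" using T by (auto simp: convex_body_def)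
  have linf: "linear f" by (auto simp: f_def linear_iff algebra_simps)
  have Wconv: "convex W" unfolding W_def by (rule convex_linear_image[OF linf]) (simp add: convex_Times cT)
  have Wcomp: "compact W" unfolding W_def
    by (rule compact_continuous_image)
      (use linf cT in \<open>auto simp: linear_conv_bounded_linear intro!: linear_continuous_on compact_Times\<close>)
  have WI: "(b - a, c - b) \<in> W" if "a \<in> T" "b \<in> T" "c \<in> T" for a b c
    unfolding W_def using that by (intro image_eqI[of _ _ "(a, b, c)"]) (auto simp: f_def)
  obtain z where z: "z \<in> interior T" using T by (auto simp: convex_body_def)
  then obtain r where r: "r > 0" "ball z r \<subseteq> T" by (auto simp: mem_interior)
  have ball0: "ball 0 r \<subseteq> W"
  proof
    fix v :: R4 assume v: "v \<in> ball 0 r"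
    obtain a b where ab: "v = (a, b)" by (cases v)
    have "norm a \<le> norm v" "norm b \<le> norm v" using ab norm_fst_le norm_snd_le by auto
    then have ab': "norm a < r" "norm b < r" using v by auto
    have "z - a \<in> T" "z \<in> T" "z + b \<in> T" using r ab' by (auto intro!: subsetD[OF r(2)] simp: dist_norm)
    from WI[OF this] show "v \<in> W" by (simp add: ab)
  qed
  then have int0: "0 \<in> interior W" using r(1) by (auto simp: mem_interior)
  define A where "A = {b. b \<ge> 0 \<and> b *\<^sub>R w \<in> W}"
  have "compact A"
  proof -
    obtain M where M: "\<And>v. v \<in> W \<Longrightarrow> norm v \<le> M" using compact_imp_bounded[OF Wcomp] by (auto simp: bounded_iff)
    have "A \<subseteq> {0..M / norm w}"
    proof
      fix b assume b: "b \<in> A"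
      then have "\<bar>b\<bar> * norm w \<le> M" using M[of "b *\<^sub>R w"] by (simp add: A_def)
      then show "b \<in> {0..M / norm w}" using b w0 by (simp add: A_def field_simps)
    qed
    moreover have "closed A"
    proof -
      have "closed ((\<lambda>b. b *\<^sub>R w) -` W)"
        by (rule closed_vimage[OF compact_imp_closed[OF Wcomp]]) (intro continuous_intros)
      moreover have "A = {0..} \<inter> (\<lambda>b. b *\<^sub>R w) -` W" by (auto simp: A_def)
      ultimately show ?thesis by (simp add: closed_Int)
    qed
    ultimately show ?thesis using compact_Icc compact_eq_bounded_closed bounded_subset by metis
  qed
  moreover have "0 \<in> A" using int0 interior_subset by (auto simp: A_def)
  ultimately obtain \<alpha> where \<alpha>: "\<alpha> \<in> A" "\<And>b. b \<in> A \<Longrightarrow> b \<le> \<alpha>" using compact_attains_sup[of A] by blast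
  have aW: "\<alpha> *\<^sub>R w \<in> W" "\<alpha> \<ge> 0" using \<alpha> by (auto simp: A_def)
  have nint: "\<alpha> *\<^sub>R w \<notin> interior W"
  proof
    assume "\<alpha> *\<^sub>R w \<in> interior W"
    then obtain e where e: "e > 0" "ball (\<alpha> *\<^sub>R w) e \<subseteq> W" by (auto simp: mem_interior)
    define d where "d = e / (2 * norm w)"
    have d: "d > 0" using e w0 by (simp add: d_def)
    have "(\<alpha> + d) *\<^sub>R w \<in> W"
      by (rule subsetD[OF e(2)]) (use e w0 in \<open>simp add: d_def dist_norm algebra_simps\<close>)
    then have "\<alpha> + d \<in> A" using aW d by (simp add: A_def)
    then show False using \<alpha>(2) d by fastforce
  qed
  have "rel_interior W = interior W" using int0 by (intro rel_interior_nonempty_interior) auto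
  then obtain a where a: "a \<noteq> 0" "\<And>v. v \<in> W \<Longrightarrow> inner a (\<alpha> *\<^sub>R w) \<le> inner a v"
    using supporting_hyperplane_rel_boundary[OF Wconv aW(1)] nint by metis
  obtain m where m: "m = - a" "m \<noteq> 0" using a by auto
  have msup: "inner m v \<le> inner m (\<alpha> *\<^sub>R w)" if "v \<in> W" for v using a(2)[OF that] m by simp
  have "inner m 0 < inner m (\<alpha> *\<^sub>R w)" by (rule interior_support_strict[OF int0 m(2) msup])
  then have pos: "\<alpha> > 0" "inner m w > 0" using aW(2) by (auto simp: zero_less_mult_iff)
  obtain p1 p2 p3 where p: "p1 \<in> T" "p2 \<in> T" "p3 \<in> T" "\<alpha> *\<^sub>R w = (p2 - p1, p3 - p2)"
    using aW(1) by (auto simp: W_def f_def)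
  have p2: "p2 = p1 + \<alpha> *\<^sub>R w1" and p3: "p3 = p1 + \<alpha> *\<^sub>R (w1 + w2)"
    using p(4) by (auto simp: w_def algebra_simps)
  obtain m1 m2 where m12: "m = (m1, m2)" by (cases m)
  have sup: "inner m1 (b - a) + inner m2 (c - b) \<le> inner m1 (p2 - p1) + inner m2 (p3 - p2)"
    if "a \<in> T" "b \<in> T" "c \<in> T" for a b c
    using msup[OF WI[OF that]] p(4) m12 by (simp add: inner_prod_def)
  show thesis
  \<comment> \<open>The functionals are the coefficients of \<open>a\<close>, \<open>b\<close> and
    \<open>c\<close> in \<open>inner m1 (b - a) + inner m2 (c - b)\<close>.\<close>
  proof (rule that[of \<alpha> p1 "- m1" "m1 - m2" m2])
    show S: "inner (m1 - m2) w1 + inner m2 (w1 + w2) > 0"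
      using pos(2) m12 by (simp add: w_def inner_prod_def inner_diff_left inner_add_right)
    show "inner (- m1) y \<le> inner (- m1) p1" if "y \<in> T" for y
      using sup[OF that p(2,3)] by (simp add: inner_diff_right)
    show "inner (m1 - m2) y \<le> inner (m1 - m2) (p1 + \<alpha> *\<^sub>R w1)" if "y \<in> T" for y
      using sup[OF p(1) that p(3)] by (simp add: p2[symmetric] inner_diff_right inner_diff_left)
    show "inner m2 y \<le> inner m2 (p1 + \<alpha> *\<^sub>R (w1 + w2))" if "y \<in> T" for y
      using sup[OF p(1,2) that] by (simp add: p3[symmetric] inner_diff_right)
    show "\<beta> \<le> \<alpha>" if y: "y \<in> T" "y + \<beta> *\<^sub>R w1 \<in> T" "y + \<beta> *\<^sub>R (w1 + w2) \<in> T" for \<beta> y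
    proof -
      have "\<beta> * inner m w \<le> \<alpha> * inner m w"
        using msup[OF WI[OF y]] by (simp add: w_def m12 inner_prod_def algebra_simps inner_add_right)
      then show ?thesis using pos(2) by simp
    qed
  qed (use pos p p2 p3 in auto)
qed

text \<open>This is the degenerate path with second difference 0: the last two vertices coincide,
  their functionals add up, and the sum supports \<open>T\<close> from both sides at the ends of a
  longest chord.\<close>

lemma chord_dual:
  fixes T :: "R2 set"
  assumes T: "convex_body T" and n: "n \<noteq> 0"
  obtains \<alpha> p u where "\<alpha> > 0" "p \<in> T" "p + \<alpha> *\<^sub>R n \<in> T" "inner u n = 1"
    "\<And>y. y \<in> T \<Longrightarrow> inner u p \<le> inner u y"
    "\<And>y. y \<in> T \<Longrightarrow> inner u y \<le> inner u (p + \<alpha> *\<^sub>R n)"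
    "\<And>\<beta> y. y \<in> T \<Longrightarrow> y + \<beta> *\<^sub>R n \<in> T \<Longrightarrow> \<beta> \<le> \<alpha>"
proof -
  obtain \<alpha> p u1 u2 u3 where d: "\<alpha> > 0" "p \<in> T" "p + \<alpha> *\<^sub>R n \<in> T"
    "u1 + u2 + u3 = 0" "inner u2 n + inner u3 (n + 0) > 0"
    "\<And>y. y \<in> T \<Longrightarrow> inner u1 y \<le> inner u1 p"
    "\<And>y. y \<in> T \<Longrightarrow> inner u2 y \<le> inner u2 (p + \<alpha> *\<^sub>R n)"
    "\<And>y. y \<in> T \<Longrightarrow> inner u3 y \<le> inner u3 (p + \<alpha> *\<^sub>R (n + 0))"
    "\<And>\<beta> y. y \<in> T \<Longrightarrow> y + \<beta> *\<^sub>R n \<in> T \<Longrightarrow> y + \<beta> *\<^sub>R (n + 0) \<in> T \<Longrightarrow> \<beta> \<le> \<alpha>"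
    using inscribed_path_dual[OF T, of n 0] n by metis
  define S where "S = inner u2 n + inner u3 n"
  have S: "S > 0" using d(5) by (simp add: S_def)
  have "u1 + (u2 + u3) = 0" using d(4) by (simp add: add.assoc)
  then have u1: "u1 = - (u2 + u3)" by (simp only: eq_neg_iff_add_eq_0)
  show thesis
  proof (rule that[of \<alpha> p "(u2 + u3) /\<^sub>R S"])
    show "inner ((u2 + u3) /\<^sub>R S) n = 1" using S by (simp add: S_def inner_add_left)
    show "inner ((u2 + u3) /\<^sub>R S) p \<le> inner ((u2 + u3) /\<^sub>R S) y" if "y \<in> T" for y
    proof -
      have "inner (u2 + u3) p \<le> inner (u2 + u3) y"
        using d(6)[OF that] unfolding u1 inner_minus_left by (simp only: neg_le_iff_le)
      then show ?thesis using S by (simp add: mult_left_mono)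
    qed
    show "inner ((u2 + u3) /\<^sub>R S) y \<le> inner ((u2 + u3) /\<^sub>R S) (p + \<alpha> *\<^sub>R n)" if "y \<in> T" for y
    proof -
      have "inner (u2 + u3) y \<le> inner (u2 + u3) (p + \<alpha> *\<^sub>R n)"
        using d(7)[OF that] d(8)[OF that] by (simp add: inner_add_left)
      then show ?thesis using S by (simp add: mult_left_mono)
    qed
  qed (use d in auto)
qed

section \<open>Linear algebra in the plane and orbits in a triangle\<close>

lemma inner_R2: "inner (x::R2) y = x$1 * y$1 + x$2 * y$2"
  by (simp add: inner_vec_def sum_2)

lemma linear_system_R2:
  assumes "det2 a b \<noteq> 0"
  obtains x where "inner a x = r" "inner b x = s"
proof
  let ?x = "vector [(r * b$2 - s * a$2) / det2 a b, (s * a$1 - r * b$1) / det2 a b] :: R2"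
  have *: "a$1 * b$2 - a$2 * b$1 \<noteq> 0" using assms by (simp add: det2_def)
  show "inner a ?x = r" using * by (simp add: inner_R2 det2_def divide_simps) (simp add: algebra_simps)
  show "inner b ?x = s" using * by (simp add: inner_R2 det2_def divide_simps) (simp add: algebra_simps)
qed

lemma det2_sum_zero:
  assumes "n1 + n2 + n3 = 0"
  shows "det2 n2 n3 = det2 n1 n2" "det2 n3 n1 = det2 n1 n2" "det2 n1 n3 = - det2 n1 n2" "det2 n3 n2 = - det2 n1 n2"
proof -
  have "n3 = - n1 - n2" using assms by (metis add.commute add_diff_cancel_right' diff_0 diff_diff_eq)
  then show "det2 n2 n3 = det2 n1 n2" "det2 n3 n1 = det2 n1 n2" "det2 n1 n3 = - det2 n1 n2" "det2 n3 n2 = - det2 n1 n2"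
    unfolding \<open>n3 = - n1 - n2\<close> by (simp_all add: det2_def algebra_simps)
qed

text \<open>The momenta form a triangle with consecutive edges along \<open>- n2\<close>,
  \<open>- n3\<close>, \<open>- n1\<close>, of the largest scale that fits into \<open>T\<close>, so
  the momentum jump at each bounce point is along the normal of its side. Membership of the bounce
  points in a polygon is kept apart, because a trapezoid adds a side that has to be checked
  separately.\<close>

definition triangle_orbit :: "R2 set \<Rightarrow> R2 \<Rightarrow> R2 \<Rightarrow> R2 \<Rightarrow> real \<Rightarrow> real \<Rightarrow> real \<Rightarrow> real \<Rightarrow> R2 \<Rightarrow> R2 \<Rightarrow> R2 \<Rightarrow> R2 \<Rightarrow> bool" where
  "triangle_orbit T n1 n2 n3 b1 b2 b3 \<alpha> p q1 q2 q3 \<longleftrightarrow>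
     \<alpha> > 0 \<and> p \<in> T \<and> p - \<alpha> *\<^sub>R n2 \<in> T \<and> p + \<alpha> *\<^sub>R n1 \<in> T \<and>
     (\<forall>\<beta> y. y \<in> T \<and> y - \<beta> *\<^sub>R n2 \<in> T \<and> y + \<beta> *\<^sub>R n1 \<in> T \<longrightarrow> \<beta> \<le> \<alpha>) \<and>
     inner n1 q1 = b1 \<and> inner n2 q2 = b2 \<and> inner n3 q3 = b3 \<and>
     inner n1 q2 \<le> b1 \<and> inner n1 q3 \<le> b1 \<and> inner n2 q1 \<le> b2 \<and> inner n2 q3 \<le> b2 \<and>
     inner n3 q1 \<le> b3 \<and> inner n3 q2 \<le> b3 \<and>
     (\<forall>y\<in>T. inner (q2 - q1) y \<le> inner (q2 - q1) p) \<and>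
     (\<forall>y\<in>T. inner (q3 - q2) y \<le> inner (q3 - q2) (p - \<alpha> *\<^sub>R n2)) \<and>
     (\<forall>y\<in>T. inner (q1 - q3) y \<le> inner (q1 - q3) (p + \<alpha> *\<^sub>R n1)) \<and>
     inner (q2 - q1) p + inner (q3 - q2) (p - \<alpha> *\<^sub>R n2) + inner (q1 - q3) (p + \<alpha> *\<^sub>R n1) = \<alpha> * (b1 + b2 + b3)"

text \<open>The functionals that certify the maximal inscribed triangle, multiplied by a common
  factor \<open>k\<close>, become the edges of the position triangle. Two linear equations put
  \<open>q1\<close> and \<open>q2\<close> on their lines, and \<open>k\<close> is chosen so that
  \<open>q3\<close> falls on the third.\<close>

lemma triangle_orbit_exists:
  assumes T: "convex_body T" and n: "n1 + n2 + n3 = 0" "det2 n1 n2 \<noteq> 0" and B: "b1 + b2 + b3 > 0"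
  obtains \<alpha> p q1 q2 q3 where "triangle_orbit T n1 n2 n3 b1 b2 b3 \<alpha> p q1 q2 q3"
proof -
  have n3: "n3 = - n1 - n2" using n(1) by (metis add.commute add_diff_cancel_right' diff_0 diff_diff_eq)
  have "- n2 \<noteq> 0" using n(2) by (auto simp: det2_def)
  moreover have sm: "- n2 + - n3 = n1" using n3 by simp
  ultimately obtain \<alpha> p u1 u2 u3 where d: "\<alpha> > 0" "p \<in> T" "p - \<alpha> *\<^sub>R n2 \<in> T" "p + \<alpha> *\<^sub>R n1 \<in> T"
    "u1 + u2 + u3 = 0" "- inner u2 n2 + inner u3 n1 > 0"
    "\<And>y. y \<in> T \<Longrightarrow> inner u1 y \<le> inner u1 p"
    "\<And>y. y \<in> T \<Longrightarrow> inner u2 y \<le> inner u2 (p - \<alpha> *\<^sub>R n2)"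
    "\<And>y. y \<in> T \<Longrightarrow> inner u3 y \<le> inner u3 (p + \<alpha> *\<^sub>R n1)"
    "\<And>\<beta> y. y \<in> T \<Longrightarrow> y - \<beta> *\<^sub>R n2 \<in> T \<Longrightarrow> y + \<beta> *\<^sub>R n1 \<in> T \<Longrightarrow> \<beta> \<le> \<alpha>"
    using inscribed_path_dual[OF T, of "- n2" "- n3"] unfolding sm
    by (metis (no_types, lifting) add_uminus_conv_diff inner_minus_right scaleR_minus_right)
  define S where "S = - inner u2 n2 + inner u3 n1"
  define k where "k = (b1 + b2 + b3) / S"
  have S: "S > 0" using d(6) by (simp add: S_def)
  have k: "k > 0" using S B by (simp add: k_def)
  have kS: "k * S = b1 + b2 + b3" using S by (simp add: k_def)
  obtain q1 where q1: "inner n1 q1 = b1" "inner n2 q1 = b2 - k * inner n2 u1"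
    using linear_system_R2[OF n(2)] by blast
  define q2 where "q2 = q1 + k *\<^sub>R u1"
  define q3 where "q3 = q2 + k *\<^sub>R u2"
  have u3: "u3 = - u1 - u2" using d(5) by (metis add.commute add_diff_cancel_right' diff_0 diff_diff_eq)
  have st: "q2 - q1 = k *\<^sub>R u1" "q3 - q2 = k *\<^sub>R u2" "q1 - q3 = k *\<^sub>R u3"
    by (simp_all add: q2_def q3_def u3 algebra_simps)
  have N1: "inner (q2 - q1) y \<le> inner (q2 - q1) p" if "y \<in> T" for y
    using d(7)[OF that] k unfolding st by (simp add: mult_left_mono)
  have N2: "inner (q3 - q2) y \<le> inner (q3 - q2) (p - \<alpha> *\<^sub>R n2)" if "y \<in> T" for y
    using d(8)[OF that] k unfolding st by (simp add: mult_left_mono)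
  have N3: "inner (q1 - q3) y \<le> inner (q1 - q3) (p + \<alpha> *\<^sub>R n1)" if "y \<in> T" for y
    using d(9)[OF that] k unfolding st by (simp add: mult_left_mono)
  have q2: "inner n2 q2 = b2" by (simp add: q2_def q1 inner_add_right)
  have q3: "inner n3 q3 = b3"
    using kS q1 unfolding q3_def q2_def n3 S_def u3
    by (simp add: inner_add_right inner_diff_left inner_diff_right inner_commute algebra_simps)
  have inn: "inner n3 q = - inner n1 q - inner n2 q" for q by (simp add: n3 inner_diff_left)
  have cancel: "x \<le> 0" if "\<alpha> * x \<le> 0" for x using that d(1) by (simp add: mult_le_0_iff)
  \<comment> \<open>That the bounce points lie in the triangle comes for free: test the normal condition at one
    vertex of the inscribed triangle against the other two.\<close>
  have I: "inner n1 q2 \<le> b1" "inner n1 q3 \<le> b1" "inner n2 q1 \<le> b2" "inner n2 q3 \<le> b2" "inner n3 q1 \<le> b3" "inner n3 q2 \<le> b3"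
  proof -
    have "\<alpha> * (inner n1 q2 - b1) \<le> 0"
      using N1[OF d(4)] q1(1) by (simp add: inner_add_right inner_diff_left inner_commute algebra_simps)
    then show "inner n1 q2 \<le> b1" using cancel by force
    have "\<alpha> * (inner n2 q1 - b2) \<le> 0"
      using N1[OF d(3)] q2 by (simp add: inner_add_right inner_diff_left inner_diff_right inner_commute algebra_simps)
    then show "inner n2 q1 \<le> b2" using cancel by force
    have "\<alpha> * (inner n2 q3 - b2) \<le> 0"
      using N2[OF d(2)] q2 by (simp add: inner_add_right inner_diff_left inner_diff_right inner_commute algebra_simps)
    then show "inner n2 q3 \<le> b2" using cancel by force
    have "\<alpha> * (inner n3 q2 - b3) \<le> 0"
      using N2[OF d(4)] by (simp add: q3[symmetric] inn inner_add_right inner_diff_left inner_diff_right inner_commute algebra_simps)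
    then show "inner n3 q2 \<le> b3" using cancel by force
    have "\<alpha> * (inner n3 q1 - b3) \<le> 0"
      using N3[OF d(3)] by (simp add: q3[symmetric] inn inner_add_right inner_diff_left inner_diff_right inner_commute algebra_simps)
    then show "inner n3 q1 \<le> b3" using cancel by force
    have "\<alpha> * (inner n1 q3 - b1) \<le> 0"
      using N3[OF d(2)] q1 by (simp add: inner_add_right inner_diff_left inner_diff_right inner_commute algebra_simps)
    then show "inner n1 q3 \<le> b1" using cancel by force
  qed
  have len: "inner (q2 - q1) p + inner (q3 - q2) (p - \<alpha> *\<^sub>R n2) + inner (q1 - q3) (p + \<alpha> *\<^sub>R n1) = \<alpha> * (b1 + b2 + b3)"
  proof -
    have "inner (q2 - q1) p + inner (q3 - q2) (p - \<alpha> *\<^sub>R n2) + inner (q1 - q3) (p + \<alpha> *\<^sub>R n1) = \<alpha> * (k * S)"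
      unfolding st S_def u3 by (simp add: inner_add_right inner_diff_left inner_diff_right algebra_simps)
    then show ?thesis unfolding kS .
  qed
  have "triangle_orbit T n1 n2 n3 b1 b2 b3 \<alpha> p q1 q2 q3"
    unfolding triangle_orbit_def using d q1 q2 q3 I N1 N2 N3 len by blast
  then show thesis by (rule that)
qed

section \<open>Polygons given by half-planes and loops that touch their sides\<close>

definition halfspaces :: "(R2 \<times> real) set \<Rightarrow> R2 set" where
  "halfspaces H = {x. \<forall>(n, b)\<in>H. inner n x \<le> b}"

lemma interior_halfspaces:
  assumes "finite H" "\<And>n b. (n, b) \<in> H \<Longrightarrow> inner n x < b"
  shows "x \<in> interior (halfspaces H)"
proof -
  have "open (\<Inter>(n, b)\<in>H. {x. inner n x < b})"
    using assms(1) by (intro open_INT) (auto simp: open_halfspace_lt)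
  moreover have "(\<Inter>(n, b)\<in>H. {x. inner n x < b}) \<subseteq> halfspaces H"
    by (force simp: halfspaces_def)
  moreover have "x \<in> (\<Inter>(n, b)\<in>H. {x. inner n x < b})" using assms(2) by auto
  ultimately show ?thesis by (meson interior_maximal subsetD)
qed

text \<open>If every half-plane that is tight at \<open>q t\<close> had negative product with
  \<open>w\<close>, a small move along \<open>w\<close> would enter the interior: tight constraints
  become strict and the others stay strict. The choice of \<open>w\<close> singles out the sides
  that can be the touched one.\<close>

lemma untranslatable_touches:
  assumes H: "finite H" and q: "untranslatable_loop (halfspaces H) q"
  obtains t n b where "t \<in> {0..1}" "(n, b) \<in> H" "inner n (q t) = b" "inner n w \<ge> 0"
proof -
  obtain t where t: "t \<in> {0..1}" "\<And>e. e > 0 \<Longrightarrow> q t + e *\<^sub>R w \<notin> interior (halfspaces H)"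
    using q unfolding untranslatable_loop_def by blast
  have le: "inner n (q t) \<le> b" if "(n, b) \<in> H" for n b
    using q that unfolding untranslatable_loop_def halfspaces_def by blast
  show thesis
  proof (rule ccontr)
    assume "\<not> thesis"
    then have no: "\<not> (inner n (q t) = b \<and> inner n w \<ge> 0)" if "(n, b) \<in> H" for n b
      using that t(1) \<open>\<And>t n b. \<lbrakk>t \<in> {0..1}; (n, b) \<in> H; inner n (q t) = b; 0 \<le> inner n w\<rbrakk> \<Longrightarrow> thesis\<close> by blast
    have "\<forall>\<^sub>F e in at_right 0. inner (fst h) (q t + e *\<^sub>R w) < snd h" if h: "h \<in> H" for h
    proof (cases "inner (fst h) w < 0")
      case True
      have "inner (fst h) (q t + e *\<^sub>R w) < snd h" if "e > 0" for e
        using le[of "fst h" "snd h"] h mult_pos_neg[OF that True] by (simp add: inner_add_right)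
      then show ?thesis by (intro eventually_at_rightI[of 0 1]) auto
    next
      case False
      then have lt: "inner (fst h) (q t) < snd h" using no[of "fst h" "snd h"] le[of "fst h" "snd h"] h by auto
      have "((\<lambda>e. inner (fst h) (q t + e *\<^sub>R w)) \<longlongrightarrow> inner (fst h) (q t + 0 *\<^sub>R w)) (at_right 0)"
        by (intro tendsto_intros)
      then show ?thesis using lt by (intro order_tendstoD(2)[where a="snd h"]) auto
    qed
    then have "\<forall>\<^sub>F e in at_right 0. \<forall>h\<in>H. inner (fst h) (q t + e *\<^sub>R w) < snd h"
      using H by (simp add: eventually_ball_finite)
    then obtain c :: real where c: "c > 0" "\<And>e. 0 < e \<Longrightarrow> e < c \<Longrightarrow> \<forall>h\<in>H. inner (fst h) (q t + e *\<^sub>R w) < snd h"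
      unfolding eventually_at_right_field by blast
    have "q t + (c/2) *\<^sub>R w \<in> interior (halfspaces H)"
      by (rule interior_halfspaces[OF H]) (use c(2)[of "c/2"] c(1) in auto)
    then show False using t(2)[of "c/2"] c(1) by simp
  qed
qed

text \<open>The sum is invariant under cyclic relabelling, whereas \<open>length_bound\<close> asks
  for increasing times.\<close>

lemma cyclic_lower:
  assumes y: "y1 \<in> T" "y2 \<in> T" "y3 \<in> T" and t: "t1 \<in> {0..1::real}" "t2 \<in> {0..1}" "t3 \<in> {0..1}"
    and cyc: "t1 \<le> t2 \<and> t2 \<le> t3 \<or> t2 \<le> t3 \<and> t3 \<le> t1 \<or> t3 \<le> t1 \<and> t1 \<le> t2"
    and A: "A \<le> inner (q t2 - q t1) y1 + inner (q t3 - q t2) y2 + inner (q t1 - q t3) y3"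
  shows "length_bound T q A"
proof -
  consider "t1 \<le> t2 \<and> t2 \<le> t3" | "t2 \<le> t3 \<and> t3 \<le> t1" | "t3 \<le> t1 \<and> t1 \<le> t2" using cyc by blast
  then show ?thesis
  proof cases
    case 1
    then show ?thesis unfolding length_bound_def using y t A by (intro exI[of _ t1] exI[of _ t2] exI[of _ t3] exI[of _ y1] exI[of _ y2] exI[of _ y3]) auto
  next
    case 2
    show ?thesis
      unfolding length_bound_def
      by (rule exI[of _ t2], rule exI[of _ t3], rule exI[of _ t1], rule exI[of _ y2], rule exI[of _ y3], rule exI[of _ y1])
         (use 2 y t A in auto)
  next
    case 3
    show ?thesis
      unfolding length_bound_def
      by (rule exI[of _ t3], rule exI[of _ t1], rule exI[of _ t2], rule exI[of _ y3], rule exI[of _ y1], rule exI[of _ y2])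
         (use 3 y t A in auto)
  qed
qed

text \<open>Summation by parts turns the length for frozen momenta into the sum of the three terms
  \<open>\<beta> * inner ni (q ti)\<close>. The triangle at \<open>p\<close> achieves this when the
  sides are visited in the cyclic order 1, 2, 3, the triangle at \<open>r\<close> when the order is
  1, 3, 2.\<close>

lemma triangle_lower:
  assumes n: "n1 + n2 + n3 = 0"
    and p: "p \<in> T" "p - \<beta> *\<^sub>R n2 \<in> T" "p + \<beta> *\<^sub>R n1 \<in> T"
    and r: "r \<in> T" "r - \<beta> *\<^sub>R n3 \<in> T" "r + \<beta> *\<^sub>R n1 \<in> T"
    and t: "t1 \<in> {0..1::real}" "t2 \<in> {0..1}" "t3 \<in> {0..1}"
    and q: "inner n1 (q t1) = b1" "inner n2 (q t2) = b2" "inner n3 (q t3) = b3"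
  shows "length_bound T q (\<beta> * (b1 + b2 + b3))"
proof -
  have n3: "n3 = - n1 - n2" using n(1) by (metis add.commute add_diff_cancel_right' diff_0 diff_diff_eq)
  have inn: "inner n3 q = - inner n1 q - inner n2 q" for q by (simp add: n3 inner_diff_left)
  consider "t1 \<le> t2 \<and> t2 \<le> t3 \<or> t2 \<le> t3 \<and> t3 \<le> t1 \<or> t3 \<le> t1 \<and> t1 \<le> t2"
    | "t1 \<le> t3 \<and> t3 \<le> t2 \<or> t3 \<le> t2 \<and> t2 \<le> t1 \<or> t2 \<le> t1 \<and> t1 \<le> t3" by linarith
  then show ?thesis
  proof cases
    case 1
    show ?thesis
      by (rule cyclic_lower[OF p t 1], simp add: q[symmetric] n3 inner_add_right inner_diff_left inner_diff_right inner_commute algebra_simps)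
  next
    case 2
    show ?thesis
      by (rule cyclic_lower[OF r t(1) t(3) t(2) 2], simp add: q[symmetric] n3 inner_add_right inner_diff_left inner_diff_right inner_commute algebra_simps)
  qed
qed

lemma chord_lower:
  assumes p: "p \<in> T" "p + \<beta> *\<^sub>R n \<in> T" and t: "t1 \<in> {0..1::real}" "t2 \<in> {0..1}"
    and q: "inner n (q t1) = b1" "inner (- n) (q t2) = b2"
  shows "length_bound T q (\<beta> * (b1 + b2))"
  by (rule cyclic_lower[OF p(1) p(2) p(2) t(1) t(2) t(2)], linarith)
     (simp add: q[symmetric] inner_add_right inner_diff_left inner_commute algebra_simps)

section \<open>Capacities of products with polygons\<close>

lemma scaled_segment_in_convex:
  fixes T :: "R2 set"
  assumes "convex T" "p \<in> T" "p + a *\<^sub>R v \<in> T" "0 \<le> b" "b \<le> a"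
  shows "p + b *\<^sub>R v \<in> T"
proof (cases "a = 0")
  case False
  then have a: "a > 0" using assms by simp
  have "p + b *\<^sub>R v = (1 - b / a) *\<^sub>R p + (b / a) *\<^sub>R (p + a *\<^sub>R v)"
    using a by (simp add: algebra_simps)
  also have "\<dots> \<in> T" using assms a by (intro convexD) (auto simp: field_simps)
  finally show ?thesis .
qed (use assms in auto)

lemma scaled_triangle_in_convex:
  fixes T :: "R2 set"
  assumes "convex T" "p \<in> T" "p - a *\<^sub>R n2 \<in> T" "p + a *\<^sub>R n1 \<in> T" "0 \<le> b" "b \<le> a"
  shows "p - b *\<^sub>R n2 \<in> T" "p + b *\<^sub>R n1 \<in> T"
  using scaled_segment_in_convex[OF assms(1,2), of a "- n2" b] scaled_segment_in_convex[OF assms(1,2,4,5,6)] assms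
  by simp_all

text \<open>The second triangle has the edges of the first in the opposite cyclic order, so it is a
  translate of its point reflection. Both have to fit, because a loop may visit the sides in either
  order.\<close>

definition triangle_fits :: "R2 set \<Rightarrow> R2 \<Rightarrow> R2 \<Rightarrow> R2 \<Rightarrow> real \<Rightarrow> bool" where
  "triangle_fits T n1 n2 n3 \<beta> \<longleftrightarrow> (\<exists>p. p \<in> T \<and> p - \<beta> *\<^sub>R n2 \<in> T \<and> p + \<beta> *\<^sub>R n1 \<in> T) \<and>
     (\<exists>p. p \<in> T \<and> p - \<beta> *\<^sub>R n3 \<in> T \<and> p + \<beta> *\<^sub>R n1 \<in> T)"

definition chord_fits :: "R2 set \<Rightarrow> R2 \<Rightarrow> real \<Rightarrow> bool" where
  "chord_fits T n \<beta> \<longleftrightarrow> (\<exists>p. p \<in> T \<and> p + \<beta> *\<^sub>R n \<in> T)"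

lemma triangle_orbit_bounce:
  assumes o: "triangle_orbit T n1 n2 n3 b1 b2 b3 \<alpha> p q1 q2 q3" and n: "n1 + n2 + n3 = 0" "n1 \<noteq> 0"
    and q: "q1 \<in> K" "q2 \<in> K" "q3 \<in> K"
    and K: "\<And>x. x \<in> K \<Longrightarrow> inner n1 x \<le> b1 \<and> inner n2 x \<le> b2 \<and> inner n3 x \<le> b3"
  shows "bounce K T q1 q2 q3 p (p - \<alpha> *\<^sub>R n2) (p + \<alpha> *\<^sub>R n1)"
proof -
  have n3: "n3 = - n1 - n2" using n(1) by (metis add.commute add_diff_cancel_right' diff_0 diff_diff_eq)
  have a: "\<alpha> > 0" using o by (simp add: triangle_orbit_def)
  have e: "p - (p - \<alpha> *\<^sub>R n2) = \<alpha> *\<^sub>R n2" "p - \<alpha> *\<^sub>R n2 - (p + \<alpha> *\<^sub>R n1) = \<alpha> *\<^sub>R n3" "p + \<alpha> *\<^sub>R n1 - p = \<alpha> *\<^sub>R n1"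
    by (simp_all add: n3 algebra_simps)
  have "\<not> (p = p - \<alpha> *\<^sub>R n2 \<and> p - \<alpha> *\<^sub>R n2 = p + \<alpha> *\<^sub>R n1)"
  proof
    assume "p = p - \<alpha> *\<^sub>R n2 \<and> p - \<alpha> *\<^sub>R n2 = p + \<alpha> *\<^sub>R n1"
    then have "p + \<alpha> *\<^sub>R n1 - p = 0" by (metis diff_self)
    then show False unfolding e using a n(2) by simp
  qed
  then show ?thesis
    using o q K a unfolding bounce_def triangle_orbit_def e
    by (auto intro!: mult_left_mono)
qed

lemma triangle_orbit_reversed:
  assumes n: "n1 + n2 + n3 = 0"
    and o: "triangle_orbit T n1 n3 n2 b1 b3 b2 \<alpha> p q1 q3 q2" and "convex T" "\<beta> \<le> \<alpha>" "0 \<le> \<beta>"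
  shows "\<exists>p. p \<in> T \<and> p - \<beta> *\<^sub>R n3 \<in> T \<and> p + \<beta> *\<^sub>R n1 \<in> T"
  using scaled_triangle_in_convex[OF assms(3), of p \<alpha> n3 n1 \<beta>] o assms by (auto simp: triangle_orbit_def)

text \<open>Each orientation has its own largest scale and its own orbit. The smaller scale is the
  largest one at which both triangles fit, and its orbit attains the capacity.\<close>

theorem c_EHZ_triangle_product:
  assumes n: "n1 + n2 + n3 = 0" "det2 n1 n2 \<noteq> 0" and B: "b1 + b2 + b3 > 0"
    and T: "convex_body T" and K: "K = halfspaces {(n1, b1), (n2, b2), (n3, b3)}" "convex_body K"
  obtains \<alpha> where "\<alpha> > 0" "c_EHZ (K \<times> T) = \<alpha> * (b1 + b2 + b3)"
    "triangle_fits T n1 n2 n3 \<alpha>" "\<And>\<beta>. triangle_fits T n1 n2 n3 \<beta> \<Longrightarrow> \<beta> \<le> \<alpha>"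
proof -
  have n': "n1 + n3 + n2 = 0" using n(1) by (simp add: ac_simps)
  have dets: "det2 n1 n3 \<noteq> 0" "det2 n2 n3 \<noteq> 0" "det2 n3 n1 \<noteq> 0" using det2_sum_zero[OF n(1)] n(2) by auto
  have n1: "n1 \<noteq> 0" using n(2) by (auto simp: det2_def)
  have n3: "n3 = - n1 - n2" using n(1) by (metis add.commute add_diff_cancel_right' diff_0 diff_diff_eq)
  have cT: "convex T" using T by (simp add: convex_body_def)
  obtain \<alpha> p q1 q2 q3 where o: "triangle_orbit T n1 n2 n3 b1 b2 b3 \<alpha> p q1 q2 q3"
    using triangle_orbit_exists[OF T n B] by blast
  have B': "b1 + b3 + b2 > 0" using B by simp
  obtain \<alpha>' p' q1' q2' q3' where o': "triangle_orbit T n1 n3 n2 b1 b3 b2 \<alpha>' p' q1' q3' q2'"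
    using triangle_orbit_exists[OF T n' dets(1) B'] by blast
  have KI: "x \<in> K \<longleftrightarrow> inner n1 x \<le> b1 \<and> inner n2 x \<le> b2 \<and> inner n3 x \<le> b3" for x
    by (auto simp: K(1) halfspaces_def)
  have low: "length_bound T q (\<beta> * (b1 + b2 + b3))"
    if f: "triangle_fits T n1 n2 n3 \<beta>" and q: "untranslatable_loop K q" for \<beta> q
  proof -
    let ?H = "{(n1, b1), (n2, b2), (n3, b3)}"
    have fin: "finite ?H" by simp
    note touch = untranslatable_touches[OF fin q[unfolded K(1)]]
    \<comment> \<open>Such a direction can be blocked only by the first side; \<open>w2\<close> and
      \<open>w3\<close> play the same role for the other two.\<close>
    obtain w1 where "inner n2 w1 = -1" "inner n3 w1 = -1" using linear_system_R2[OF dets(2)] by blast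
    then obtain t1 where t1: "t1 \<in> {0..1}" "inner n1 (q t1) = b1" by (auto intro: touch[of w1])
    obtain w2 where "inner n3 w2 = -1" "inner n1 w2 = -1" using linear_system_R2[OF dets(3)] by blast
    then obtain t2 where t2: "t2 \<in> {0..1}" "inner n2 (q t2) = b2" by (auto intro: touch[of w2])
    obtain w3 where "inner n1 w3 = -1" "inner n2 w3 = -1" using linear_system_R2[OF n(2)] by blast
    then obtain t3 where t3: "t3 \<in> {0..1}" "inner n3 (q t3) = b3" by (auto intro: touch[of w3])
    show ?thesis using f unfolding triangle_fits_def
      using triangle_lower[OF n(1) _ _ _ _ _ _ t1(1) t2(1) t3(1) t1(2) t2(2) t3(2)] by metis
  qed
  have le: "\<beta> \<le> \<alpha> \<and> \<beta> \<le> \<alpha>'" if "triangle_fits T n1 n2 n3 \<beta>" for \<beta>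
    using o o' that unfolding triangle_orbit_def triangle_fits_def by metis
  define a where "a = min \<alpha> \<alpha>'"
  have a0: "a > 0" using o o' by (simp add: a_def triangle_orbit_def)
  have fits: "triangle_fits T n1 n2 n3 a"
    unfolding triangle_fits_def
    using triangle_orbit_reversed[OF n(1) o' cT, of a] triangle_orbit_reversed[OF n' o cT, of a] a0
    by (simp add: a_def)
  have "c_EHZ (K \<times> T) = a * (b1 + b2 + b3)"
  proof (cases "\<alpha> \<le> \<alpha>'")
    case True
    have b: "bounce K T q1 q2 q3 p (p - \<alpha> *\<^sub>R n2) (p + \<alpha> *\<^sub>R n1)"
      by (rule triangle_orbit_bounce[OF o n(1) n1]) (use o KI in \<open>auto simp: triangle_orbit_def\<close>)
    show ?thesis
      by (rule c_EHZ_eqI[OF K(2) T b _ low[OF fits]]) (use o True in \<open>auto simp: triangle_orbit_def a_def\<close>)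
  next
    case False
    have b: "bounce K T q1' q3' q2' p' (p' - \<alpha>' *\<^sub>R n3) (p' + \<alpha>' *\<^sub>R n1)"
      by (rule triangle_orbit_bounce[OF o' n' n1]) (use o' KI in \<open>auto simp: triangle_orbit_def\<close>)
    show ?thesis
      by (rule c_EHZ_eqI[OF K(2) T b _ low[OF fits]]) (use o' False in \<open>auto simp: triangle_orbit_def a_def ac_simps\<close>)
  qed
  then show thesis using that[OF a0 _ fits] le by (auto simp: a_def)
qed

text \<open>The four diagonal directions force the loop to touch one side of every adjacent pair,
  hence two opposite sides. The orbit belonging to the shorter of the two longest chords runs back
  and forth along the normal \<open>u\<close> of a strip that contains \<open>T\<close>. It fits
  into the square because the other chord, at least as long, lies in the same strip and bounds the
  slope of \<open>u\<close>.\<close>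

theorem c_EHZ_square_product:
  fixes x0 y0 s :: real
  assumes s: "s > 0" and T: "convex_body T"
    and K: "K = {x::R2. x0 \<le> x$1 \<and> x$1 \<le> x0 + s \<and> y0 \<le> x$2 \<and> x$2 \<le> y0 + s}" "convex_body K"
  obtains \<alpha> where "\<alpha> > 0" "c_EHZ (K \<times> T) = \<alpha> * s"
    "chord_fits T (axis 1 1) \<alpha>" "chord_fits T (axis 2 1) \<alpha>"
    "\<And>\<beta>. chord_fits T (axis 1 1) \<beta> \<Longrightarrow> chord_fits T (axis 2 1) \<beta> \<Longrightarrow> \<beta> \<le> \<alpha>"
proof -
  let ?e = "axis 1 1 :: R2" and ?f = "axis 2 1 :: R2"
  have cT: "convex T" using T by (simp add: convex_body_def)
  have in1: "inner ?e x = x$1" "inner x ?e = x$1" and in2: "inner ?f x = x$2" "inner x ?f = x$2" for x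
    by (simp_all add: inner_axis inner_axis')
  have ne: "?e \<noteq> 0" "?f \<noteq> 0" by (simp_all add: axis_eq_0_iff)
  obtain \<alpha> p u where A: "\<alpha> > 0" "p \<in> T" "p + \<alpha> *\<^sub>R ?e \<in> T" "inner u ?e = 1"
    "\<And>y. y \<in> T \<Longrightarrow> inner u p \<le> inner u y"
    "\<And>y. y \<in> T \<Longrightarrow> inner u y \<le> inner u (p + \<alpha> *\<^sub>R ?e)"
    "\<And>\<beta> y. y \<in> T \<Longrightarrow> y + \<beta> *\<^sub>R ?e \<in> T \<Longrightarrow> \<beta> \<le> \<alpha>"
    using chord_dual[OF T ne(1)] by blast
  obtain \<alpha>' p' u' where A': "\<alpha>' > 0" "p' \<in> T" "p' + \<alpha>' *\<^sub>R ?f \<in> T" "inner u' ?f = 1"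
    "\<And>y. y \<in> T \<Longrightarrow> inner u' p' \<le> inner u' y"
    "\<And>y. y \<in> T \<Longrightarrow> inner u' y \<le> inner u' (p' + \<alpha>' *\<^sub>R ?f)"
    "\<And>\<beta> y. y \<in> T \<Longrightarrow> y + \<beta> *\<^sub>R ?f \<in> T \<Longrightarrow> \<beta> \<le> \<alpha>'"
    using chord_dual[OF T ne(2)] by blast
  define a where "a = min \<alpha> \<alpha>'"
  have a0: "a > 0" using A A' by (simp add: a_def)
  have f1: "chord_fits T ?e a" unfolding chord_fits_def
    using scaled_segment_in_convex[OF cT A(2,3), of a] A(2) a0 by (auto simp: a_def)
  have f2: "chord_fits T ?f a" unfolding chord_fits_def
    using scaled_segment_in_convex[OF cT A'(2,3), of a] A'(2) a0 by (auto simp: a_def)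
  let ?H = "{(?e, x0 + s), (- ?e, - x0), (?f, y0 + s), (- ?f, - y0)}"
  have KH: "K = halfspaces ?H" by (auto simp: K(1) halfspaces_def in1 in2)
  have low: "length_bound T q (a * s)"
    if q: "untranslatable_loop K q" for q
  proof -
    have fin: "finite ?H" by simp
    note touch = untranslatable_touches[OF fin q[unfolded KH]]
    define R where "R \<longleftrightarrow> (\<exists>t\<in>{0..1}. inner ?e (q t) = x0 + s)"
    define L where "L \<longleftrightarrow> (\<exists>t\<in>{0..1}. inner (- ?e) (q t) = - x0)"
    define U where "U \<longleftrightarrow> (\<exists>t\<in>{0..1}. inner ?f (q t) = y0 + s)"
    define D where "D \<longleftrightarrow> (\<exists>t\<in>{0..1}. inner (- ?f) (q t) = - y0)"
    have RU: "R \<or> U"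
      by (rule touch[of "vector [1, 1]"]) (auto simp: R_def U_def in1 in2)
    have RD: "R \<or> D"
      by (rule touch[of "vector [1, -1]"]) (auto simp: R_def D_def in1 in2)
    have LU: "L \<or> U"
      by (rule touch[of "vector [-1, 1]"]) (auto simp: L_def U_def in1 in2)
    have LD: "L \<or> D"
      by (rule touch[of "vector [-1, -1]"]) (auto simp: L_def D_def in1 in2)
    consider "R \<and> L" | "U \<and> D" using RU RD LU LD by blast
    then show ?thesis
    proof cases
      case 1
      then obtain t1 t2 where t: "t1 \<in> {0..1}" "t2 \<in> {0..1}" "inner ?e (q t1) = x0 + s" "inner (- ?e) (q t2) = - x0"
        unfolding R_def L_def by blast
      then show ?thesis using f1 chord_lower[of _ T a ?e t1 t2 q "x0 + s" "- x0"] unfolding chord_fits_def by auto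
    next
      case 2
      then obtain t1 t2 where t: "t1 \<in> {0..1}" "t2 \<in> {0..1}" "inner ?f (q t1) = y0 + s" "inner (- ?f) (q t2) = - y0"
        unfolding U_def D_def by blast
      then show ?thesis using f2 chord_lower[of _ T a ?f t1 t2 q "y0 + s" "- y0"] unfolding chord_fits_def by auto
    qed
  qed
  have wid: "\<bar>x\<bar> \<le> 1" if "\<beta> > 0" "\<gamma> \<le> \<beta>" "\<beta> * x \<le> \<gamma>" "\<beta> * - x \<le> \<gamma>" for \<beta> \<gamma> x :: real
  proof -
    have "\<beta> * \<bar>x\<bar> \<le> \<gamma>" using that by (simp add: abs_if)
    then have "\<beta> * \<bar>x\<bar> \<le> \<beta> * 1" using order_trans[OF _ that(2)] by simp
    then show ?thesis using that(1) by simp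
  qed
  have "c_EHZ (K \<times> T) = a * s"
  proof (cases "\<alpha> \<le> \<alpha>'")
    case True
    then have aa: "a = \<alpha>" by (simp add: a_def)
    have "\<bar>u$2\<bar> \<le> 1"
    proof (rule wid[OF A'(1) True])
      show "\<alpha>' * u$2 \<le> \<alpha>" "\<alpha>' * - u$2 \<le> \<alpha>"
        using A(5)[OF A'(2)] A(6)[OF A'(2)] A(5)[OF A'(3)] A(6)[OF A'(3)] A(4)
        by (simp_all add: inner_add_right in1 in2)
    qed
    then have u2: "-1 \<le> u$2" "u$2 \<le> 1" by auto
    have u1: "u$1 = 1" using A(4) by (simp add: in1)
    \<comment> \<open>The start is the lower or the upper left corner, according to the slope, so
      that the step \<open>s *\<^sub>R u\<close> ends on the right side of the square.\<close>
    define q1 :: R2 where "q1 = vector [x0, if u$2 \<ge> 0 then y0 else y0 + s]"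
    define q2 where "q2 = q1 + s *\<^sub>R u"
    have su: "0 \<le> s * u$2 \<Longrightarrow> s * u$2 \<le> s" "- s \<le> s * u$2"
      using mult_left_mono[of "u$2" 1 s] mult_left_mono[of "-1" "u$2" s] u2 s by auto
    have q: "q1 \<in> K" "q2 \<in> K" "q1$1 = x0" "q2$1 = x0 + s"
      using s u1 u2 su mult_nonneg_nonneg[of s "u$2"] mult_nonneg_nonpos[of s "u$2"]
      by (auto simp: K(1) q1_def q2_def)
    have st: "q2 - q1 = s *\<^sub>R u" "q1 - q2 = - (s *\<^sub>R u)" by (simp_all add: q2_def)
    have b: "bounce K T q1 q2 q2 (p + \<alpha> *\<^sub>R ?e) p p"
      unfolding bounce_def st
      using q A s by (auto simp: ne in1 in2 K(1) mult_left_mono inner_diff_left)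
    show ?thesis
      by (rule c_EHZ_eqI[OF K(2) T b _ low]) (auto simp: aa st inner_add_right A(4))
  next
    case False
    then have aa: "a = \<alpha>'" by (simp add: a_def)
    have "\<bar>u'$1\<bar> \<le> 1"
    proof (rule wid[OF A(1)])
      show "\<alpha>' \<le> \<alpha>" using False by simp
      show "\<alpha> * u'$1 \<le> \<alpha>'" "\<alpha> * - u'$1 \<le> \<alpha>'"
        using A'(5)[OF A(2)] A'(6)[OF A(2)] A'(5)[OF A(3)] A'(6)[OF A(3)] A'(4)
        by (simp_all add: inner_add_right in1 in2)
    qed
    then have u2: "-1 \<le> u'$1" "u'$1 \<le> 1" by auto
    have u1: "u'$2 = 1" using A'(4) by (simp add: in2)
    define q1 :: R2 where "q1 = vector [if u'$1 \<ge> 0 then x0 else x0 + s, y0]"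
    define q2 where "q2 = q1 + s *\<^sub>R u'"
    have su: "0 \<le> s * u'$1 \<Longrightarrow> s * u'$1 \<le> s" "- s \<le> s * u'$1"
      using mult_left_mono[of "u'$1" 1 s] mult_left_mono[of "-1" "u'$1" s] u2 s by auto
    have q: "q1 \<in> K" "q2 \<in> K" "q1$2 = y0" "q2$2 = y0 + s"
      using s u1 u2 su mult_nonneg_nonneg[of s "u'$1"] mult_nonneg_nonpos[of s "u'$1"]
      by (auto simp: K(1) q1_def q2_def)
    have st: "q2 - q1 = s *\<^sub>R u'" "q1 - q2 = - (s *\<^sub>R u')" by (simp_all add: q2_def)
    have b: "bounce K T q1 q2 q2 (p' + \<alpha>' *\<^sub>R ?f) p' p'"
      unfolding bounce_def st
      using q A' s by (auto simp: ne in1 in2 K(1) mult_left_mono inner_diff_left)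
    show ?thesis
      by (rule c_EHZ_eqI[OF K(2) T b _ low]) (auto simp: aa st inner_add_right A'(4))
  qed
  moreover have "\<beta> \<le> a" if "chord_fits T ?e \<beta>" "chord_fits T ?f \<beta>" for \<beta>
    using that A(7) A'(7) unfolding chord_fits_def a_def by (metis min.bounded_iff)
  ultimately show thesis using that[OF a0 _ f1 f2] by blast
qed

text \<open>\<open>h\<close> and \<open>B\<close> are the extents in direction \<open>n1\<close> of
  the trapezoid and of the uncut triangle, so an action \<open>c\<close> corresponds to chords of
  scale \<open>c / h\<close> and triangles of scale \<open>c / B\<close>. Every loop touches side 1.
  If it also touches the opposite side, the chord bounds its length; otherwise it touches the other
  two sides as in a triangle.\<close>

theorem c_EHZ_trapezoid_product:
  assumes n: "n1 + n2 + n3 = 0" "det2 n1 n2 \<noteq> 0" and B: "B = b1 + b2 + b3" "B > 0"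
    and h: "h = b0 + b1" "h > 0" "h \<le> B"
    and T: "convex_body T" and K: "K = halfspaces {(n1, b1), (n2, b2), (n3, b3), (- n1, b0)}" "convex_body K"
  obtains c where "c > 0" "c_EHZ (K \<times> T) = c"
    "triangle_fits T n1 n2 n3 (c / B)" "chord_fits T n1 (c / h)"
    "\<And>c'. triangle_fits T n1 n2 n3 (c' / B) \<Longrightarrow> chord_fits T n1 (c' / h) \<Longrightarrow> c' \<le> c"
proof -
  have n': "n1 + n3 + n2 = 0" using n(1) by (simp add: ac_simps)
  have dets: "det2 n1 n3 \<noteq> 0" "det2 n2 n3 \<noteq> 0" "det2 n3 n1 \<noteq> 0" using det2_sum_zero[OF n(1)] n(2) by auto
  have n1: "n1 \<noteq> 0" using n(2) by (auto simp: det2_def)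
  have n3: "n3 = - n1 - n2" using n(1) by (metis add.commute add_diff_cancel_right' diff_0 diff_diff_eq)
  have inn: "inner n3 q = - inner n1 q - inner n2 q" for q by (simp add: n3 inner_diff_left)
  have cT: "convex T" using T by (simp add: convex_body_def)
  obtain \<alpha> p q1 q2 q3 where o: "triangle_orbit T n1 n2 n3 b1 b2 b3 \<alpha> p q1 q2 q3"
    using triangle_orbit_exists[OF T n] B by blast
  have B': "b1 + b3 + b2 > 0" using B by simp
  obtain \<alpha>' p' q1' q2' q3' where o': "triangle_orbit T n1 n3 n2 b1 b3 b2 \<alpha>' p' q1' q3' q2'"
    using triangle_orbit_exists[OF T n' dets(1) B'] by blast
  obtain \<gamma> m u where C: "\<gamma> > 0" "m \<in> T" "m + \<gamma> *\<^sub>R n1 \<in> T" "inner u n1 = 1"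
    "\<And>y. y \<in> T \<Longrightarrow> inner u m \<le> inner u y"
    "\<And>y. y \<in> T \<Longrightarrow> inner u y \<le> inner u (m + \<gamma> *\<^sub>R n1)"
    "\<And>\<beta> y. y \<in> T \<Longrightarrow> y + \<beta> *\<^sub>R n1 \<in> T \<Longrightarrow> \<beta> \<le> \<gamma>"
    using chord_dual[OF T n1] by blast
  have KI: "x \<in> K \<longleftrightarrow> inner n1 x \<le> b1 \<and> inner n2 x \<le> b2 \<and> inner n3 x \<le> b3 \<and> - inner n1 x \<le> b0" for x
    by (auto simp: K(1) halfspaces_def)
  have low: "length_bound T q c"
    if f: "triangle_fits T n1 n2 n3 (c / B)" "chord_fits T n1 (c / h)" and q: "untranslatable_loop K q" for c q
  proof -
    let ?H = "{(n1, b1), (n2, b2), (n3, b3), (- n1, b0)}"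
    have fin: "finite ?H" by simp
    note touch = untranslatable_touches[OF fin q[unfolded K(1)]]
    have cB: "c / B * (b1 + b2 + b3) = c" and ch: "c / h * (b1 + b0) = c" using B h by (simp_all add: add.commute)
    obtain w1 where w1: "inner n2 w1 = -1" "inner n3 w1 = -1" using linear_system_R2[OF dets(2)] by blast
    then have "inner n1 w1 = 2" using inn[of w1] by simp
    with w1 obtain t1 where t1: "t1 \<in> {0..1}" "inner n1 (q t1) = b1" by (auto intro: touch[of w1])
    show ?thesis
    proof (cases "\<exists>t\<in>{0..1}. inner (- n1) (q t) = b0")
      case True
      then obtain t0 where t0: "t0 \<in> {0..1}" "inner (- n1) (q t0) = b0" by blast
      show ?thesis using f(2) chord_lower[OF _ _ t1(1) t0(1) t1(2) t0(2)] ch unfolding chord_fits_def by metis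
    next
      case False
      obtain w2 where w2: "inner n3 w2 = -1" "inner n1 w2 = -1" using linear_system_R2[OF dets(3)] by blast
      obtain t2 where t2: "t2 \<in> {0..1}" "inner n2 (q t2) = b2"
        by (rule touch[of w2]) (use w2 False in auto)
      obtain w3 where w3: "inner n1 w3 = -1" "inner n2 w3 = -1" using linear_system_R2[OF n(2)] by blast
      obtain t3 where t3: "t3 \<in> {0..1}" "inner n3 (q t3) = b3"
        by (rule touch[of w3]) (use w3 False in auto)
      show ?thesis using f(1) unfolding triangle_fits_def
        using triangle_lower[OF n(1) _ _ _ _ _ _ t1(1) t2(1) t3(1) t1(2) t2(2) t3(2), where \<beta>="c / B"] cB by metis
    qed
  qed
  have le: "\<beta> \<le> \<alpha> \<and> \<beta> \<le> \<alpha>'" if "triangle_fits T n1 n2 n3 \<beta>" for \<beta>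
    using o o' that unfolding triangle_orbit_def triangle_fits_def by metis
  define a where "a = min \<alpha> \<alpha>'"
  have a0: "a > 0" using o o' by (simp add: a_def triangle_orbit_def)
  define c where "c = min (a * B) (\<gamma> * h)"
  have c0: "c > 0" using a0 C(1) B(2) h(2) by (simp add: c_def)
  have cle: "0 \<le> c / B" "c / B \<le> \<alpha>" "c / B \<le> \<alpha>'" "0 \<le> c / h" "c / h \<le> \<gamma>"
  proof -
    have "c \<le> a * B" "c \<le> \<gamma> * h" by (simp_all add: c_def)
    moreover have "a * B \<le> \<alpha> * B" "a * B \<le> \<alpha>' * B" using B(2) by (simp_all add: a_def mult_right_mono)
    ultimately have "c \<le> \<alpha> * B" "c \<le> \<alpha>' * B" "c \<le> \<gamma> * h" by linarith+
    then show "0 \<le> c / B" "c / B \<le> \<alpha>" "c / B \<le> \<alpha>'" "0 \<le> c / h" "c / h \<le> \<gamma>"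
      using c0 B(2) h(2) by (simp_all add: pos_divide_le_eq)
  qed
  have fits: "triangle_fits T n1 n2 n3 (c / B)"
    unfolding triangle_fits_def
    using triangle_orbit_reversed[OF n(1) o' cT cle(3,1)] triangle_orbit_reversed[OF n' o cT cle(2,1)] by blast
  have fitc: "chord_fits T n1 (c / h)"
    unfolding chord_fits_def using scaled_segment_in_convex[OF cT C(2,3) cle(4,5)] C(2) by blast
  \<comment> \<open>A triangle orbit not longer than \<open>\<gamma> * h\<close> respects the cut:
    with its momenta replaced by ends of the longest chord, the length is \<open>\<gamma>\<close>
    times the drop of \<open>inner n1\<close> from \<open>b1\<close> to the other bounce point, so
    this drop is at most \<open>h\<close>.\<close>
  have short: "- inner n1 y2 \<le> b0 \<and> - inner n1 y3 \<le> b0"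
    if O: "triangle_orbit T n1 v2 v3 b1 d2 d3 \<beta> z y1 y2 y3" and \<beta>: "\<beta> * (b1 + d2 + d3) \<le> \<gamma> * h" for v2 v3 d2 d3 \<beta> z y1 y2 y3
  proof -
    note O = O[unfolded triangle_orbit_def]
    have len: "inner (y2 - y1) x1 + inner (y3 - y2) x2 + inner (y1 - y3) x3 \<le> \<gamma> * h"
      if "x1 \<in> T" "x2 \<in> T" "x3 \<in> T" for x1 x2 x3
    proof -
      have "inner (y2 - y1) x1 \<le> inner (y2 - y1) z" "inner (y3 - y2) x2 \<le> inner (y3 - y2) (z - \<beta> *\<^sub>R v2)"
        "inner (y1 - y3) x3 \<le> inner (y1 - y3) (z + \<beta> *\<^sub>R n1)" using O that by blast+
      then show ?thesis using O \<beta> by linarith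
    qed
    have q1: "inner n1 y1 = b1" using O by blast
    have "\<gamma> * (b1 - inner n1 y2) \<le> \<gamma> * h" "\<gamma> * (b1 - inner n1 y3) \<le> \<gamma> * h"
      using len[OF C(2,3,3)] len[OF C(2,2,3)] q1
      by (simp_all add: inner_add_right inner_diff_left inner_commute algebra_simps)
    then show ?thesis using C(1) h(1) by simp
  qed
  have "c_EHZ (K \<times> T) = c"
  proof -
    consider "\<alpha> \<le> \<alpha>'" "\<alpha> * B \<le> \<gamma> * h" | "\<alpha>' \<le> \<alpha>" "\<alpha>' * B \<le> \<gamma> * h" | "\<gamma> * h \<le> a * B"
      by (smt (verit) a_def)
    then show ?thesis
    proof cases
      case 1
      have cc: "c = \<alpha> * B" using 1 by (simp add: c_def a_def)
      note O = o[unfolded triangle_orbit_def]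
      have K23: "- inner n1 q2 \<le> b0" "- inner n1 q3 \<le> b0" using short[OF o] 1 B(1) by simp_all
      have b: "bounce K T q1 q2 q3 p (p - \<alpha> *\<^sub>R n2) (p + \<alpha> *\<^sub>R n1)"
        by (rule triangle_orbit_bounce[OF o n(1) n1]) (use O K23 KI h in auto)
      show ?thesis
        by (rule c_EHZ_eqI[OF K(2) T b _ low[OF fits fitc]]) (use O cc B in auto)
    next
      case 2
      have cc: "c = \<alpha>' * B" using 2 by (simp add: c_def a_def)
      note O = o'[unfolded triangle_orbit_def]
      have K23: "- inner n1 q3' \<le> b0" "- inner n1 q2' \<le> b0" using short[OF o'] 2 B(1) by (simp_all add: ac_simps)
      have b: "bounce K T q1' q3' q2' p' (p' - \<alpha>' *\<^sub>R n3) (p' + \<alpha>' *\<^sub>R n1)"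
        by (rule triangle_orbit_bounce[OF o' n' n1]) (use O K23 KI h in auto)
      show ?thesis
        by (rule c_EHZ_eqI[OF K(2) T b _ low[OF fits fitc]]) (use O cc B in \<open>auto simp: ac_simps\<close>)
    next
      case 3
      have cc: "c = \<gamma> * h" using 3 by (simp add: c_def)
      \<comment> \<open>\<open>u\<close> varies on \<open>T\<close> by at most
        \<open>\<gamma>\<close>. Comparison with the edges of the inscribed triangle bounds
        \<open>inner n2 u\<close> and \<open>inner n3 u\<close> from below.\<close>
      have w: "inner u y - inner u y' \<le> \<gamma>" if "y \<in> T" "y' \<in> T" for y y'
        using C(6)[OF that(1)] C(5)[OF that(2)] C(4) by (simp add: inner_add_right)
      have "a * B \<le> \<alpha> * B" using B(2) by (simp add: a_def mult_right_mono)
      then have "\<gamma> * h \<le> \<alpha> * B" using 3 by linarith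
      moreover have sl: "0 \<le> B + h * v" if "\<alpha> * - v \<le> \<gamma>" "\<gamma> * h \<le> \<alpha> * B" for v
      proof -
        have "\<alpha> * (h * - v) \<le> h * \<gamma>" using mult_left_mono[OF that(1), of h] h(2) by (simp add: mult_ac)
        then have "\<alpha> * (h * - v) \<le> \<alpha> * B" using that(2) by (simp add: mult_ac)
        moreover have "\<alpha> > 0" using o by (simp add: triangle_orbit_def)
        ultimately have "h * - v \<le> B" by (simp only: mult_le_cancel_left_pos)
        then show ?thesis by simp
      qed
      moreover have "\<alpha> * - inner n2 u \<le> \<gamma>" "\<alpha> * - inner n3 u \<le> \<gamma>"
        using w[of "p - \<alpha> *\<^sub>R n2" p] w[of "p + \<alpha> *\<^sub>R n1" "p - \<alpha> *\<^sub>R n2"] o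
        by (simp_all add: triangle_orbit_def n3 inner_add_right inner_diff_right inner_diff_left inner_commute algebra_simps)
      ultimately have s: "0 \<le> B + h * inner n2 u" "0 \<le> B + h * inner n3 u" by blast+
      have nu: "inner n1 u = 1" "inner n3 u = - 1 - inner n2 u" using C(4) inn[of u] by (simp_all add: inner_commute)
      \<comment> \<open>The least position along side 1 for which both ends of the step satisfy the
        third constraint; the bounds \<open>s\<close> then give the second constraint.\<close>
      define l where "l = max (- b1 - b3) (- b1 - b3 - h * inner n3 u)"
      have n3u: "h * inner n3 u = - h - h * inner n2 u" by (simp add: nu algebra_simps)
      have l: "- b1 - b3 \<le> l" "- b1 - b3 - h * inner n3 u \<le> l" by (simp_all add: l_def)
      have l': "l \<le> b2" unfolding l_def by (rule max.boundedI) (use s B h(3) n3u in linarith)+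
      have l'': "l \<le> b2 + h * inner n2 u" unfolding l_def by (rule max.boundedI) (use s B h(3) n3u in linarith)+
      obtain qa where qa: "inner n1 qa = b1" "inner n2 qa = l" using linear_system_R2[OF n(2)] by blast
      define qb where "qb = qa - h *\<^sub>R u"
      have qaK: "qa \<in> K" using qa l l' h by (simp add: KI inn)
      have qbK: "qb \<in> K" using qa l l'' h nu n3u by (simp add: KI inn qb_def inner_diff_right algebra_simps)
      have na: "inner n1 qb = - b0" using qa nu h by (simp add: qb_def inner_diff_right)
      have st: "qa - qb = h *\<^sub>R u" "qb - qa = - (h *\<^sub>R u)" by (simp_all add: qb_def)
      have G: "- (\<gamma> * inner n1 y) \<le> \<gamma> * b0" if "y \<in> K" for y
        using mult_left_mono[of "- inner n1 y" b0 \<gamma>] that C(1) by (simp add: KI)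
      have b: "bounce K T qb qa qa (m + \<gamma> *\<^sub>R n1) m m"
        unfolding bounce_def st
        using qaK qbK C h na qa n1 G by (auto simp: mult_left_mono KI)
      show ?thesis
        by (rule c_EHZ_eqI[OF K(2) T b _ low[OF fits fitc]]) (auto simp: cc st inner_add_right C(4))
    qed
  qed
  moreover have "c' \<le> c" if "triangle_fits T n1 n2 n3 (c' / B)" "chord_fits T n1 (c' / h)" for c'
  proof -
    have "c' / B \<le> a" using le[OF that(1)] by (simp add: a_def)
    moreover have "c' / h \<le> \<gamma>" using that(2) C(7) unfolding chord_fits_def by blast
    ultimately show ?thesis using B(2) h(2) by (simp add: c_def pos_divide_le_eq)
  qed
  ultimately show thesis using that[OF c0 _ fits fitc] by blast
qed

section \<open>Areas of slabs in the plane\<close>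

lemma det2_diff [simp]: "det2 a (b - c) = det2 a b - det2 a c" "det2 (a - b) c = det2 a c - det2 b c"
  and det2_add [simp]: "det2 a (b + c) = det2 a b + det2 a c" "det2 (a + b) c = det2 a c + det2 b c"
  and det2_scaleR [simp]: "det2 (r *\<^sub>R a) b = r * det2 a b" "det2 a (r *\<^sub>R b) = r * det2 a b"
  and det2_self [simp]: "det2 a a = 0" and det2_zero [simp]: "det2 a 0 = 0" "det2 0 a = 0"
  by (simp_all add: det2_def algebra_simps)

lemma det2_commute: "det2 a b = - det2 b a"
  by (simp add: det2_def)

lemma det2_inner: "det2 e x = inner (vector [- (e$2), e$1]) x"
  by (simp add: det2_def inner_R2)

lemma perp_nonzero: "(e :: R2) \<noteq> 0 \<Longrightarrow> (vector [- (e$2), e$1] :: R2) \<noteq> 0"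
  by (auto simp: vec_eq_iff forall_2)

lemma compact_lebesgue: "compact (S :: 'a::euclidean_space set) \<Longrightarrow> vol S = measure lborel S"
  by (simp add: vol_def compact_imp_closed)

lemma vol_triangle: "vol (convex hull {a, b, c :: R2}) = \<bar>det2 (b - a) (c - a)\<bar> / 2"
proof -
  have "compact (convex hull {a, b, c})" by (simp add: compact_convex_hull)
  then have "vol (convex hull {a, b, c}) = measure lborel (convex hull {a, b, c})" by (rule compact_lebesgue)
  also have "\<dots> = \<bar>(c $ 1 - a $ 1) * (b $ 2 - a $ 2) - (b $ 1 - a $ 1) * (c $ 2 - a $ 2)\<bar> / 2"
    by (rule content_triangle)
  also have "\<dots> = \<bar>det2 (b - a) (c - a)\<bar> / 2"
    unfolding det2_def by (simp add: abs_minus_commute mult.commute)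
  finally show ?thesis .
qed

lemma vol_mono: "S \<subseteq> T \<Longrightarrow> S \<in> lmeasurable \<Longrightarrow> T \<in> lmeasurable \<Longrightarrow> vol S \<le> vol T"
  unfolding vol_def by (rule measure_mono_fmeasurable) auto

lemma vol_affine: "vol ((\<lambda>v::R2. l *\<^sub>R v + s) ` S) = l\<^sup>2 * vol S"
  unfolding vol_def by (simp add: measure_lebesgue_affine)

lemma vol_Times:
  fixes S :: "R2 set" and T :: "R2 set"
  assumes "compact S" "compact T"
  shows "vol (S \<times> T) = vol S * vol T"
proof -
  have m: "S \<in> sets borel" "T \<in> sets borel" using assms by (auto simp: compact_imp_closed)
  have "measure lborel (S \<times> T) = measure (lborel \<Otimes>\<^sub>M lborel) (S \<times> T)" by (simp add: lborel_prod)
  also have "\<dots> = measure lborel S * measure lborel T"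
    using m by (simp add: measure_def lborel.emeasure_pair_measure_Times enn2real_mult)
  finally show ?thesis using assms by (simp add: compact_lebesgue compact_Times)
qed

lemma convex_body_lmeasurable: "convex_body T \<Longrightarrow> T \<in> lmeasurable"
  by (simp add: convex_body_def lmeasurable_compact)

text \<open>A missed interior point would leave a nonempty open set of measure 0, so
  \<open>X\<close> contains the interior of \<open>T\<close> and, being closed, its closure. All
  equality cases end here.\<close>

lemma convex_body_vol_eqI:
  assumes T: "convex_body T" and X: "compact X" "X \<subseteq> T" and v: "vol T \<le> vol X"
  shows "X = T"
proof -
  have m: "T \<in> lmeasurable" "X \<in> lmeasurable" using T X by (auto simp: convex_body_def lmeasurable_compact)
  have "open (interior T - X)" using X(1) by (simp add: compact_imp_closed open_Diff)
  moreover have "negligible (T - X)"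
  proof -
    have "measure lebesgue (T - X) = measure lebesgue T - measure lebesgue X"
      by (rule measurable_measure_Diff) (use m X in auto)
    also have "\<dots> \<le> 0" using v by (simp add: vol_def)
    finally have "measure lebesgue (T - X) = 0" by (simp add: measure_le_0_iff)
    then show ?thesis using m by (simp add: negligible_iff_measure fmeasurable.Diff)
  qed
  then have "negligible (interior T - X)" by (rule negligible_subset) (use interior_subset in auto)
  ultimately have "interior T - X = {}" using open_not_negligible by blast
  then have "closure (interior T) \<subseteq> X" using X(1) by (intro closure_minimal) (auto simp: compact_imp_closed)
  moreover have "closure (interior T) = closure T"
    using T by (intro convex_closure_interior) (auto simp: convex_body_def)
  ultimately show ?thesis using X closure_subset[of T] by blast
qed

text \<open>\<open>det2 e x\<close> is the height of \<open>x\<close> over the line spanned by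
  \<open>e\<close>, multiplied by the length of \<open>e\<close>. With chords measured in units of
  \<open>e\<close>, areas are products without further normalisation.\<close>

definition slab :: "R2 \<Rightarrow> real \<Rightarrow> real \<Rightarrow> R2 set" where
  "slab e a b = {x. a \<le> det2 e x \<and> det2 e x \<le> b}"

lemma closed_slab: "closed (slab e a b)"
proof -
  have "slab e a b = {x. inner (vector [- (e$2), e$1]) x \<ge> a} \<inter> {x. inner (vector [- (e$2), e$1]) x \<le> b}"
    by (auto simp: slab_def det2_inner)
  then show ?thesis by (simp add: closed_Int closed_halfspace_ge closed_halfspace_le)
qed

lemma convex_slab: "convex (slab e a b)"
proof -
  have "slab e a b = {x. inner (vector [- (e$2), e$1]) x \<ge> a} \<inter> {x. inner (vector [- (e$2), e$1]) x \<le> b}"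
    by (auto simp: slab_def det2_inner)
  then show ?thesis by (simp add: convex_Int convex_halfspace_ge convex_halfspace_le)
qed

lemma negligible_line: "e \<noteq> 0 \<Longrightarrow> negligible {x. det2 e x = b}"
  unfolding det2_inner by (rule negligible_hyperplane) (simp add: perp_nonzero)

lemma vol_slab_add:
  assumes T: "compact T" and e: "e \<noteq> 0" and abc: "a \<le> b" "b \<le> c"
  shows "vol (T \<inter> slab e a b) + vol (T \<inter> slab e b c) = vol (T \<inter> slab e a c)"
proof -
  have m: "T \<inter> slab e a b \<in> lmeasurable" "T \<inter> slab e b c \<in> lmeasurable"
    using T by (auto intro!: lmeasurable_compact compact_Int_closed simp: closed_slab)
  have "negligible ((T \<inter> slab e a b) \<inter> (T \<inter> slab e b c))"
    by (rule negligible_subset[OF negligible_line[OF e, of b]]) (auto simp: slab_def)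
  then have "vol ((T \<inter> slab e a b) \<union> (T \<inter> slab e b c)) = vol (T \<inter> slab e a b) + vol (T \<inter> slab e b c)"
    unfolding vol_def using measure_Un3[OF m] by (simp add: negligible_imp_measure0)
  moreover have "(T \<inter> slab e a b) \<union> (T \<inter> slab e b c) = T \<inter> slab e a c"
    using abc by (auto simp: slab_def)
  ultimately show ?thesis by simp
qed

lemma vol_slab_le: "compact T \<Longrightarrow> vol (T \<inter> slab e a b) \<le> vol T"
  by (rule vol_mono) (auto intro!: lmeasurable_compact compact_Int_closed simp: closed_slab)

text \<open>The two chords span a trapezoid inside the slab, cut by a diagonal into two triangles
  that overlap only on a line. A chord of length 0 gives the area of a triangle.\<close>

lemma vol_slab_chords:
  assumes T: "compact T" "convex T" and e: "e \<noteq> 0" and m: "m1 \<ge> 0" "m2 \<ge> 0"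
    and p: "p \<in> T" "p + m1 *\<^sub>R e \<in> T" "q \<in> T" "q + m2 *\<^sub>R e \<in> T" and le: "det2 e p \<le> det2 e q"
  shows "(m1 + m2) / 2 * (det2 e q - det2 e p) \<le> vol (T \<inter> slab e (det2 e p) (det2 e q))"
proof (cases "det2 e p = det2 e q")
  case True
  then show ?thesis by (simp add: vol_def)
next
  case False
  define A where "A = convex hull {p, p + m1 *\<^sub>R e, q}"
  define B where "B = convex hull {q, q + m2 *\<^sub>R e, p + m1 *\<^sub>R e}"
  let ?S = "T \<inter> slab e (det2 e p) (det2 e q)"
  have cS: "convex ?S" using T convex_slab by (simp add: convex_Int)
  have AS: "A \<subseteq> ?S" unfolding A_def by (rule hull_minimal[where S=convex, OF _ cS]) (use p le in \<open>auto simp: slab_def\<close>)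
  have BS: "B \<subseteq> ?S" unfolding B_def by (rule hull_minimal[where S=convex, OF _ cS]) (use p le in \<open>auto simp: slab_def\<close>)
  have mAB: "A \<in> lmeasurable" "B \<in> lmeasurable"
    unfolding A_def B_def by (simp_all add: lmeasurable_compact compact_convex_hull)
  \<comment> \<open>Direction of the diagonal from \<open>p + m1 *\<^sub>R e\<close> to
    \<open>q\<close>; the two triangles lie on opposite sides of it.\<close>
  define d where "d = q - p - m1 *\<^sub>R e"
  have d0: "d \<noteq> 0"
  proof
    assume "d = 0"
    then have "det2 e d = 0" by simp
    then show False using False by (simp add: d_def)
  qed
  define v :: R2 where "v = vector [- (d$2), d$1]"
  have dv: "inner v x = det2 d x" for x by (simp add: v_def det2_inner)
  have "A \<subseteq> {x. inner v x \<ge> det2 d q}"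
    unfolding A_def
  proof (rule hull_minimal[where S=convex, OF _ convex_halfspace_ge])
    have "det2 d p - det2 d q = m1 * (det2 e q - det2 e p)"
      by (simp add: d_def det2_commute[of q p] det2_commute[of q e] det2_commute[of p e] algebra_simps)
    moreover have "m1 * (det2 e q - det2 e p) \<ge> 0" using m le by simp
    moreover have "det2 d (p + m1 *\<^sub>R e) = det2 d q"
    proof -
      have "p + m1 *\<^sub>R e = q - d" by (simp add: d_def)
      then show ?thesis by simp
    qed
    ultimately show "{p, p + m1 *\<^sub>R e, q} \<subseteq> {x. inner v x \<ge> det2 d q}" unfolding dv by auto
  qed
  moreover have "B \<subseteq> {x. inner v x \<le> det2 d q}"
    unfolding B_def
  proof (rule hull_minimal[where S=convex, OF _ convex_halfspace_le])
    have "det2 d (q + m2 *\<^sub>R e) - det2 d q = - m2 * (det2 e q - det2 e p)"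
      by (simp add: d_def det2_commute[of q e] det2_commute[of p e] algebra_simps)
    moreover have "m2 * (det2 e q - det2 e p) \<ge> 0" using m le by simp
    moreover have "det2 d (p + m1 *\<^sub>R e) = det2 d q"
    proof -
      have "p + m1 *\<^sub>R e = q - d" by (simp add: d_def)
      then show ?thesis by simp
    qed
    ultimately show "{q, q + m2 *\<^sub>R e, p + m1 *\<^sub>R e} \<subseteq> {x. inner v x \<le> det2 d q}" unfolding dv by auto
  qed
  ultimately have "A \<inter> B \<subseteq> {x. det2 d x = det2 d q}" unfolding dv by fastforce
  then have "negligible (A \<inter> B)" using negligible_line[OF d0] negligible_subset by blast
  then have "vol (A \<union> B) = vol A + vol B"
    unfolding vol_def using measure_Un3[OF mAB] by (simp add: negligible_imp_measure0)
  moreover have "vol (A \<union> B) \<le> vol ?S"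
    by (rule vol_mono) (use AS BS mAB T in \<open>auto intro!: lmeasurable_compact compact_Int_closed simp: closed_slab fmeasurable.Un\<close>)
  moreover have "vol A = m1 * (det2 e q - det2 e p) / 2"
    unfolding A_def vol_triangle using m(1) le by (simp add: abs_mult flip: right_diff_distrib)
  moreover have "vol B = m2 * (det2 e q - det2 e p) / 2"
  proof -
    have "det2 (q + m2 *\<^sub>R e - q) (p + m1 *\<^sub>R e - q) = - (m2 * (det2 e q - det2 e p))"
      by (simp add: algebra_simps)
    then show ?thesis unfolding B_def vol_triangle using m(2) le by (simp add: abs_mult)
  qed
  ultimately show ?thesis by (simp add: field_simps)
qed

section \<open>Quadrilaterals cut along a diagonal\<close>

lemma convex_hull_3I:
  assumes "x = u *\<^sub>R a + v *\<^sub>R b + w *\<^sub>R c" "0 \<le> u" "0 \<le> v" "0 \<le> w" "u + v + w = 1"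
  shows "x \<in> convex hull {a, b, c}"
  using assms unfolding convex_hull_3 by blast

text \<open>In a barycentric representation the crossing relation trades weight on \<open>b\<close>
  and \<open>d\<close> for weight on \<open>a\<close> and \<open>c\<close>. This is done until
  \<open>b\<close> or \<open>d\<close> drops out.\<close>

lemma crossing_diagonals_hull:
  fixes a b c d :: "'a::real_vector"
  assumes z: "(1 - s) *\<^sub>R a + s *\<^sub>R c = (1 - r) *\<^sub>R b + r *\<^sub>R d" and rs: "0 \<le> r" "r \<le> 1" "0 \<le> s" "s \<le> 1"
  shows "convex hull {a, b, c, d} \<subseteq> convex hull {a, c, b} \<union> convex hull {a, c, d}"
proof
  fix x assume "x \<in> convex hull {a, b, c, d}"
  then obtain u w y where y: "y \<in> convex hull {b, c, d}" "0 \<le> u" "0 \<le> w" "u + w = 1" "x = u *\<^sub>R a + w *\<^sub>R y"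
    unfolding convex_hull_insert[of "{b, c, d}" a, simplified] by blast
  from y(1) obtain p q t where pqt: "0 \<le> p" "0 \<le> q" "0 \<le> t" "p + q + t = 1" "y = p *\<^sub>R b + q *\<^sub>R c + t *\<^sub>R d"
    unfolding convex_hull_3 by blast
  define A B C D where "A = u" and "B = w * p" and "C = w * q" and "D = w * t"
  have "w * p + w * q + w * t = w" using pqt(4) by (metis distrib_left mult.right_neutral)
  then have x: "x = A *\<^sub>R a + B *\<^sub>R b + C *\<^sub>R c + D *\<^sub>R d" "0 \<le> A" "0 \<le> B" "0 \<le> C" "0 \<le> D" "A + B + C + D = 1"
    using y pqt by (simp_all add: A_def B_def C_def D_def algebra_simps)
  show "x \<in> convex hull {a, c, b} \<union> convex hull {a, c, d}"
  proof (cases "D * (1 - r) \<le> B * r")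
    case True
    show ?thesis
    proof (cases "r = 0")
      case True
      then have "D = 0" using \<open>D * (1 - r) \<le> B * r\<close> x by simp
      then have "x \<in> convex hull {a, c, b}" using x by (intro convex_hull_3I[of _ A _ C _ B]) (auto simp: algebra_simps)
      then show ?thesis by simp
    next
      case False
      then have r: "r > 0" using rs by simp
      define k where "k = D / r"
      have k: "k \<ge> 0" "k * r = D" using r x by (auto simp: k_def)
      have "k * (1 - r) * r \<le> B * r" using True k by (metis mult.assoc mult.commute)
      then have kB: "k * (1 - r) \<le> B" using r by simp
      have "D *\<^sub>R d = k *\<^sub>R (r *\<^sub>R d)" using k by simp
      also have "r *\<^sub>R d = (1 - s) *\<^sub>R a + s *\<^sub>R c - (1 - r) *\<^sub>R b" using z by simp
      finally have "x = (A + k * (1 - s)) *\<^sub>R a + (C + k * s) *\<^sub>R c + (B - k * (1 - r)) *\<^sub>R b"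
        unfolding x(1) by (simp add: algebra_simps)
      then have "x \<in> convex hull {a, c, b}"
        by (rule convex_hull_3I) (use x k kB rs mult_nonneg_nonneg[of k s] mult_left_le[of s k] in \<open>auto simp: algebra_simps\<close>)
      then show ?thesis by simp
    qed
  next
    case F: False
    then have "r < 1"
      using x rs by (smt (verit) mult_nonneg_nonneg mult_eq_0_iff)
    then have r: "1 - r > 0" by simp
    define k where "k = B / (1 - r)"
    have k: "k \<ge> 0" "k * (1 - r) = B" using r x by (auto simp: k_def)
    have "k * r * (1 - r) \<le> D * (1 - r)" using F k by (metis mult.assoc mult.commute linear)
    then have kB: "k * r \<le> D" using r by simp
    have "B *\<^sub>R b = k *\<^sub>R ((1 - r) *\<^sub>R b)" using k by simp
    also have "(1 - r) *\<^sub>R b = (1 - s) *\<^sub>R a + s *\<^sub>R c - r *\<^sub>R d" using z by simp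
    finally have "x = (A + k * (1 - s)) *\<^sub>R a + (C + k * s) *\<^sub>R c + (D - k * r) *\<^sub>R d"
      unfolding x(1) by (simp add: algebra_simps)
    then have "x \<in> convex hull {a, c, d}"
      by (rule convex_hull_3I) (use x k kB rs mult_nonneg_nonneg[of k s] mult_left_le[of s k] in \<open>auto simp: algebra_simps\<close>)
    then show ?thesis by simp
  qed
qed

lemma vol_crossing_diagonals:
  fixes a b c d :: R2
  assumes "(1 - s) *\<^sub>R a + s *\<^sub>R c = (1 - r) *\<^sub>R b + r *\<^sub>R d" "0 \<le> r" "r \<le> 1" "0 \<le> s" "s \<le> 1"
  shows "vol (convex hull {a, b, c, d}) \<le> (\<bar>det2 (c - a) (b - a)\<bar> + \<bar>det2 (c - a) (d - a)\<bar>) / 2"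
proof -
  have m: "convex hull {a, c, b} \<in> lmeasurable" "convex hull {a, c, d} \<in> lmeasurable" "convex hull {a, b, c, d} \<in> lmeasurable"
    by (simp_all add: lmeasurable_compact compact_convex_hull)
  have "vol (convex hull {a, b, c, d}) \<le> vol (convex hull {a, c, b} \<union> convex hull {a, c, d})"
    by (rule vol_mono[OF crossing_diagonals_hull[OF assms]]) (use m in auto)
  also have "\<dots> \<le> vol (convex hull {a, c, b}) + vol (convex hull {a, c, d})"
    unfolding vol_def by (rule measure_Un_le) (use m in auto)
  finally show ?thesis by (simp add: vol_triangle)
qed

section \<open>Minimal area of bodies containing given chords and triangles\<close>

lemma convex_bodyI:
  fixes S :: "'a::euclidean_space set"
  assumes "compact S" "convex S" "vol S > 0"
  shows "convex_body S"
proof -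
  have "\<not> negligible S" using assms(3) by (auto simp: vol_def negligible_imp_measure0)
  then show ?thesis using assms negligible_convex_interior by (auto simp: convex_body_def)
qed

lemma diamond_eq_hull:
  assumes "a1 \<in> {0..1}" "a2 \<in> {0..1}"
  shows "diamond a1 a2 = convex hull {vector [0, a2], vector [a1, 0], vector [1, a2], vector [a1, 1]}"
    (is "_ = convex hull {?W, ?S, ?E, ?N}")
proof
  let ?C = "convex hull {?W, ?S, ?E, ?N}"
  have inC: "?W \<in> ?C" "?S \<in> ?C" "?E \<in> ?C" "?N \<in> ?C" by (simp_all add: hull_inc)
  have "x \<in> ?C" if x: "0 \<le> x$1" "x$1 \<le> 1" "x$2 = a2" for x :: R2
  proof -
    have "x = (1 - x$1) *\<^sub>R ?W + x$1 *\<^sub>R ?E" using x by (simp add: vec_eq_iff forall_2 algebra_simps)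
    also have "\<dots> \<in> ?C" using x inC by (intro convexD) auto
    finally show ?thesis .
  qed
  moreover have "x \<in> ?C" if x: "0 \<le> x$2" "x$2 \<le> 1" "x$1 = a1" for x :: R2
  proof -
    have "x = (1 - x$2) *\<^sub>R ?S + x$2 *\<^sub>R ?N" using x by (simp add: vec_eq_iff forall_2 algebra_simps)
    also have "\<dots> \<in> ?C" using x inC by (intro convexD) auto
    finally show ?thesis .
  qed
  ultimately show "diamond a1 a2 \<subseteq> ?C"
    unfolding diamond_def by (intro hull_minimal) auto
  show "?C \<subseteq> diamond a1 a2"
    unfolding diamond_def by (intro hull_mono) (use assms in auto)
qed

text \<open>The diagonals are perpendicular, cross and have length 1. Cutting along the horizontal
  one bounds the area from above, and the slabs on its two sides bound it from below.\<close>

lemma diamond_body: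
  assumes a: "a1 \<in> {0..1}" "a2 \<in> {0..1}"
  shows "vol (diamond a1 a2) = 1/2" "convex_body (diamond a1 a2)"
proof -
  let ?W = "vector [0, a2] :: R2" and ?S = "vector [a1, 0] :: R2" and ?E = "vector [1, a2] :: R2" and ?N = "vector [a1, 1] :: R2"
  let ?C = "convex hull {?W, ?S, ?E, ?N}"
  have eq: "diamond a1 a2 = ?C" by (rule diamond_eq_hull[OF a])
  have C: "compact ?C" "convex ?C" by (simp_all add: compact_convex_hull)
  have inC: "?W \<in> ?C" "?S \<in> ?C" "?E \<in> ?C" "?N \<in> ?C" by (simp_all add: hull_inc)
  have "vol ?C \<le> (\<bar>det2 (?E - ?W) (?S - ?W)\<bar> + \<bar>det2 (?E - ?W) (?N - ?W)\<bar>) / 2"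
    by (rule vol_crossing_diagonals[where s=a1 and r=a2]) (use a in \<open>auto simp: vec_eq_iff forall_2 algebra_simps\<close>)
  also have "\<dots> = 1/2" using a by (simp add: det2_def)
  finally have le: "vol ?C \<le> 1/2" .
  let ?e = "vector [1, 0] :: R2"
  have e: "?e \<noteq> 0" by (auto simp: vec_eq_iff forall_2)
  have We: "?W + 1 *\<^sub>R ?e = ?E" by (simp add: vec_eq_iff forall_2)
  have d: "det2 ?e ?W = a2" "det2 ?e ?S = 0" "det2 ?e ?N = 1" by (simp_all add: det2_def)
  have "1 / 2 * (a2 - 0) \<le> vol (?C \<inter> slab ?e 0 a2)"
    using vol_slab_chords[OF C e, of 0 1 ?S ?W] inC We a by (simp add: d)
  moreover have "1 / 2 * (1 - a2) \<le> vol (?C \<inter> slab ?e a2 1)"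
    using vol_slab_chords[OF C e, of 1 0 ?W ?N] inC We a by (simp add: d)
  moreover have "vol (?C \<inter> slab ?e 0 a2) + vol (?C \<inter> slab ?e a2 1) \<le> vol ?C"
    using vol_slab_add[OF C(1) e, of 0 a2 1] vol_slab_le[OF C(1), of ?e 0 1] a by simp
  ultimately have "1/2 \<le> vol ?C" by (simp add: field_simps)
  then show "vol (diamond a1 a2) = 1/2" using le eq by simp
  then show "convex_body (diamond a1 a2)" using C by (intro convex_bodyI) (auto simp: eq)
qed

lemma vol_triangle_le:
  assumes "convex_body T" "a \<in> T" "b \<in> T" "c \<in> T"
  shows "\<bar>det2 (b - a) (c - a)\<bar> / 2 \<le> vol T"
proof -
  have "convex hull {a, b, c} \<subseteq> T" using assms by (intro hull_minimal) (auto simp: convex_body_def)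
  then have "vol (convex hull {a, b, c}) \<le> vol T"
    by (rule vol_mono) (use assms in \<open>auto simp: lmeasurable_compact compact_convex_hull convex_body_lmeasurable\<close>)
  then show ?thesis by (simp add: vol_triangle)
qed

text \<open>If the chords cross, \<open>T\<close> contains the diamond that they span, which already
  has area \<open>l\<^sup>2 / 2\<close>. If they do not, one chord and an end of the other span a
  triangle of larger area.\<close>

lemma cross_chords_vol:
  assumes T: "convex_body T" and l: "l > 0" and f: "chord_fits T (axis 1 1) l" "chord_fits T (axis 2 1) l"
  shows "l\<^sup>2 / 2 \<le> vol T"
    "vol T \<le> l\<^sup>2 / 2 \<Longrightarrow> \<exists>s. \<exists>a1\<in>{0..1}. \<exists>a2\<in>{0..1}. T = (\<lambda>v. l *\<^sub>R v + s) ` diamond a1 a2"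
proof -
  obtain P Q where P: "P \<in> T" "P + l *\<^sub>R axis 1 1 \<in> T" and Q: "Q \<in> T" "Q + l *\<^sub>R axis 2 1 \<in> T"
    using f unfolding chord_fits_def by blast
  have cT: "convex T" using T by (simp add: convex_body_def)
  \<comment> \<open>Relative positions of the crossing point on the two chords; the chords meet
    exactly if both numbers lie in the unit interval.\<close>
  define a1 where "a1 = (Q$1 - P$1) / l"
  define a2 where "a2 = (P$2 - Q$2) / l"
  have la: "l * a1 = Q$1 - P$1" "l * a2 = P$2 - Q$2" using l by (simp_all add: a1_def a2_def)
  have ax: "(axis 1 1 :: R2) $ 1 = 1" "(axis 1 1 :: R2) $ 2 = 0" "(axis 2 1 :: R2) $ 1 = 0" "(axis 2 1 :: R2) $ 2 = 1"
    by (simp_all add: axis_def)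
  define s where "s = (vector [P$1, Q$2] :: R2)"
  have "l\<^sup>2 / 2 \<le> vol T \<and> (vol T \<le> l\<^sup>2 / 2 \<longrightarrow> (\<exists>s. \<exists>a1\<in>{0..1}. \<exists>a2\<in>{0..1}. T = (\<lambda>v. l *\<^sub>R v + s) ` diamond a1 a2))"
  proof (cases "a1 \<in> {0..1} \<and> a2 \<in> {0..1}")
    case True
    let ?D = "(\<lambda>v. l *\<^sub>R v + s) ` diamond a1 a2"
    have D: "compact (diamond a1 a2)" "convex (diamond a1 a2)" using diamond_body(2) True by (auto simp: convex_body_def)
    have cD: "compact ?D" by (rule compact_continuous_image[OF _ D(1)]) (intro continuous_intros)
    have sub: "?D \<subseteq> T"
    proof -
      have "convex ((\<lambda>v. l *\<^sub>R v + s) -` T)"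
        unfolding convex_def
      proof (clarsimp)
        fix x y and u v :: real
        assume "l *\<^sub>R x + s \<in> T" "l *\<^sub>R y + s \<in> T" "0 \<le> u" "0 \<le> v" "u + v = 1"
        then have "u *\<^sub>R (l *\<^sub>R x + s) + v *\<^sub>R (l *\<^sub>R y + s) \<in> T" by (intro convexD[OF cT]) auto
        moreover have "u *\<^sub>R (l *\<^sub>R x + s) + v *\<^sub>R (l *\<^sub>R y + s) = l *\<^sub>R (u *\<^sub>R x + v *\<^sub>R y) + (u + v) *\<^sub>R s"
          by (simp add: algebra_simps)
        ultimately show "l *\<^sub>R (u *\<^sub>R x + v *\<^sub>R y) + s \<in> T" using \<open>u + v = 1\<close> by simp
      qed
      moreover have "l *\<^sub>R vector [0, a2] + s = P" "l *\<^sub>R vector [1, a2] + s = P + l *\<^sub>R axis 1 1"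
        "l *\<^sub>R vector [a1, 0] + s = Q" "l *\<^sub>R vector [a1, 1] + s = Q + l *\<^sub>R axis 2 1"
        by (simp_all add: vec_eq_iff forall_2 s_def la ax)
      ultimately have "convex hull {vector [0, a2], vector [a1, 0], vector [1, a2], vector [a1, 1]} \<subseteq> (\<lambda>v. l *\<^sub>R v + s) -` T"
        using P Q by (intro hull_minimal) auto
      then show ?thesis using diamond_eq_hull True by auto
    qed
    have v: "vol ?D = l\<^sup>2 / 2" using diamond_body(1) True by (simp add: vol_affine)
    have "vol ?D \<le> vol T" by (rule vol_mono[OF sub]) (use cD T in \<open>auto simp: lmeasurable_compact convex_body_lmeasurable\<close>)
    moreover have "?D = T" if "vol T \<le> l\<^sup>2 / 2"
      by (rule convex_body_vol_eqI[OF T cD sub]) (use that v in simp)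
    ultimately show ?thesis using v True by metis
  next
    case False
    have big: "l\<^sup>2 / 2 < vol T" if "a \<in> T" "b \<in> T" "c \<in> T" "det2 (b - a) (c - a) = l * m \<or> det2 (b - a) (c - a) = - (l * m)" "m > l" for a b c m
    proof -
      have "l * m > 0" using that(5) l by simp
      then have "\<bar>det2 (b - a) (c - a)\<bar> = l * m" using that(4) by auto
      moreover
      have "l * l < l * m" using l that by simp
      ultimately show ?thesis using vol_triangle_le[OF T that(1-3)] by (simp add: power2_eq_square)
    qed
    have d: "det2 (axis 1 1) x = x$2" "det2 (axis 2 1) x = - (x$1)" for x by (simp_all add: det2_def ax)
    consider "a1 < 0" | "a1 > 1" | "a2 < 0" | "a2 > 1" using False by fastforce
    then have "l\<^sup>2 / 2 < vol T"
    proof cases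
      case 1
      then have "l * a1 < 0" using l by (simp add: mult_pos_neg)
      then have "Q$1 - P$1 < 0" unfolding la .
      then show ?thesis
        by (intro big[OF Q P(2), of "l - (Q$1 - P$1)"] disjI2) (simp_all add: la d ax algebra_simps)
    next
      case 2
      then have "l * a1 > l" using l by simp
      then have "Q$1 - P$1 > l" unfolding la .
      then show ?thesis
        by (intro big[OF Q P(1), of "Q$1 - P$1"] disjI1) (simp_all add: la d ax algebra_simps)
    next
      case 3
      then have "l * a2 < 0" using l by (simp add: mult_pos_neg)
      then have "P$2 - Q$2 < 0" unfolding la .
      then show ?thesis
        by (intro big[OF P Q(2), of "l - (P$2 - Q$2)"] disjI1) (simp_all add: la d ax algebra_simps)
    next
      case 4
      then have "l * a2 > l" using l by simp
      then have "P$2 - Q$2 > l" unfolding la .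
      then show ?thesis
        by (intro big[OF P Q(1), of "P$2 - Q$2"] disjI2) (simp_all add: la d ax algebra_simps)
    qed
    then show ?thesis by simp
  qed
  then show "l\<^sup>2 / 2 \<le> vol T"
    "vol T \<le> l\<^sup>2 / 2 \<Longrightarrow> \<exists>s. \<exists>a1\<in>{0..1}. \<exists>a2\<in>{0..1}. T = (\<lambda>v. l *\<^sub>R v + s) ` diamond a1 a2" by blast+
qed

text \<open>The edge from \<open>V1\<close> to \<open>V2\<close> and its reflected copy are parallel
  chords at height difference \<open>h\<close>. If \<open>h \<ge> d\<close>, their parallelogram
  suffices. Otherwise it has area \<open>h\<close>, and the caps with apexes \<open>V3\<close> and
  \<open>t - V3\<close> add \<open>(d - h) / 2\<close> each.\<close>

lemma vol_antipodal_triangles_aux: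
  assumes X: "compact X" "convex X" and V: "V1 \<in> X" "V2 \<in> X" "V3 \<in> X" "t - V1 \<in> X" "t - V2 \<in> X" "t - V3 \<in> X"
    and d: "d = det2 (V2 - V1) (V3 - V1)" "d > 0" and \<tau>: "det2 (V2 - V1) (t - V1 - V2) \<ge> 0"
  shows "d \<le> vol X"
proof -
  define e where "e = V2 - V1"
  define h where "h = det2 (V2 - V1) (t - V1 - V2)"
  have e: "e \<noteq> 0" using d by (auto simp: e_def)
  have eV: "V1 + 1 *\<^sub>R e = V2" "t - V2 + 1 *\<^sub>R e = t - V1" by (simp_all add: e_def)
  have lev: "det2 e (t - V2) = det2 e V1 + h" "det2 e V3 = det2 e V1 + d" "det2 e (t - V3) = det2 e V1 + h - d"
    unfolding h_def e_def d(1) using det2_commute[of V2 V1] by simp_all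
  have mem: "V1 + 1 *\<^sub>R e \<in> X" "t - V2 + 1 *\<^sub>R e \<in> X" using V by (simp_all only: eV)
  have h0: "h \<ge> 0" using \<tau> by (simp only: h_def)
  let ?s = "\<lambda>a b. vol (X \<inter> slab e a b)"
  have 1: "h \<le> ?s (det2 e V1) (det2 e (t - V2))"
    using vol_slab_chords[OF X e _ _ V(1) mem(1) V(5) mem(2)] h0 lev by simp
  show ?thesis
  proof (cases "h \<ge> d")
    case True
    then show ?thesis using 1 vol_slab_le[OF X(1), of e] by (meson order_trans)
  next
    case False
    have 2: "(d - h) / 2 \<le> ?s (det2 e (t - V2)) (det2 e V3)"
      using vol_slab_chords[OF X e _ _ V(5) mem(2) V(3), of 0] V False lev by simp
    have 3: "(d - h) / 2 \<le> ?s (det2 e (t - V3)) (det2 e V1)"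
      using vol_slab_chords[OF X e _ _ V(6) _ V(1) mem(1), of 0] V False lev by simp
    have "?s (det2 e (t - V3)) (det2 e V1) + (?s (det2 e V1) (det2 e (t - V2)) + ?s (det2 e (t - V2)) (det2 e V3)) = ?s (det2 e (t - V3)) (det2 e V3)"
      using vol_slab_add[OF X(1) e, of "det2 e V1" "det2 e (t - V2)" "det2 e V3"]
        vol_slab_add[OF X(1) e, of "det2 e (t - V3)" "det2 e V1" "det2 e V3"] False lev h0 d(2) by simp
    then have "d \<le> ?s (det2 e (t - V3)) (det2 e V3)" using 1 2 3 by (simp add: field_simps)
    then show ?thesis using vol_slab_le[OF X(1), of e] by (meson order_trans)
  qed
qed

text \<open>The height differences of the three pairs of parallel edges add up to a positive number,
  so one of them is nonnegative and a cyclic relabelling applies.\<close>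

lemma vol_antipodal_triangles:
  assumes X: "compact X" "convex X" and V: "V1 \<in> X" "V2 \<in> X" "V3 \<in> X" "t - V1 \<in> X" "t - V2 \<in> X" "t - V3 \<in> X"
    and d: "det2 (V2 - V1) (V3 - V1) > 0"
  shows "det2 (V2 - V1) (V3 - V1) \<le> vol X"
proof -
  have r: "det2 (V3 - V2) (V1 - V2) = det2 (V2 - V1) (V3 - V1)" "det2 (V1 - V3) (V2 - V3) = det2 (V2 - V1) (V3 - V1)"
    by (simp_all add: det2_def algebra_simps)
  have "det2 (V2 - V1) (t - V1 - V2) + det2 (V3 - V2) (t - V2 - V3) + det2 (V1 - V3) (t - V3 - V1) = 2 * det2 (V2 - V1) (V3 - V1)"
    by (simp add: det2_def algebra_simps)
  then consider "det2 (V2 - V1) (t - V1 - V2) \<ge> 0" | "det2 (V3 - V2) (t - V2 - V3) \<ge> 0" | "det2 (V1 - V3) (t - V3 - V1) \<ge> 0"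
    using d by linarith
  then show ?thesis
  proof cases
    case 1 then show ?thesis using vol_antipodal_triangles_aux[OF X V refl d] by simp
  next
    case 2 then show ?thesis using vol_antipodal_triangles_aux[OF X V(2,3,1,5,6,4) refl] d r by simp
  next
    case 3 then show ?thesis using vol_antipodal_triangles_aux[OF X V(3,1,2,6,4,5) refl] d r by simp
  qed
qed

text \<open>\<open>z\<close> is the relative height of the chord over the base \<open>E\<close>; at
  that height the triangle has width \<open>1 - z\<close> in units of \<open>E\<close>.\<close>

lemma chord_in_triangle:
  assumes w: "w \<in> convex hull {P, P + E, R}" "w + m *\<^sub>R E \<in> convex hull {P, P + E, R}"
    and nz: "det2 E (R - P) \<noteq> 0"
  obtains y z where "0 \<le> y" "0 \<le> z" "y + m + z \<le> 1" "w - P = y *\<^sub>R E + z *\<^sub>R (R - P)"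
proof -
  obtain y z where yz: "w = P + y *\<^sub>R (P + E - P) + z *\<^sub>R (R - P)" "0 \<le> y" "0 \<le> z" "y + z \<le> 1"
    using w(1) unfolding convex_hull_3_alt by blast
  obtain y' z' where yz': "w + m *\<^sub>R E = P + y' *\<^sub>R (P + E - P) + z' *\<^sub>R (R - P)" "0 \<le> y'" "0 \<le> z'" "y' + z' \<le> 1"
    using w(2) unfolding convex_hull_3_alt by blast
  define D where "D = R - P"
  have e1: "w - P = y *\<^sub>R E + z *\<^sub>R D" and e2: "(w - P) + m *\<^sub>R E = y' *\<^sub>R E + z' *\<^sub>R D"
    using yz(1) yz'(1) by (simp_all add: D_def[symmetric] add.assoc)
  have eq: "(y + m - y') *\<^sub>R E + (z - z') *\<^sub>R (R - P) = 0"
    using e2 unfolding e1 D_def[symmetric] by (simp add: algebra_simps)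
  have "det2 E ((y + m - y') *\<^sub>R E + (z - z') *\<^sub>R (R - P)) = (z - z') * det2 E (R - P)"
    by (simp only: det2_add det2_scaleR det2_self)
  then have z: "z = z'" using eq nz by simp
  then have "(y + m - y') * det2 E (R - P) = det2 ((y + m - y') *\<^sub>R E + (z - z') *\<^sub>R (R - P)) (R - P)"
    by (simp only: det2_add det2_scaleR det2_self)
  then have "y + m = y'" using eq nz by simp
  then show thesis using that[of y z] yz yz' z by simp
qed

text \<open>The extremal body is the unit square with \<open>P\<close> as a corner,
  \<open>X = P + (\<kappa>, 0)\<close> and \<open>Y = P + (0, \<kappa>)\<close>. Slabs parallel to
  \<open>E\<close> give two bounds: \<open>A1\<close> uses only the long chord and the apexes
  \<open>L\<close> and \<open>R\<close>, while \<open>A2\<close> also uses the two shorter chords.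
  Adding \<open>\<kappa>\<close> times \<open>A1\<close> to \<open>A2\<close> gives
  \<open>(\<kappa> + 1) * vol T \<ge> \<kappa> + 1\<close>.\<close>

lemma trapezoid_dual_vol:
  fixes \<kappa> :: real
  assumes T: "convex_body T" and k: "0 < \<kappa>" "\<kappa> < 1" and E: "E = (vector [1, 1] :: R2)"
    and P: "P \<in> T" "P + E \<in> T"
    and X: "X \<in> T" "X + (1 - \<kappa>) *\<^sub>R E \<in> T" "X + vector [- \<kappa>, 1] \<in> T"
    and Y: "Y \<in> T" "Y + (1 - \<kappa>) *\<^sub>R E \<in> T" "Y + vector [1, - \<kappa>] \<in> T"
  shows "1 \<le> vol T" "vol T \<le> 1 \<Longrightarrow> T = (\<lambda>v. v + P) ` cbox 0 1"
proof -
  have cT: "compact T" "convex T" using T by (auto simp: convex_body_def)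
  have E0: "E \<noteq> 0" by (auto simp: E vec_eq_iff forall_2)
  define L where "L = X + vector [- \<kappa>, 1]"
  define R where "R = Y + vector [1, - \<kappa>]"
  \<comment> \<open>The chords through \<open>X\<close> and \<open>Y\<close> lie at distance \<open>b\<close> and \<open>a\<close> on the two sides of the long chord (or
    on the same side, when a sign is negative). In the main case \<open>A1\<close> decreases and \<open>A2\<close> increases with
    \<open>a + b\<close>, and the combination in \<open>comb\<close> is independent of \<open>a + b\<close>.\<close>
  define b where "b = det2 E P - det2 E X"
  define a where "a = det2 E Y - det2 E P"
  define m0 where "m0 = det2 E P"
  have lev: "det2 E P = m0" "det2 E X = m0 - b" "det2 E Y = m0 + a" "det2 E L = m0 + (1 + \<kappa> - b)" "det2 E R = m0 - (1 + \<kappa> - a)"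
    by (simp_all add: a_def b_def m0_def L_def R_def E det2_def)
  have LR: "L \<in> T" "R \<in> T" using X Y by (auto simp: L_def R_def)
  let ?s = "\<lambda>x y. vol (T \<inter> slab E x y)"
  note ch = vol_slab_chords[OF cT E0]
  have PL: "(1 + \<kappa> - b) / 2 \<le> ?s m0 (m0 + (1 + \<kappa> - b))" if "b \<le> 1 + \<kappa>"
    using ch[of 1 0 P L] P LR that by (simp add: lev)
  have RP: "(1 + \<kappa> - a) / 2 \<le> ?s (m0 - (1 + \<kappa> - a)) m0" if "a \<le> 1 + \<kappa>"
    using ch[of 0 1 R P] P LR that by (simp add: lev)
  have XP: "(2 - \<kappa>) / 2 * b \<le> ?s (m0 - b) m0" if "0 \<le> b"
    using ch[of "1 - \<kappa>" 1 X P] P X that k by (simp add: lev)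
  have PY: "(2 - \<kappa>) / 2 * a \<le> ?s m0 (m0 + a)" if "0 \<le> a"
    using ch[of 1 "1 - \<kappa>" P Y] P Y that k by (simp add: lev)
  have YL: "(1 - \<kappa>) / 2 * (1 + \<kappa> - b - a) \<le> ?s (m0 + a) (m0 + (1 + \<kappa> - b))" if "a + b \<le> 1 + \<kappa>"
    using ch[of "1 - \<kappa>" 0 Y L] Y LR that k by (simp add: lev)
  have RX: "(1 - \<kappa>) / 2 * (1 + \<kappa> - b - a) \<le> ?s (m0 - (1 + \<kappa> - a)) (m0 - b)" if "a + b \<le> 1 + \<kappa>"
    using ch[of 0 "1 - \<kappa>" R X] X LR that k by (simp add: lev algebra_simps)
  note add = vol_slab_add[OF cT(1) E0]
  have lv: "?s x y \<le> vol T" for x y by (rule vol_slab_le[OF cT(1)])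
  have kk: "\<kappa> * \<kappa> < \<kappa>" using k mult_strict_left_mono[of \<kappa> 1 \<kappa>] by simp
  have big: "1 < (2 - \<kappa>) / 2 * x" if "x \<ge> 1 + \<kappa>" for x
  proof -
    have "(2 - \<kappa>) / 2 * (1 + \<kappa>) \<le> (2 - \<kappa>) / 2 * x" by (rule mult_left_mono) (use that k in auto)
    moreover have "(2 - \<kappa>) / 2 * (1 + \<kappa>) > 1" using kk by (simp add: algebra_simps)
    ultimately show ?thesis by linarith
  qed
  have A1: "1 + \<kappa> - (a + b) / 2 \<le> vol T" if "a \<le> 1 + \<kappa>" "b \<le> 1 + \<kappa>"
  proof -
    have "(1 + \<kappa> - a) / 2 + (1 + \<kappa> - b) / 2 \<le> vol T"
      using PL RP that add[of "m0 - (1 + \<kappa> - a)" m0 "m0 + (1 + \<kappa> - b)"] lv[of "m0 - (1 + \<kappa> - a)" "m0 + (1 + \<kappa> - b)"] by linarith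
    then show ?thesis by (simp add: field_simps)
  qed
  have A2: "(1 - \<kappa>) * (1 + \<kappa> - (a + b)) + (2 - \<kappa>) / 2 * (a + b) \<le> vol T" if ab: "0 \<le> a" "0 \<le> b" "a + b \<le> 1 + \<kappa>"
  proof -
    have "(1 - \<kappa>) / 2 * (1 + \<kappa> - b - a) + ((2 - \<kappa>) / 2 * b + ((2 - \<kappa>) / 2 * a + (1 - \<kappa>) / 2 * (1 + \<kappa> - b - a))) \<le> vol T"
      using RX XP PY YL ab add[of m0 "m0 + a" "m0 + (1 + \<kappa> - b)"] add[of "m0 - b" m0 "m0 + (1 + \<kappa> - b)"]
        add[of "m0 - (1 + \<kappa> - a)" "m0 - b" "m0 + (1 + \<kappa> - b)"] lv[of "m0 - (1 + \<kappa> - a)" "m0 + (1 + \<kappa> - b)"] by linarith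
    moreover have "(1 - \<kappa>) / 2 * (1 + \<kappa> - b - a) + ((2 - \<kappa>) / 2 * b + ((2 - \<kappa>) / 2 * a + (1 - \<kappa>) / 2 * (1 + \<kappa> - b - a)))
      = (1 - \<kappa>) * (1 + \<kappa> - (a + b)) + (2 - \<kappa>) / 2 * (a + b)" by (simp add: field_simps)
    ultimately show ?thesis by simp
  qed
  have comb: "\<kappa> * (1 + \<kappa> - (a + b) / 2) + ((1 - \<kappa>) * (1 + \<kappa> - (a + b)) + (2 - \<kappa>) / 2 * (a + b)) = \<kappa> + 1"
    by (simp add: field_simps)
  have half: "1 < (1 + \<kappa> - x) / 2 + ((2 - \<kappa>) / 2 * x + (1 - \<kappa>) / 2 * (1 + \<kappa> - x - y))" if "y < 0" for x y
  proof -
    have "(1 - \<kappa>) / 2 * y < 0" using that k by (intro mult_pos_neg) auto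
    moreover have "1 < (2 + \<kappa> - \<kappa> * \<kappa>) / 2" using kk by simp
    ultimately have "1 < (2 + \<kappa> - \<kappa> * \<kappa>) / 2 - (1 - \<kappa>) / 2 * y" by (simp only: less_diff_eq)
    also have "\<dots> = (1 + \<kappa> - x) / 2 + ((2 - \<kappa>) / 2 * x + (1 - \<kappa>) / 2 * (1 + \<kappa> - x - y))"
      by (simp add: field_simps)
    finally show ?thesis .
  qed
  \<comment> \<open>In every case but the first, the slabs that are still available have total area
    above 1.\<close>
  consider (main) "0 \<le> a" "0 \<le> b" "a + b \<le> 1 + \<kappa>" | (far) "0 \<le> a" "0 \<le> b" "a + b \<ge> 1 + \<kappa>"
    | (neg) "a < 0" "b < 0" | (a) "b < 0" "0 \<le> a" "a \<le> 1 + \<kappa>" | (a') "b < 0" "1 + \<kappa> \<le> a"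
    | (b) "a < 0" "0 \<le> b" "b \<le> 1 + \<kappa>" | (b') "a < 0" "1 + \<kappa> \<le> b" by linarith
  then have dich: "1 < vol T \<or> (0 \<le> a \<and> 0 \<le> b \<and> a + b \<le> 1 + \<kappa>)"
  proof cases
    case far
    have "(2 - \<kappa>) / 2 * (a + b) \<le> vol T"
      using XP PY far add[of "m0 - b" m0 "m0 + a"] lv[of "m0 - b" "m0 + a"] by (simp add: distrib_left)
    then show ?thesis using big[of "a + b"] far by linarith
  next
    case neg
    then show ?thesis using A1 k by (simp add: field_simps)
  next
    case a
    have ee: "1 + \<kappa> - a - b = 1 + \<kappa> - b - a" by simp
    have "(1 + \<kappa> - a) / 2 + ((2 - \<kappa>) / 2 * a + (1 - \<kappa>) / 2 * (1 + \<kappa> - a - b)) \<le> vol T"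
      using RP PY YL a add[of m0 "m0 + a" "m0 + (1 + \<kappa> - b)"] add[of "m0 - (1 + \<kappa> - a)" m0 "m0 + (1 + \<kappa> - b)"]
        lv[of "m0 - (1 + \<kappa> - a)" "m0 + (1 + \<kappa> - b)"] unfolding ee by linarith
    then show ?thesis using half[of b a] a by linarith
  next
    case a'
    then show ?thesis using PY lv[of m0 "m0 + a"] big[of a] k by linarith
  next
    case b
    have "(1 + \<kappa> - b) / 2 + ((2 - \<kappa>) / 2 * b + (1 - \<kappa>) / 2 * (1 + \<kappa> - b - a)) \<le> vol T"
      using PL XP RX b add[of "m0 - b" m0 "m0 + (1 + \<kappa> - b)"] add[of "m0 - (1 + \<kappa> - a)" "m0 - b" "m0 + (1 + \<kappa> - b)"]
        lv[of "m0 - (1 + \<kappa> - a)" "m0 + (1 + \<kappa> - b)"] by linarith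
    then show ?thesis using half[of a b] b by linarith
  next
    case b'
    then show ?thesis using XP lv[of "m0 - b" m0] big[of b] k by linarith
  qed auto
  have mainge: "1 \<le> vol T" if "0 \<le> a \<and> 0 \<le> b \<and> a + b \<le> 1 + \<kappa>"
  proof -
    have "\<kappa> * (1 + \<kappa> - (a + b) / 2) \<le> \<kappa> * vol T" by (rule mult_left_mono) (use A1 that k in auto)
    then have "\<kappa> + 1 \<le> \<kappa> * vol T + vol T" using A2 comb that by linarith
    then have "(\<kappa> + 1) * 1 \<le> (\<kappa> + 1) * vol T" by (simp add: algebra_simps)
    then show ?thesis using k by (simp only: mult_le_cancel_left_pos)
  qed
  then show "1 \<le> vol T" using dich by linarith
  assume v1: "vol T \<le> 1"
  then have main: "0 \<le> a" "0 \<le> b" "a + b \<le> 1 + \<kappa>" using dich by auto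
  \<comment> \<open>At area 1 the bound \<open>A1\<close> limits \<open>a + b\<close> from below and
    \<open>A2\<close> limits it from above by the same number.\<close>
  have s: "a + b = 2 * \<kappa>"
  proof -
    have "a + b \<ge> 2 * \<kappa>" using A1 main v1 by (simp add: field_simps)
    moreover have "(1 - \<kappa>) * (1 + \<kappa> - (a + b)) + (2 - \<kappa>) / 2 * (a + b) = 1 - \<kappa> * \<kappa> + \<kappa> * ((a + b) / 2)"
      by (simp add: field_simps)
    then have "\<kappa> * ((a + b) / 2) \<le> \<kappa> * \<kappa>" using A2[OF main] v1 by linarith
    then have "(a + b) / 2 \<le> \<kappa>" using k by simp
    ultimately show ?thesis by simp
  qed
  define TL where "TL = convex hull {P, P + E, L}"
  define TR where "TR = convex hull {P, P + E, R}"
  have cLR: "compact TL" "compact TR" by (simp_all add: TL_def TR_def compact_convex_hull)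
  have subT: "TL \<subseteq> T" "TR \<subseteq> T" unfolding TL_def TR_def by (rule hull_minimal; use P LR cT in auto)+
  have PE: "det2 E (P + E) = m0" by (simp add: lev)
  have levL: "det2 E x \<ge> m0" if "x \<in> TL" for x
  proof -
    have "TL \<subseteq> {x. inner (vector [- (E$2), E$1]) x \<ge> m0}"
      unfolding TL_def by (rule hull_minimal[where S=convex, OF _ convex_halfspace_ge])
        (use main lev PE in \<open>auto simp: det2_inner[symmetric]\<close>)
    then show ?thesis using that by (auto simp: det2_inner)
  qed
  have levR: "det2 E x \<le> m0" if "x \<in> TR" for x
  proof -
    have "TR \<subseteq> {x. inner (vector [- (E$2), E$1]) x \<le> m0}"
      unfolding TR_def by (rule hull_minimal[where S=convex, OF _ convex_halfspace_le])
        (use main lev PE in \<open>auto simp: det2_inner[symmetric]\<close>)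
    then show ?thesis using that by (auto simp: det2_inner)
  qed
  \<comment> \<open>The two triangles over the long chord exhaust the area, so \<open>T\<close> is
    their union and contains the shorter chords only inside these triangles.\<close>
  have Teq: "TL \<union> TR = T"
  proof (rule convex_body_vol_eqI[OF T])
    show "compact (TL \<union> TR)" "TL \<union> TR \<subseteq> T" using cLR subT by auto
    have "TL \<inter> TR \<subseteq> {x. det2 E x = m0}" using levL levR by fastforce
    then have "negligible (TL \<inter> TR)" using negligible_line[OF E0] negligible_subset by blast
    then have "vol (TL \<union> TR) = vol TL + vol TR"
      unfolding vol_def using measure_Un3[of TL lebesgue TR] cLR by (simp add: lmeasurable_compact negligible_imp_measure0)
    moreover have "vol TL = (1 + \<kappa> - b) / 2" unfolding TL_def vol_triangle using main lev by simp
    moreover have "vol TR = (1 + \<kappa> - a) / 2" unfolding TR_def vol_triangle using main lev by simp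
    ultimately show "vol T \<le> vol (TL \<union> TR)" using v1 s by (simp add: field_simps)
  qed
  have ab1: "1 + \<kappa> - a > 0" "1 + \<kappa> - b > 0" using s main k by linarith+
  have dR: "det2 E (R - P) = - (1 + \<kappa> - a)" and dL: "det2 E (L - P) = 1 + \<kappa> - b" by (simp_all add: lev)
  \<comment> \<open>For \<open>b > 0\<close> the chord at \<open>X\<close> lies strictly on one side
    of the long chord, which decides the triangle that contains it.\<close>
  have Xc: "\<exists>y. 0 \<le> y \<and> y + b / (1 + \<kappa> - a) \<le> \<kappa> \<and> X - P = y *\<^sub>R E + (b / (1 + \<kappa> - a)) *\<^sub>R (R - P)" if "b > 0"
  proof -
    have "det2 E X < m0" "det2 E (X + (1 - \<kappa>) *\<^sub>R E) < m0" using that by (simp_all add: lev)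
    then have "X \<in> TR" "X + (1 - \<kappa>) *\<^sub>R E \<in> TR" using Teq X levL by (metis Un_iff not_le)+
    then obtain y z where yz: "0 \<le> y" "0 \<le> z" "y + (1 - \<kappa>) + z \<le> 1" "X - P = y *\<^sub>R E + z *\<^sub>R (R - P)"
      using chord_in_triangle[of X P E R "1 - \<kappa>"] dR ab1 unfolding TR_def by auto
    have "det2 E (X - P) = z * det2 E (R - P)" unfolding yz(4) by (simp only: det2_add det2_scaleR det2_self)
    then have "b = z * (1 + \<kappa> - a)" using dR by (simp add: lev algebra_simps)
    then have "z = b / (1 + \<kappa> - a)" using ab1 by (simp add: field_simps)
    then show ?thesis using yz by auto
  qed
  have Yc: "\<exists>y. 0 \<le> y \<and> y + a / (1 + \<kappa> - b) \<le> \<kappa> \<and> Y - P = y *\<^sub>R E + (a / (1 + \<kappa> - b)) *\<^sub>R (L - P)" if "a > 0"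
  proof -
    have "det2 E Y > m0" "det2 E (Y + (1 - \<kappa>) *\<^sub>R E) > m0" using that by (simp_all add: lev)
    then have "Y \<in> TL" "Y + (1 - \<kappa>) *\<^sub>R E \<in> TL" using Teq Y levR by (metis Un_iff not_le)+
    then obtain y z where yz: "0 \<le> y" "0 \<le> z" "y + (1 - \<kappa>) + z \<le> 1" "Y - P = y *\<^sub>R E + z *\<^sub>R (L - P)"
      using chord_in_triangle[of Y P E L "1 - \<kappa>"] dL ab1 unfolding TL_def by auto
    have "det2 E (Y - P) = z * det2 E (L - P)" unfolding yz(4) by (simp only: det2_add det2_scaleR det2_self)
    then have "a = z * (1 + \<kappa> - b)" using dL by (simp add: lev algebra_simps)
    then have "z = a / (1 + \<kappa> - b)" using ab1 by (simp add: field_simps)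
    then show ?thesis using yz by auto
  qed
  have ble: "b \<le> \<kappa> * (1 + \<kappa> - a)" if "b > 0"
  proof -
    have "b / (1 + \<kappa> - a) \<le> \<kappa>" using Xc[OF that] by linarith
    then show ?thesis using ab1 by (simp add: pos_divide_le_eq)
  qed
  have ale: "a \<le> \<kappa> * (1 + \<kappa> - b)" if "a > 0"
  proof -
    have "a / (1 + \<kappa> - b) \<le> \<kappa>" using Yc[OF that] by linarith
    then show ?thesis using ab1 by (simp add: pos_divide_le_eq)
  qed
  have bpos: "b > 0"
  proof (rule ccontr)
    assume "\<not> b > 0"
    then have "b = 0" "a = 2 * \<kappa>" using main s by auto
    then have "2 * \<kappa> \<le> \<kappa> * (1 + \<kappa>)" using ale k by simp
    then show False using kk k by (simp add: algebra_simps)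
  qed
  have apos: "a > 0"
  proof (rule ccontr)
    assume "\<not> a > 0"
    then have "a = 0" "b = 2 * \<kappa>" using main s by auto
    then have "2 * \<kappa> \<le> \<kappa> * (1 + \<kappa>)" using ble k by simp
    then show False using kk k by (simp add: algebra_simps)
  qed
  \<comment> \<open>With \<open>a + b = 2 * \<kappa>\<close> the inequalities \<open>ble\<close> and
    \<open>ale\<close> become opposite comparisons of \<open>a\<close> with
    \<open>\<kappa>\<close>.\<close>
  have ak: "a = \<kappa>" "b = \<kappa>"
  proof -
    have b: "b = 2 * \<kappa> - a" using s by simp
    have "\<kappa> - a \<le> \<kappa> * (\<kappa> - a)" using ble[OF bpos] by (simp add: b algebra_simps)
    then have 1: "(1 - \<kappa>) * (\<kappa> - a) \<le> 0" by (simp add: algebra_simps)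
    have "a - \<kappa> \<le> \<kappa> * (a - \<kappa>)" using ale[OF apos] by (simp add: b algebra_simps)
    then have 2: "(1 - \<kappa>) * (a - \<kappa>) \<le> 0" by (simp add: algebra_simps)
    show "a = \<kappa>" using 1 2 k by (simp add: mult_le_0_iff)
    then show "b = \<kappa>" using b by simp
  qed
  have XP': "X - P = \<kappa> *\<^sub>R (R - P)" using Xc[OF bpos] by (auto simp: ak)
  have YP': "Y - P = \<kappa> *\<^sub>R (L - P)" using Yc[OF apos] by (auto simp: ak)
  \<comment> \<open>Each apex is expressed through the other. This linear system has the factor
    \<open>1 - \<kappa> * \<kappa>\<close>, and its solution is the pair of unit coordinate
    vectors.\<close>
  have L1: "L - P = \<kappa> *\<^sub>R (R - P) + vector [- \<kappa>, 1]" and R1: "R - P = \<kappa> *\<^sub>R (L - P) + vector [1, - \<kappa>]"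
    using XP' YP' by (simp_all add: L_def R_def algebra_simps)
  have k2: "1 - \<kappa> * \<kappa> > 0" using kk k by linarith
  define l where "l = L - P"
  define r where "r = R - P"
  have lr: "l$1 = \<kappa> * r$1 - \<kappa>" "l$2 = \<kappa> * r$2 + 1" "r$1 = \<kappa> * l$1 + 1" "r$2 = \<kappa> * l$2 - \<kappa>"
    using arg_cong[OF L1, of "\<lambda>v. v$1"] arg_cong[OF L1, of "\<lambda>v. v$2"]
      arg_cong[OF R1, of "\<lambda>v. v$1"] arg_cong[OF R1, of "\<lambda>v. v$2"]
    unfolding l_def r_def by simp_all
  have "(1 - \<kappa> * \<kappa>) * l$1 = 0" using lr(1,3) by (simp add: algebra_simps)
  then have l1: "l$1 = 0" using k2 by simp
  have "(1 - \<kappa> * \<kappa>) * (l$2 - 1) = 0" using lr(2,4) by (simp add: algebra_simps)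
  then have l2: "l$2 = 1" using k2 by simp
  have r12: "r$1 = 1" "r$2 = 0" using lr l1 l2 by simp_all
  show "T = (\<lambda>v. v + P) ` cbox 0 1"
  proof (rule convex_body_vol_eqI[OF T, symmetric])
    show "compact ((\<lambda>v. v + P) ` cbox 0 1)"
      by (rule compact_continuous_image) (auto intro!: continuous_intros)
    show "(\<lambda>v. v + P) ` cbox 0 1 \<subseteq> T"
    proof clarify
      fix v :: R2 assume "v \<in> cbox 0 1"
      then have v: "0 \<le> v$1" "v$1 \<le> 1" "0 \<le> v$2" "v$2 \<le> 1" by (auto simp: mem_box_cart forall_2)
      show "v + P \<in> T"
      proof (cases "v$2 \<le> v$1")
        case True
        have "v + P = (1 - v$1) *\<^sub>R P + v$2 *\<^sub>R (P + E) + (v$1 - v$2) *\<^sub>R R"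
          using r12 unfolding r_def by (simp add: vec_eq_iff forall_2 E algebra_simps)
        then have "v + P \<in> TR" unfolding TR_def by (rule convex_hull_3I) (use v True in auto)
        then show ?thesis using subT by blast
      next
        case False
        have "v + P = (1 - v$2) *\<^sub>R P + v$1 *\<^sub>R (P + E) + (v$2 - v$1) *\<^sub>R L"
          using l1 l2 unfolding l_def by (simp add: vec_eq_iff forall_2 E algebra_simps)
        then have "v + P \<in> TL" unfolding TL_def by (rule convex_hull_3I) (use v False in auto)
        then show ?thesis using subT by blast
      qed
    qed
    have "vol ((\<lambda>v. v + P) ` cbox 0 1) = vol (cbox 0 1 :: R2 set)"
      using vol_affine[of 1 P "cbox 0 1"] by simp
    also have "\<dots> = 1" by (simp add: vol_def content_cbox_cart one_vec_def zero_vec_def interval_eq_empty_cart)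
    finally show "vol T \<le> vol ((\<lambda>v. v + P) ` cbox 0 1)" using v1 by simp
  qed
qed

section \<open>Triangles and squares\<close>

lemma convex_body_vol_pos: "convex_body S \<Longrightarrow> vol S > 0"
proof -
  assume S: "convex_body S"
  then have "\<not> negligible S" using negligible_convex_interior by (auto simp: convex_body_def)
  then have "vol S \<noteq> 0" using convex_body_lmeasurable
    by (metis S convex_body_def lmeasurable_compact negligible_iff_measure0 vol_def)
  then show "vol S > 0" by (simp add: vol_def order_less_le)
qed

lemma affine_image_convex_hull:
  assumes "linear f"
  shows "(\<lambda>x. f x + c) ` (convex hull S) = convex hull ((\<lambda>x. f x + c) ` S)"
proof -
  have "(\<lambda>x. f x + c) ` A = (+) c ` f ` A" for A by (auto simp: image_image add.commute)
  then show ?thesis by (simp only: convex_hull_linear_image[OF assms, symmetric] convex_hull_translation)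
qed

lemma linear_scaleR_R2: "linear (\<lambda>v. l *\<^sub>R v :: R2)"
  by (simp add: linear_iff algebra_simps)

lemma convex_body_affine_image:
  assumes "convex_body S" "l > 0"
  shows "convex_body ((\<lambda>v. l *\<^sub>R v + s :: R2) ` S)"
proof (rule convex_bodyI)
  have S: "compact S" "convex S" using assms by (auto simp: convex_body_def)
  show "compact ((\<lambda>v. l *\<^sub>R v + s) ` S)" by (rule compact_continuous_image[OF _ S(1)]) (intro continuous_intros)
  have "(\<lambda>v. l *\<^sub>R v + s) ` S = convex hull ((\<lambda>v. l *\<^sub>R v + s) ` S)"
    using affine_image_convex_hull[OF linear_scaleR_R2, of l s S] S(2) by (simp add: hull_same)
  then show "convex ((\<lambda>v. l *\<^sub>R v + s) ` S)" by (metis convex_convex_hull)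
  show "vol ((\<lambda>v. l *\<^sub>R v + s) ` S) > 0"
    using convex_body_vol_pos[OF assms(1)] assms(2) by (simp add: vol_affine)
qed

section \<open>Triangles, their normals and the bodies in \<open>T_Delta\<close>\<close>

lemma linear_J2: "linear J2"
  by (simp add: linear_iff J2_def vec_eq_iff forall_2)

lemma inner_J2: "inner (J2 v) w = - det2 v w"
  by (simp add: J2_def inner_R2 det2_def)

lemma det2_J2: "det2 (J2 a) (J2 b) = det2 a b"
  by (simp add: J2_def det2_def)

lemma collinear_det2: "collinear {a, b, c :: R2} \<longleftrightarrow> det2 (b - a) (c - a) = 0"
proof -
  have "collinear {a, b, c} \<longleftrightarrow> collinear {b, a, c}" by (simp add: insert_commute)
  also have "\<dots> \<longleftrightarrow> collinear {0, b - a, c - a}" by (rule collinear_3) (simp add: NO_MATCH_def)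
  also have "\<dots> \<longleftrightarrow> det2 (b - a) (c - a) = 0"
  proof (cases "b - a = 0")
    case False
    define u where "u = b - a"
    define v where "v = c - a"
    have u: "u \<noteq> 0" using False by (simp add: u_def)
    have "(v = 0 \<or> (\<exists>r. v = r *\<^sub>R u)) \<longleftrightarrow> det2 u v = 0"
    proof
      assume d: "det2 u v = 0"
      then have e: "u$1 * v$2 = u$2 * v$1" by (simp add: det2_def)
      have "v = (inner u v / inner u u) *\<^sub>R u"
      proof -
        have nz: "u$1 * u$1 + u$2 * u$2 \<noteq> 0" using u inner_eq_zero_iff[of u] by (simp add: inner_R2)
        have "v$1 * (u$1 * u$1 + u$2 * u$2) = (u$1 * v$1 + u$2 * v$2) * u$1"
          "v$2 * (u$1 * u$1 + u$2 * u$2) = (u$1 * v$1 + u$2 * v$2) * u$2"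
          using e by algebra+
        then show ?thesis using nz by (simp add: vec_eq_iff forall_2 inner_R2 field_simps)
      qed
      then show "v = 0 \<or> (\<exists>r. v = r *\<^sub>R u)" by blast
    qed auto
    then show ?thesis unfolding collinear_lemma u_def[symmetric] v_def[symmetric] using u by blast
  qed simp
  finally show ?thesis .
qed

text \<open>For a counterclockwise triangle \<open>J2\<close> turns edges into outer normals, which
  sum to 0 because the edges close up. The slacks of the three inequalities divided by
  \<open>d\<close> are the barycentric coordinates; \<open>d\<close> is twice the area.\<close>

lemma triangle_halfspaces:
  fixes A1 A2 A3 :: R2
  assumes d: "d = det2 (A2 - A1) (A3 - A1)" "d > 0"
  shows "convex hull {A1, A2, A3} = halfspaces {(J2 (A3 - A2), inner (J2 (A3 - A2)) A2),
      (J2 (A1 - A3), inner (J2 (A1 - A3)) A3), (J2 (A2 - A1), inner (J2 (A2 - A1)) A1)}" (is "?H = ?K")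
    "inner (J2 (A3 - A2)) A2 + inner (J2 (A1 - A3)) A3 + inner (J2 (A2 - A1)) A1 = d"
proof -
  have dd: "d = A2$1 * A3$2 - A2$2 * A3$1 - (A2$1 * A1$2 - A2$2 * A1$1) - (A1$1 * A3$2 - A1$2 * A3$1)"
    unfolding d(1) by (simp add: det2_def algebra_simps)
  show sum: "inner (J2 (A3 - A2)) A2 + inner (J2 (A1 - A3)) A3 + inner (J2 (A2 - A1)) A1 = d"
    unfolding dd by (simp add: inner_J2 det2_def algebra_simps)
  show "?H = ?K"
  proof
    have "convex ?K"
    proof -
      have "?K = {x. inner (J2 (A3 - A2)) x \<le> inner (J2 (A3 - A2)) A2} \<inter> ({x. inner (J2 (A1 - A3)) x \<le> inner (J2 (A1 - A3)) A3}
          \<inter> {x. inner (J2 (A2 - A1)) x \<le> inner (J2 (A2 - A1)) A1})"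
        by (auto simp: halfspaces_def)
      then show ?thesis by (simp add: convex_Int convex_halfspace_le)
    qed
    then show "?H \<subseteq> ?K"
      by (intro hull_minimal) (use d(2) dd in \<open>auto simp: halfspaces_def inner_J2 det2_def algebra_simps\<close>)
    show "?K \<subseteq> ?H"
    proof
      fix x assume x: "x \<in> ?K"
      define l1 where "l1 = (inner (J2 (A3 - A2)) A2 - inner (J2 (A3 - A2)) x) / d"
      define l2 where "l2 = (inner (J2 (A1 - A3)) A3 - inner (J2 (A1 - A3)) x) / d"
      define l3 where "l3 = (inner (J2 (A2 - A1)) A1 - inner (J2 (A2 - A1)) x) / d"
      have ld: "d * l1 = inner (J2 (A3 - A2)) A2 - inner (J2 (A3 - A2)) x"
        "d * l2 = inner (J2 (A1 - A3)) A3 - inner (J2 (A1 - A3)) x"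
        "d * l3 = inner (J2 (A2 - A1)) A1 - inner (J2 (A2 - A1)) x" using d by (simp_all add: l1_def l2_def l3_def)
      show "x \<in> ?H"
      proof (rule convex_hull_3I)
        show "0 \<le> l1" "0 \<le> l2" "0 \<le> l3" using x d(2) by (auto simp: l1_def l2_def l3_def halfspaces_def)
        have "d * (l1 + l2 + l3) = d * 1"
          using ld sum by (simp add: distrib_left inner_J2 det2_def algebra_simps)
        then show "l1 + l2 + l3 = 1" using d(2) by simp
        have "d *\<^sub>R x = d *\<^sub>R (l1 *\<^sub>R A1 + l2 *\<^sub>R A2 + l3 *\<^sub>R A3)"
          unfolding scaleR_add_right scaleR_scaleR ld
          by (simp add: dd vec_eq_iff forall_2 inner_J2 det2_def algebra_simps)
        then show "x = l1 *\<^sub>R A1 + l2 *\<^sub>R A2 + l3 *\<^sub>R A3" using d(2) by simp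
      qed
    qed
  qed
qed

lemma conv_refl_triangle:
  "conv_refl (convex hull {A1, A2, A3}) t =
     convex hull {J2 A1, J2 A2, J2 A3, t - J2 A1, t - J2 A2, t - J2 A3}"
proof -
  have 1: "J2 ` (convex hull {A1, A2, A3}) = convex hull {J2 A1, J2 A2, J2 A3}"
    by (simp add: convex_hull_linear_image[OF linear_J2])
  have "linear (\<lambda>v. - J2 v)" using linear_J2 by (rule linear_compose_neg)
  from affine_image_convex_hull[OF this]
  have 2: "(\<lambda>v. - J2 v + t) ` (convex hull {A1, A2, A3}) = convex hull {t - J2 A1, t - J2 A2, t - J2 A3}" by simp
  show ?thesis unfolding conv_refl_def 1 2 by (subst hull_Un[symmetric]) (auto intro!: convex_Inter arg_cong[where f="\<lambda>A. convex hull A"])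
qed

text \<open>With \<open>t = J2 A1 + J2 A2\<close> the reflection exchanges the images of
  \<open>A1\<close> and \<open>A2\<close>, and the hull becomes a parallelogram made of two copies
  of the triangle. So the minimum in \<open>T_Delta\<close> is twice the area of the
  triangle.\<close>

lemma conv_refl_vol:
  assumes d: "d = det2 (A2 - A1) (A3 - A1)" "d > 0"
  shows "d \<le> vol (conv_refl (convex hull {A1, A2, A3}) t)"
    "vol (conv_refl (convex hull {A1, A2, A3}) (J2 A1 + J2 A2)) \<le> d"
proof -
  let ?X = "convex hull {J2 A1, J2 A2, J2 A3, t - J2 A1, t - J2 A2, t - J2 A3}"
  have dd: "d = det2 (J2 A2 - J2 A1) (J2 A3 - J2 A1)"
    unfolding d(1) by (simp add: det2_J2)
  have "det2 (J2 A2 - J2 A1) (J2 A3 - J2 A1) \<le> vol ?X"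
    by (rule vol_antipodal_triangles[where t=t]) (use d dd in \<open>auto simp: compact_convex_hull hull_inc\<close>)
  then show "d \<le> vol (conv_refl (convex hull {A1, A2, A3}) t)" unfolding conv_refl_triangle dd .
  let ?t = "J2 A1 + J2 A2"
  have eq: "{J2 A1, J2 A2, J2 A3, ?t - J2 A1, ?t - J2 A2, ?t - J2 A3} = {J2 A1, J2 A3, J2 A2, ?t - J2 A3}" by auto
  have "vol (convex hull {J2 A1, J2 A3, J2 A2, ?t - J2 A3}) \<le>
      (\<bar>det2 (J2 A2 - J2 A1) (J2 A3 - J2 A1)\<bar> + \<bar>det2 (J2 A2 - J2 A1) (?t - J2 A3 - J2 A1)\<bar>) / 2"
    by (rule vol_crossing_diagonals[where s="1/2" and r="1/2"]) (simp_all add: vec_eq_iff field_simps)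
  also have "det2 (J2 A2 - J2 A1) (?t - J2 A3 - J2 A1) = - d"
    unfolding dd by (simp add: det2_def algebra_simps)
  finally show "vol (conv_refl (convex hull {A1, A2, A3}) ?t) \<le> d"
    unfolding conv_refl_triangle eq using d(2) dd by simp
qed

lemma T_Delta_triangle:
  assumes d: "d = det2 (A2 - A1) (A3 - A1)" "d > 0"
  shows "T \<in> T_Delta (convex hull {A1, A2, A3}) \<longleftrightarrow>
    (\<exists>t. T = conv_refl (convex hull {A1, A2, A3}) t \<and> vol (conv_refl (convex hull {A1, A2, A3}) t) = d)"
proof -
  let ?D = "convex hull {A1, A2, A3}"
  have ge: "d \<le> vol (conv_refl ?D t)" for t by (rule conv_refl_vol(1)[OF d])
  have "(\<forall>t'. vol (conv_refl ?D t) \<le> vol (conv_refl ?D t')) \<longleftrightarrow> vol (conv_refl ?D t) = d" for t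
  proof
    assume "\<forall>t'. vol (conv_refl ?D t) \<le> vol (conv_refl ?D t')"
    then have "vol (conv_refl ?D t) \<le> vol (conv_refl ?D (J2 A1 + J2 A2))" by blast
    then show "vol (conv_refl ?D t) = d" using conv_refl_vol(2)[OF d] ge[of t] by linarith
  next
    assume "vol (conv_refl ?D t) = d"
    then show "\<forall>t'. vol (conv_refl ?D t) \<le> vol (conv_refl ?D t')" using ge by simp
  qed
  then show ?thesis unfolding T_Delta_def by blast
qed

lemma conv_refl_body:
  assumes d: "d = det2 (A2 - A1) (A3 - A1)" "d > 0"
  shows "convex_body (conv_refl (convex hull {A1, A2, A3}) t)"
  by (rule convex_bodyI, use conv_refl_vol(1)[OF d, of t] d(2) in
      \<open>auto simp: conv_refl_triangle compact_convex_hull\<close>)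

text \<open>The two triangles are placed independently. The one at \<open>r\<close> is a copy of the
  triangle rotated by \<open>J2\<close> and determines \<open>s\<close>; the one at \<open>p\<close>
  is a copy of its reflection, and its relative position is \<open>t\<close>.\<close>

lemma triangle_fits_iff_conv_refl:
  assumes T: "convex T" and l: "l > 0"
  shows "triangle_fits T (J2 (A3 - A2)) (J2 (A1 - A3)) (J2 (A2 - A1)) l \<longleftrightarrow>
    (\<exists>s t. (\<lambda>v. l *\<^sub>R v + s) ` conv_refl (convex hull {A1, A2, A3}) t \<subseteq> T)"
proof -
  have J: "J2 (a - b) = J2 a - J2 b" for a b by (rule linear_diff[OF linear_J2])
  have im: "(\<lambda>v. l *\<^sub>R v + s) ` conv_refl (convex hull {A1, A2, A3}) t \<subseteq> T \<longleftrightarrow>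
      (\<lambda>v. l *\<^sub>R v + s) ` {J2 A1, J2 A2, J2 A3, t - J2 A1, t - J2 A2, t - J2 A3} \<subseteq> T" for s t
    unfolding conv_refl_triangle affine_image_convex_hull[OF linear_scaleR_R2]
    by (rule subset_hull[where S=convex, OF T])
  show ?thesis
  proof
    assume "triangle_fits T (J2 (A3 - A2)) (J2 (A1 - A3)) (J2 (A2 - A1)) l"
    then obtain p r where p: "p \<in> T" "p - l *\<^sub>R (J2 A1 - J2 A3) \<in> T" "p + l *\<^sub>R (J2 A3 - J2 A2) \<in> T"
      and r: "r \<in> T" "r - l *\<^sub>R (J2 A2 - J2 A1) \<in> T" "r + l *\<^sub>R (J2 A3 - J2 A2) \<in> T"
      unfolding triangle_fits_def J by blast
    define s where "s = r - l *\<^sub>R J2 A2"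
    define t where "t = (p - s) /\<^sub>R l + J2 A3"
    have lt: "l *\<^sub>R t = p - s + l *\<^sub>R J2 A3" using l by (simp add: t_def scaleR_add_right)
    have "l *\<^sub>R J2 A1 + s = r - l *\<^sub>R (J2 A2 - J2 A1)" "l *\<^sub>R J2 A2 + s = r" "l *\<^sub>R J2 A3 + s = r + l *\<^sub>R (J2 A3 - J2 A2)"
      by (simp_all add: s_def algebra_simps)
    moreover have "l *\<^sub>R (t - J2 A1) + s = p - l *\<^sub>R (J2 A1 - J2 A3)" "l *\<^sub>R (t - J2 A2) + s = p + l *\<^sub>R (J2 A3 - J2 A2)" "l *\<^sub>R (t - J2 A3) + s = p"
      by (simp_all add: scaleR_diff_right lt)
    ultimately have "(\<lambda>v. l *\<^sub>R v + s) ` {J2 A1, J2 A2, J2 A3, t - J2 A1, t - J2 A2, t - J2 A3} \<subseteq> T"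
      using p r by (simp only: image_insert image_empty insert_subset empty_subsetI)
    then show "\<exists>s t. (\<lambda>v. l *\<^sub>R v + s) ` conv_refl (convex hull {A1, A2, A3}) t \<subseteq> T" using im by blast
  next
    assume "\<exists>s t. (\<lambda>v. l *\<^sub>R v + s) ` conv_refl (convex hull {A1, A2, A3}) t \<subseteq> T"
    then obtain s t where st: "l *\<^sub>R J2 A1 + s \<in> T" "l *\<^sub>R J2 A2 + s \<in> T" "l *\<^sub>R J2 A3 + s \<in> T"
      "l *\<^sub>R (t - J2 A1) + s \<in> T" "l *\<^sub>R (t - J2 A2) + s \<in> T" "l *\<^sub>R (t - J2 A3) + s \<in> T"
      unfolding im by auto
    have "l *\<^sub>R (t - J2 A3) + s - l *\<^sub>R (J2 A1 - J2 A3) = l *\<^sub>R (t - J2 A1) + s"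
      "l *\<^sub>R (t - J2 A3) + s + l *\<^sub>R (J2 A3 - J2 A2) = l *\<^sub>R (t - J2 A2) + s"
      "l *\<^sub>R J2 A2 + s - l *\<^sub>R (J2 A2 - J2 A1) = l *\<^sub>R J2 A1 + s"
      "l *\<^sub>R J2 A2 + s + l *\<^sub>R (J2 A3 - J2 A2) = l *\<^sub>R J2 A3 + s"
      by (simp_all add: algebra_simps)
    then show "triangle_fits T (J2 (A3 - A2)) (J2 (A1 - A3)) (J2 (A2 - A1)) l"
      unfolding triangle_fits_def J using st by metis
  qed
qed

text \<open>With \<open>vol D = d / 2\<close> and capacity \<open>\<alpha> * d\<close>, equality
  becomes \<open>vol T = \<alpha>\<^sup>2 * d\<close>. \<open>T\<close> contains a copy of some
  \<open>conv_refl D t\<close> at scale \<open>\<alpha>\<close>, whose area is at least that, so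
  equality means that \<open>T\<close> is this copy and \<open>t\<close> is a minimiser.\<close>

lemma viterbo_equality_triangle:
  assumes D: "triangle D" and T: "convex_body T"
  shows "vol (D \<times> T) = c_EHZ (D \<times> T)^2 / 2 \<longleftrightarrow>
           (\<exists>l>0. \<exists>s. \<exists>Ts\<in>T_Delta D. T = (\<lambda>v. l *\<^sub>R v + s) ` Ts)"
proof -
  obtain A1 A2 A3 d where D': "D = convex hull {A1, A2, A3}" and d: "d = det2 (A2 - A1) (A3 - A1)" "d > 0"
  proof -
    obtain a b c where abc: "\<not> collinear {a, b, c}" "D = convex hull {a, b, c}" using D by (auto simp: triangle_def)
    show thesis
    proof (cases "det2 (b - a) (c - a) > 0")
      case True
      then show ?thesis using that abc by blast
    next
      case False
      then have "det2 (b - a) (c - a) < 0" using abc(1) collinear_det2[of a b c] by linarith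
    then have "det2 (c - a) (b - a) > 0" using det2_commute[of "c - a" "b - a"] by linarith
      moreover have "D = convex hull {a, c, b}" using abc(2) by (simp add: insert_commute)
      ultimately show ?thesis using that by blast
    qed
  qed
  let ?n1 = "J2 (A3 - A2)" and ?n2 = "J2 (A1 - A3)" and ?n3 = "J2 (A2 - A1)"
  have sum0: "?n1 + ?n2 + ?n3 = 0" by (simp add: linear_diff[OF linear_J2])
  have "det2 ?n1 ?n2 = det2 (A3 - A2) (A1 - A3)" by (rule det2_J2)
  also have "\<dots> = d" unfolding d(1) by (simp add: det2_def algebra_simps)
  finally have dn: "det2 ?n1 ?n2 \<noteq> 0" using d(2) by simp
  note H = triangle_halfspaces[OF d]
  have cD: "compact D" "convex D" unfolding D' by (simp_all add: compact_convex_hull)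
  have vD: "vol D = d / 2" unfolding D' vol_triangle using d by simp
  have Db: "convex_body D" by (rule convex_bodyI) (use cD vD d in auto)
  have cT: "compact T" "convex T" using T by (auto simp: convex_body_def)
  obtain \<alpha> where \<alpha>: "\<alpha> > 0" "c_EHZ (D \<times> T) = \<alpha> * d" "triangle_fits T ?n1 ?n2 ?n3 \<alpha>"
    "\<And>\<beta>. triangle_fits T ?n1 ?n2 ?n3 \<beta> \<Longrightarrow> \<beta> \<le> \<alpha>"
  proof (rule c_EHZ_triangle_product[OF sum0 dn _ T H(1)[folded D'] Db])
    show "0 < inner ?n1 A2 + inner ?n2 A3 + inner ?n3 A1" unfolding H(2) by (rule d(2))
  qed (use that H(2) in auto)
  have iff: "vol (D \<times> T) = c_EHZ (D \<times> T)^2 / 2 \<longleftrightarrow> vol T = \<alpha>\<^sup>2 * d"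
    using d(2) by (simp add: vol_Times[OF cD(1) cT(1)] vD \<alpha>(2) power_mult_distrib power2_eq_square mult.assoc)
  obtain s t where st: "(\<lambda>v. \<alpha> *\<^sub>R v + s) ` conv_refl D t \<subseteq> T"
    using triangle_fits_iff_conv_refl[OF cT(2) \<alpha>(1)] \<alpha>(3) unfolding D' by blast
  have bd: "convex_body (conv_refl D t)" for t unfolding D' by (rule conv_refl_body[OF d])
  have sb: "convex_body ((\<lambda>v. l *\<^sub>R v + s) ` conv_refl D t)" if "l > 0" for l s t
    by (rule convex_body_affine_image[OF bd that])
  have "vol ((\<lambda>v. \<alpha> *\<^sub>R v + s) ` conv_refl D t) \<le> vol T"
    by (rule vol_mono[OF st]) (use sb[OF \<alpha>(1)] T in \<open>auto intro: convex_body_lmeasurable\<close>)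
  then have le: "\<alpha>\<^sup>2 * vol (conv_refl D t) \<le> vol T" by (simp add: vol_affine)
  have dle: "d \<le> vol (conv_refl D t)" unfolding D' by (rule conv_refl_vol(1)[OF d])
  have a2: "\<alpha>\<^sup>2 > 0" using \<alpha>(1) by simp
  have low: "\<alpha>\<^sup>2 * d \<le> vol T" using le mult_left_mono[OF dle, of "\<alpha>\<^sup>2"] by simp
  show ?thesis
  proof
    assume "vol (D \<times> T) = c_EHZ (D \<times> T)^2 / 2"
    then have v: "vol T = \<alpha>\<^sup>2 * d" using iff by simp
    then have "vol (conv_refl D t) \<le> d" using le a2 by simp
    then have vd: "vol (conv_refl D t) = d" using dle by simp
    have "(\<lambda>v. \<alpha> *\<^sub>R v + s) ` conv_refl D t = T"
      by (rule convex_body_vol_eqI[OF T _ st]) (use sb[OF \<alpha>(1)] v vd in \<open>auto simp: convex_body_def vol_affine\<close>)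
    moreover have "conv_refl D t \<in> T_Delta D" unfolding D' T_Delta_triangle[OF d] using vd D' by blast
    ultimately show "\<exists>l>0. \<exists>s. \<exists>Ts\<in>T_Delta D. T = (\<lambda>v. l *\<^sub>R v + s) ` Ts" using \<alpha>(1) by blast
  next
    assume "\<exists>l>0. \<exists>s. \<exists>Ts\<in>T_Delta D. T = (\<lambda>v. l *\<^sub>R v + s) ` Ts"
    then obtain l s Ts where l: "l > 0" "Ts \<in> T_Delta D" "T = (\<lambda>v. l *\<^sub>R v + s) ` Ts" by blast
    then obtain t where t: "Ts = conv_refl D t" "vol (conv_refl D t) = d"
      unfolding D' T_Delta_triangle[OF d] by blast
    have vT: "vol T = l\<^sup>2 * d" unfolding l(3) vol_affine t by simp
    have "triangle_fits T ?n1 ?n2 ?n3 l"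
      unfolding triangle_fits_iff_conv_refl[OF cT(2) l(1)] using l(3) t D' by blast
    \<comment> \<open>Maximality of \<open>\<alpha>\<close> gives one inequality, and the area bound
      \<open>low\<close> gives the other.\<close>
    then have "l \<le> \<alpha>" by (rule \<alpha>(4))
    moreover have "\<alpha>\<^sup>2 \<le> l\<^sup>2" using low vT d(2) by simp
    then have "\<alpha> \<le> l" using l(1) by (simp add: power2_le_iff_abs_le)
    ultimately show "vol (D \<times> T) = c_EHZ (D \<times> T)^2 / 2" using iff vT by simp
  qed
qed

lemma T_Delta_convex_body:
  assumes D: "triangle D" and T: "T \<in> T_Delta D"
  shows "convex_body T"
proof -
  obtain a b c where abc: "\<not> collinear {a, b, c}" "D = convex hull {a, b, c}" using D by (auto simp: triangle_def)
  obtain t where t: "T = conv_refl D t" using T by (auto simp: T_Delta_def)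
  show ?thesis
  proof (cases "det2 (b - a) (c - a) > 0")
    case True
    then show ?thesis unfolding t abc(2) by (rule conv_refl_body[OF refl])
  next
    case False
    then have "det2 (b - a) (c - a) < 0" using abc(1) collinear_det2[of a b c] by linarith
    then have "det2 (c - a) (b - a) > 0" using det2_commute[of "c - a" "b - a"] by linarith
    moreover have "D = convex hull {a, c, b}" using abc(2) by (simp add: insert_commute)
    ultimately show ?thesis unfolding t using conv_refl_body[OF refl] by metis
  qed
qed

text \<open>With \<open>m\<close> the side of the square, equality becomes
  \<open>vol T = \<alpha>\<^sup>2 / 2\<close>, the extremal case of
  \<open>cross_chords_vol\<close>.\<close>

lemma viterbo_equality_square:
  assumes S: "axis_square S" and T: "convex_body T"
  shows "vol (S \<times> T) = c_EHZ (S \<times> T)^2 / 2 \<longleftrightarrow>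
           (\<exists>l>0. \<exists>s. \<exists>a1\<in>{0..1}. \<exists>a2\<in>{0..1}. T = (\<lambda>v. l *\<^sub>R v + s) ` diamond a1 a2)"
proof -
  obtain p m where S': "m > 0" "S = cbox p (p + m *\<^sub>R (1::R2))" using S by (auto simp: axis_square_def)
  have Sset: "S = {x::R2. p$1 \<le> x$1 \<and> x$1 \<le> p$1 + m \<and> p$2 \<le> x$2 \<and> x$2 \<le> p$2 + m}"
    unfolding S'(2) by (auto simp: mem_box_cart forall_2)
  have vS: "vol S = m\<^sup>2"
    using S'(1) unfolding S'(2) vol_def by (simp add: content_cbox_cart interval_eq_empty_cart not_less UNIV_2 power2_eq_square)
  have cS: "compact S" "convex S" unfolding S'(2) by simp_all
  have Sb: "convex_body S" by (rule convex_bodyI) (use cS vS S'(1) in auto)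
  have cT: "compact T" using T by (auto simp: convex_body_def)
  obtain \<alpha> where \<alpha>: "\<alpha> > 0" "c_EHZ (S \<times> T) = \<alpha> * m"
    "chord_fits T (axis 1 1) \<alpha>" "chord_fits T (axis 2 1) \<alpha>"
    "\<And>\<beta>. chord_fits T (axis 1 1) \<beta> \<Longrightarrow> chord_fits T (axis 2 1) \<beta> \<Longrightarrow> \<beta> \<le> \<alpha>"
    using c_EHZ_square_product[OF S'(1) T Sset Sb] by metis
  have iff: "vol (S \<times> T) = c_EHZ (S \<times> T)^2 / 2 \<longleftrightarrow> vol T = \<alpha>\<^sup>2 / 2"
    using S'(1) by (simp add: vol_Times[OF cS(1) cT] vS \<alpha>(2) power_mult_distrib field_simps)
  note cc = cross_chords_vol[OF T \<alpha>(1,3,4)]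
  show ?thesis
  proof
    assume "vol (S \<times> T) = c_EHZ (S \<times> T)^2 / 2"
    then show "\<exists>l>0. \<exists>s. \<exists>a1\<in>{0..1}. \<exists>a2\<in>{0..1}. T = (\<lambda>v. l *\<^sub>R v + s) ` diamond a1 a2"
      using iff cc(2) \<alpha>(1) by auto
  next
    assume "\<exists>l>0. \<exists>s. \<exists>a1\<in>{0..1}. \<exists>a2\<in>{0..1}. T = (\<lambda>v. l *\<^sub>R v + s) ` diamond a1 a2"
    then obtain l s a1 a2 where l: "l > 0" "a1 \<in> {0..1}" "a2 \<in> {0..1}" "T = (\<lambda>v. l *\<^sub>R v + s) ` diamond a1 a2" by blast
    have vT: "vol T = l\<^sup>2 / 2" unfolding l(4) vol_affine diamond_body(1)[OF l(2,3)] by simp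
    have inD: "vector [0, a2] \<in> diamond a1 a2" "vector [1, a2] \<in> diamond a1 a2"
      "vector [a1, 0] \<in> diamond a1 a2" "vector [a1, 1] \<in> diamond a1 a2"
      unfolding diamond_eq_hull[OF l(2,3)] by (simp_all add: hull_inc)
    have "l *\<^sub>R vector [0, a2] + s + l *\<^sub>R axis 1 1 = l *\<^sub>R vector [1, a2] + s"
      "l *\<^sub>R vector [a1, 0] + s + l *\<^sub>R axis 2 1 = l *\<^sub>R vector [a1, 1] + s"
      by (simp_all add: vec_eq_iff forall_2 axis_def)
    then have "chord_fits T (axis 1 1) l" "chord_fits T (axis 2 1) l"
      unfolding chord_fits_def l(4) using inD by (metis imageI)+
    then have "l \<le> \<alpha>" by (rule \<alpha>(5))
    moreover have "\<alpha>\<^sup>2 \<le> l\<^sup>2" using cc(1) vT by simp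
    then have "\<alpha> \<le> l" using l(1) by (simp add: power2_le_iff_abs_le)
    ultimately show "vol (S \<times> T) = c_EHZ (S \<times> T)^2 / 2" using iff vT by simp
  qed
qed

section \<open>Trapezoids\<close>

lemma matrix_vector_mult_R2: "(A :: real^2^2) *v x = vector [A$1$1 * x$1 + A$1$2 * x$2, A$2$1 * x$1 + A$2$2 * x$2]"
  by (simp add: matrix_vector_mult_def sum_2 vec_eq_iff forall_2)

lemma matrix_inv_right: "invertible A \<Longrightarrow> A ** matrix_inv A = mat 1"
  and matrix_inv_left: "invertible A \<Longrightarrow> matrix_inv A ** A = mat 1"
proof -
  assume "invertible A"
  then have "\<exists>B. A ** B = mat 1 \<and> B ** A = mat 1" by (simp add: invertible_def)
  then have "A ** matrix_inv A = mat 1 \<and> matrix_inv A ** A = mat 1"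
    unfolding matrix_inv_def by (rule someI_ex)
  then show "A ** matrix_inv A = mat 1" "matrix_inv A ** A = mat 1" by auto
qed

lemma det2_matrix: "det2 (A *v a) (A *v b) = det A * det2 a b"
  by (simp add: matrix_vector_mult_R2 det2_def det_2 algebra_simps)

lemma vol_matrix_affine:
  fixes A :: "real^2^2"
  assumes "S \<in> lmeasurable"
  shows "vol ((\<lambda>x. A *v x + c) ` S) = \<bar>det A\<bar> * vol S"
proof -
  have "(\<lambda>x. A *v x + c) ` S = (+) c ` ((*v) A ` S)" by (auto simp: image_image add.commute)
  then have "vol ((\<lambda>x. A *v x + c) ` S) = vol ((*v) A ` S)" by (simp only: vol_def measure_translation)
  also have "\<dots> = \<bar>det A\<bar> * vol S"
    unfolding vol_def using measure_linear_image[OF matrix_vector_mul_linear[of A] assms] by simp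
  finally show ?thesis .
qed

lemma convex_body_matrix_image:
  fixes A :: "real^2^2"
  assumes S: "convex_body S" and A: "invertible A"
  shows "convex_body ((\<lambda>x. A *v x + c) ` S)"
proof (rule convex_bodyI)
  have cS: "compact S" "convex S" using S by (auto simp: convex_body_def)
  have lin: "linear ((*v) A)" by (rule matrix_vector_mul_linear)
  show "compact ((\<lambda>x. A *v x + c) ` S)"
    by (rule compact_continuous_image[OF _ cS(1)]) (intro continuous_intros)
  have "(\<lambda>x. A *v x + c) ` S = convex hull ((\<lambda>x. A *v x + c) ` S)"
    using affine_image_convex_hull[OF lin, of c S] cS(2) by (simp add: hull_same)
  then show "convex ((\<lambda>x. A *v x + c) ` S)" by (metis convex_convex_hull)
  show "vol ((\<lambda>x. A *v x + c) ` S) > 0"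
    using convex_body_vol_pos[OF S] A by (simp add: vol_matrix_affine convex_body_lmeasurable[OF S] invertible_det_nz)
qed

lemma convex_halfspaces: "convex (halfspaces H)"
proof -
  have "halfspaces H = (\<Inter>(n, b)\<in>H. {x. inner n x \<le> b})" by (auto simp: halfspaces_def)
  then show ?thesis by (auto intro!: convex_INT convex_halfspace_le)
qed

text \<open>The parallel sides lie on \<open>x$1 + x$2 = 1 + a\<close> and
  \<open>x$1 + x$2 = a\<close>; the longer one is the first side and the shorter one the cut. The
  factor \<open>1 - 2*a\<close> scales the first normal so that the first three sum to 0, as
  \<open>c_EHZ_trapezoid_product\<close> requires.\<close>

lemma diamond_halfspaces:
  assumes a: "0 < a" "a < 1/2"
  shows "diamond a a = halfspaces {(vector [1 - 2*a, 1 - 2*a], (1 - 2*a) * (1 + a)), (vector [- (1 - a), a], a * a),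
     (vector [a, - (1 - a)], a * a), (- vector [1 - 2*a, 1 - 2*a], - ((1 - 2*a) * a))}" (is "_ = halfspaces ?H")
proof
  have aa: "a \<in> {0..1}" using a by auto
  note dh = diamond_eq_hull[OF aa aa]
  have h: "1 - 2 * a > 0" using a by simp
  have KI: "x \<in> halfspaces ?H \<longleftrightarrow> x$1 + x$2 \<le> 1 + a \<and> (a - 1) * x$1 + a * x$2 \<le> a * a \<and>
     a * x$1 + (a - 1) * x$2 \<le> a * a \<and> a \<le> x$1 + x$2" for x :: R2
  proof -
    have "(1 - 2*a) * x$1 + (1 - 2*a) * x$2 \<le> (1 - 2*a) * (1 + a) \<longleftrightarrow> x$1 + x$2 \<le> 1 + a"
      unfolding distrib_left[symmetric] using h by (simp only: mult_le_cancel_left_pos)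
    moreover have "(2 * a - 1) * x$1 + (2 * a - 1) * x$2 \<le> - ((1 - 2*a) * a) \<longleftrightarrow> (1 - 2*a) * a \<le> (1 - 2*a) * (x$1 + x$2)"
      by (simp add: algebra_simps)
    then have "(2 * a - 1) * x$1 + (2 * a - 1) * x$2 \<le> - ((1 - 2*a) * a) \<longleftrightarrow> a \<le> x$1 + x$2"
      using h by (simp only: mult_le_cancel_left_pos)
    ultimately show ?thesis by (simp add: halfspaces_def inner_R2)
  qed
  show "diamond a a \<subseteq> halfspaces ?H"
    unfolding dh
  proof (rule hull_minimal[where S=convex, OF _ convex_halfspaces])
    show "{vector [0, a], vector [a, 0], vector [1, a], vector [a, 1]} \<subseteq> halfspaces ?H"
      unfolding insert_subset KI using a by (auto simp: algebra_simps)
  qed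
  show "halfspaces ?H \<subseteq> diamond a a"
  proof
    fix x assume "x \<in> halfspaces ?H"
    then have x: "x$1 + x$2 \<le> 1 + a" "(a - 1) * x$1 + a * x$2 \<le> a * a" "a * x$1 + (a - 1) * x$2 \<le> a * a" "a \<le> x$1 + x$2"
      unfolding KI by blast+
    let ?W = "vector [0, a] :: R2" and ?S = "vector [a, 0] :: R2" and ?E = "vector [1, a] :: R2" and ?N = "vector [a, 1] :: R2"
    show "x \<in> diamond a a"
    proof (cases "a \<le> x$2")
      case True
      define v where "v = (x$2 - a) / (1 - a)"
      have v: "v * (1 - a) = x$2 - a" using a by (simp add: v_def)
      have v0: "v \<ge> 0" using True a by (simp add: v_def)
      have "0 \<le> (1 - a) * (x$1 - v * a)"
      proof -
        have "(1 - a) * (x$1 - v * a) = (1 - a) * x$1 - a * (v * (1 - a))" by (simp add: algebra_simps)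
        then show ?thesis using x(2) unfolding v by (simp add: algebra_simps)
      qed
      then have E: "0 \<le> x$1 - v * a" using a by (simp add: zero_le_mult_iff)
      have W: "0 \<le> 1 - v - (x$1 - v * a)"
      proof -
        have "1 - v - (x$1 - v * a) = 1 - v * (1 - a) - x$1" by (simp add: algebra_simps)
        then show ?thesis using x(1) unfolding v by simp
      qed
      have vv: "v + (a - v * a) = x$2" using v by (simp add: algebra_simps)
      have "x = (1 - v - (x$1 - v * a)) *\<^sub>R ?W + (x$1 - v * a) *\<^sub>R ?E + v *\<^sub>R ?N"
        using vv by (simp add: vec_eq_iff forall_2 algebra_simps)
      then have "x \<in> convex hull {?W, ?E, ?N}" by (rule convex_hull_3I) (use v0 E W in auto)
      then show ?thesis unfolding dh using hull_mono[of "{?W, ?E, ?N}" "{?W, ?S, ?E, ?N}" convex] by blast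
    next
      case False
      define v where "v = (a - x$2) / a"
      have v: "v * a = a - x$2" using a by (simp add: v_def)
      have v0: "v \<ge> 0" using False a by (simp add: v_def)
      have E: "0 \<le> x$1 - v * a" using x(4) unfolding v by simp
      have "0 \<le> a * (1 - v - (x$1 - v * a))"
      proof -
        have "a * (1 - v - (x$1 - v * a)) = a - v * a - a * x$1 + a * (v * a)" by (simp add: algebra_simps)
        then show ?thesis using x(3) unfolding v by (simp add: algebra_simps)
      qed
      then have W: "0 \<le> 1 - v - (x$1 - v * a)" using a by (simp add: zero_le_mult_iff)
      have "x = (1 - v - (x$1 - v * a)) *\<^sub>R ?W + (x$1 - v * a) *\<^sub>R ?E + v *\<^sub>R ?S"
        using v by (simp add: vec_eq_iff forall_2 algebra_simps)
      then have "x \<in> convex hull {?W, ?E, ?S}" by (rule convex_hull_3I) (use v0 E W in auto)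
      then show ?thesis unfolding dh using hull_mono[of "{?W, ?E, ?S}" "{?W, ?S, ?E, ?N}" convex] by blast
    qed
  qed
qed

lemma vol_unit_square: "vol (cbox 0 1 :: R2 set) = 1"
  by (simp add: vol_def content_cbox_cart one_vec_def zero_vec_def interval_eq_empty_cart)

lemma trapezoid_dual_vol_scaled:
  fixes \<kappa> :: real and T :: "R2 set"
  assumes T: "convex_body T" and k: "0 < \<kappa>" "\<kappa> < 1" and C: "C > 0"
    and P: "P \<in> T" "P + C *\<^sub>R vector [1, 1] \<in> T"
    and X: "X \<in> T" "X + C *\<^sub>R ((1 - \<kappa>) *\<^sub>R vector [1, 1]) \<in> T" "X + C *\<^sub>R vector [- \<kappa>, 1] \<in> T"
    and Y: "Y \<in> T" "Y + C *\<^sub>R ((1 - \<kappa>) *\<^sub>R vector [1, 1]) \<in> T" "Y + C *\<^sub>R vector [1, - \<kappa>] \<in> T"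
  shows "C\<^sup>2 \<le> vol T" "vol T \<le> C\<^sup>2 \<Longrightarrow> \<exists>s. T = (\<lambda>v. C *\<^sub>R v + s) ` cbox 0 1"
proof -
  define g where "g = (\<lambda>v::R2. (1 / C) *\<^sub>R v + 0)"
  have g: "g (x + C *\<^sub>R v) = g x + v" for x v using C by (simp add: g_def algebra_simps)
  have T': "convex_body (g ` T)" unfolding g_def by (rule convex_body_affine_image[OF T]) (use C in simp)
  have vol: "vol (g ` T) = vol T / C\<^sup>2" unfolding g_def vol_affine using C by (simp add: power_divide)
  note tri = trapezoid_dual_vol[OF T' k refl imageI[OF P(1)] imageI[OF P(2), of g, unfolded g]
      imageI[OF X(1)] imageI[OF X(2), of g, unfolded g] imageI[OF X(3), of g, unfolded g]
      imageI[OF Y(1)] imageI[OF Y(2), of g, unfolded g] imageI[OF Y(3), of g, unfolded g]]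
  show "C\<^sup>2 \<le> vol T" using tri(1) C unfolding vol by (simp add: field_simps)
  assume "vol T \<le> C\<^sup>2"
  then have "g ` T = (\<lambda>v. v + g P) ` cbox 0 1" using C by (intro tri(2)) (simp add: vol field_simps)
  then have "(\<lambda>v. C *\<^sub>R v) ` g ` T = (\<lambda>v. C *\<^sub>R v) ` (\<lambda>v. v + g P) ` cbox 0 1" by simp
  then have "T = (\<lambda>v. C *\<^sub>R v + C *\<^sub>R g P) ` cbox 0 1"
    using C by (simp add: image_image g_def algebra_simps)
  then show "\<exists>s. T = (\<lambda>v. C *\<^sub>R v + s) ` cbox 0 1" by blast
qed

text \<open>The transpose of \<open>M\<close> carries the normals of \<open>Q\<close> to those of
  \<open>diamond a a\<close>, so fitting chords and triangles into \<open>T\<close> becomes fitting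
  standard ones into \<open>?T\<close>, with \<open>1 - 2 * a\<close> and \<open>1 - a\<close> as
  the extents \<open>h\<close> and \<open>B\<close>. The determinant is absorbed into
  \<open>vol ?T\<close>, and equality reads \<open>vol ?T = C\<^sup>2\<close>.\<close>

lemma viterbo_equality_trapezoid_normal:
  fixes M :: "real^2^2"
  assumes M: "invertible M" and a: "0 < a" "a < 1/2" and Q: "Q = (\<lambda>x. M *v x + c) ` diamond a a"
    and T: "convex_body T"
  shows "vol (Q \<times> T) = c_EHZ (Q \<times> T)^2 / 2 \<longleftrightarrow>
    (\<exists>l>0. \<exists>s. (\<lambda>y. transpose M *v y) ` T = (\<lambda>v. l *\<^sub>R v + s) ` cbox 0 1)"
proof -
  define g where "g = (\<lambda>y. transpose M *v y)"
  define W where "W = matrix_inv (transpose M)"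
  have iT: "invertible (transpose M)" using M by (simp add: invertible_det_nz)
  have gW: "g (W *v n) = n" and Wg: "W *v g n = n" for n
    using iT by (simp_all add: g_def W_def matrix_vector_mul_assoc matrix_inv_right matrix_inv_left del: transpose_matrix_vector)
  have glin: "g (x + y) = g x + g y" "g (x - y) = g x - g y" "g (r *\<^sub>R x) = r *\<^sub>R g x" for x y r
    by (simp_all add: g_def matrix_vector_right_distrib matrix_vector_mult_diff_distrib matrix_vector_mult_scaleR del: transpose_matrix_vector)
  have gmem: "g x \<in> g ` T \<longleftrightarrow> x \<in> T" for x using Wg by (metis (no_types, lifting) image_iff)
  have dualM: "inner N (M *v x) = inner (g N) x" for N x
    unfolding g_def by (simp add: dot_lmul_matrix)
  let ?n1 = "vector [1 - 2*a, 1 - 2*a] :: R2" and ?n2 = "vector [- (1 - a), a] :: R2" and ?n3 = "vector [a, - (1 - a)] :: R2"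
  define N1 N2 N3 where "N1 = W *v ?n1" and "N2 = W *v ?n2" and "N3 = W *v ?n3"
  have gN: "g N1 = ?n1" "g N2 = ?n2" "g N3 = ?n3" by (simp_all add: N1_def N2_def N3_def gW)
  have gN': "g (- N1) = - ?n1" using glin(3)[of "-1" N1] gN by simp
  have sum0: "N1 + N2 + N3 = 0"
  proof -
    have "?n1 + ?n2 + ?n3 = 0" by (simp add: vec_eq_iff forall_2)
    then have "g (N1 + N2 + N3) = g 0" using glin(3)[of 0 0] by (simp add: glin gN)
    then show ?thesis using Wg by metis
  qed
  have dn: "det2 N1 N2 \<noteq> 0"
  proof
    assume "det2 N1 N2 = 0"
    then have "det2 ?n1 ?n2 = 0" unfolding gN(1,2)[symmetric] g_def det2_matrix by simp
    moreover have "det2 ?n1 ?n2 = 1 - 2 * a" by (simp add: det2_def algebra_simps)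
    ultimately show False using a by simp
  qed
  have aa: "a \<in> {0..1}" using a by auto
  note db = diamond_body[OF aa aa]
  have Qb: "convex_body Q" unfolding Q by (rule convex_body_matrix_image[OF db(2) M])
  have vQ: "vol Q = \<bar>det M\<bar> / 2" unfolding Q vol_matrix_affine[OF convex_body_lmeasurable[OF db(2)]] db(1) by simp
  have m0: "\<bar>det M\<bar> > 0" using M by (simp add: invertible_det_nz)
  define b1 b2 b3 b0 where "b1 = (1 - 2*a) * (1 + a) + inner N1 c" and "b2 = a * a + inner N2 c"
    and "b3 = a * a + inner N3 c" and "b0 = - ((1 - 2*a) * a) + inner (- N1) c"
  have Qh: "Q = halfspaces {(N1, b1), (N2, b2), (N3, b3), (- N1, b0)}"
  proof -
    have "x \<in> Q \<longleftrightarrow> x \<in> halfspaces {(N1, b1), (N2, b2), (N3, b3), (- N1, b0)}" for x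
    proof -
      define y where "y = matrix_inv M *v (x - c)"
      have x: "x = M *v y + c" using M by (simp add: y_def matrix_vector_mul_assoc matrix_inv_right)
      have inj: "M *v u = M *v v \<longleftrightarrow> u = v" for u v using M
        by (metis matrix_inv_left matrix_vector_mul_assoc matrix_vector_mul_lid)
      have "x \<in> Q \<longleftrightarrow> y \<in> diamond a a" unfolding Q x using inj by auto
      moreover have "inner N x = inner (g N) y + inner N c" for N by (simp add: x inner_add_right dualM)
      ultimately show ?thesis
        unfolding diamond_halfspaces[OF a] b1_def b2_def b3_def b0_def
        by (simp add: halfspaces_def gN gN' del: inner_minus_left)
    qed
    then show ?thesis by blast
  qed
  have B: "1 - a = b1 + b2 + b3"
  proof -
    have "inner N1 c + inner N2 c + inner N3 c = 0" using sum0 by (simp add: inner_add_left[symmetric])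
    then show ?thesis unfolding b1_def b2_def b3_def by (simp add: algebra_simps)
  qed
  have h: "1 - 2 * a = b0 + b1" unfolding b0_def b1_def by (simp add: algebra_simps)
  obtain C where C: "C > 0" "c_EHZ (Q \<times> T) = C"
    "triangle_fits T N1 N2 N3 (C / (1 - a))" "chord_fits T N1 (C / (1 - 2 * a))"
    "\<And>c'. triangle_fits T N1 N2 N3 (c' / (1 - a)) \<Longrightarrow> chord_fits T N1 (c' / (1 - 2 * a)) \<Longrightarrow> c' \<le> C"
  proof (rule c_EHZ_trapezoid_product[OF sum0 dn B _ h _ _ T Qh Qb])
    show "0 < 1 - a" "0 < 1 - 2 * a" "1 - 2 * a \<le> 1 - a" using a by simp_all
  qed blast
  \<comment> \<open>Ratio of the two parallel sides. Dividing the normals by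
    \<open>1 - 2 * a\<close> and \<open>1 - a\<close> produces, up to sign, the vectors of
    \<open>trapezoid_dual_vol\<close>.\<close>
  define \<kappa> where "\<kappa> = a / (1 - a)"
  have k: "0 < \<kappa>" "\<kappa> < 1" using a by (simp_all add: \<kappa>_def)
  let ?E = "vector [1, 1] :: R2"
  have sc: "(c' / (1 - 2 * a)) *\<^sub>R ?n1 = c' *\<^sub>R ?E" "(c' / (1 - a)) *\<^sub>R ?n1 = c' *\<^sub>R ((1 - \<kappa>) *\<^sub>R ?E)"
    "(c' / (1 - a)) *\<^sub>R ?n2 = - (c' *\<^sub>R vector [1, - \<kappa>])" "(c' / (1 - a)) *\<^sub>R ?n3 = - (c' *\<^sub>R vector [- \<kappa>, 1])" for c'
    using a by (simp_all add: vec_eq_iff forall_2 \<kappa>_def field_simps)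
  let ?T = "g ` T"
  have fits: "chord_fits T N1 (c' / (1 - 2 * a)) \<longleftrightarrow> (\<exists>p. p \<in> ?T \<and> p + c' *\<^sub>R ?E \<in> ?T)"
    "triangle_fits T N1 N2 N3 (c' / (1 - a)) \<longleftrightarrow>
      (\<exists>p. p \<in> ?T \<and> p + c' *\<^sub>R vector [1, - \<kappa>] \<in> ?T \<and> p + c' *\<^sub>R ((1 - \<kappa>) *\<^sub>R ?E) \<in> ?T) \<and>
      (\<exists>p. p \<in> ?T \<and> p + c' *\<^sub>R vector [- \<kappa>, 1] \<in> ?T \<and> p + c' *\<^sub>R ((1 - \<kappa>) *\<^sub>R ?E) \<in> ?T)" for c'
  proof -
    have A: "g (p + (c' / (1 - 2 * a)) *\<^sub>R N1) = g p + c' *\<^sub>R ?E"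
      "g (p - (c' / (1 - a)) *\<^sub>R N2) = g p + c' *\<^sub>R vector [1, - \<kappa>]"
      "g (p - (c' / (1 - a)) *\<^sub>R N3) = g p + c' *\<^sub>R vector [- \<kappa>, 1]"
      "g (p + (c' / (1 - a)) *\<^sub>R N1) = g p + c' *\<^sub>R ((1 - \<kappa>) *\<^sub>R ?E)" for p
      unfolding glin gN sc by simp_all
    have ex: "(\<exists>p. p \<in> ?T \<and> F p) \<longleftrightarrow> (\<exists>p. p \<in> T \<and> F (g p))" for F by blast
    show "chord_fits T N1 (c' / (1 - 2 * a)) \<longleftrightarrow> (\<exists>p. p \<in> ?T \<and> p + c' *\<^sub>R ?E \<in> ?T)"
      unfolding ex chord_fits_def A[symmetric] gmem ..
    show "triangle_fits T N1 N2 N3 (c' / (1 - a)) \<longleftrightarrow>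
      (\<exists>p. p \<in> ?T \<and> p + c' *\<^sub>R vector [1, - \<kappa>] \<in> ?T \<and> p + c' *\<^sub>R ((1 - \<kappa>) *\<^sub>R ?E) \<in> ?T) \<and>
      (\<exists>p. p \<in> ?T \<and> p + c' *\<^sub>R vector [- \<kappa>, 1] \<in> ?T \<and> p + c' *\<^sub>R ((1 - \<kappa>) *\<^sub>R ?E) \<in> ?T)"
      unfolding ex triangle_fits_def A[symmetric] gmem ..
  qed
  have g0: "g = (\<lambda>y. transpose M *v y + 0)" by (simp add: g_def)
  have Tb: "convex_body ?T" unfolding g0 by (rule convex_body_matrix_image[OF T iT])
  have vT: "vol ?T = \<bar>det M\<bar> * vol T"
    unfolding g0 by (simp only: vol_matrix_affine[OF convex_body_lmeasurable[OF T]] det_transpose)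
  have iff: "vol (Q \<times> T) = c_EHZ (Q \<times> T)^2 / 2 \<longleftrightarrow> vol ?T = C\<^sup>2"
    using Qb T by (simp add: vol_Times convex_body_def vQ C(2) vT)
  obtain P X Y where pxy: "P \<in> ?T" "P + C *\<^sub>R ?E \<in> ?T"
    "Y \<in> ?T" "Y + C *\<^sub>R vector [1, - \<kappa>] \<in> ?T" "Y + C *\<^sub>R ((1 - \<kappa>) *\<^sub>R ?E) \<in> ?T"
    "X \<in> ?T" "X + C *\<^sub>R vector [- \<kappa>, 1] \<in> ?T" "X + C *\<^sub>R ((1 - \<kappa>) *\<^sub>R ?E) \<in> ?T"
    using C(3,4) unfolding fits by blast
  note tri = trapezoid_dual_vol_scaled[OF Tb k C(1) pxy(1,2,6,8,7,3,5,4)]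
  show ?thesis
  proof
    assume "vol (Q \<times> T) = c_EHZ (Q \<times> T)^2 / 2"
    then have "vol ?T \<le> C\<^sup>2" using iff by simp
    then show "\<exists>l>0. \<exists>s. (\<lambda>y. transpose M *v y) ` T = (\<lambda>v. l *\<^sub>R v + s) ` cbox 0 1"
      using tri(2) C(1) unfolding g_def by blast
  next
    assume "\<exists>l>0. \<exists>s. (\<lambda>y. transpose M *v y) ` T = (\<lambda>v. l *\<^sub>R v + s) ` cbox 0 1"
    then obtain l s where l: "l > 0" "?T = (\<lambda>v. l *\<^sub>R v + s) ` cbox 0 1" unfolding g_def by blast
    have vl: "vol ?T = l\<^sup>2" unfolding l(2) vol_affine vol_unit_square by simp
    have I: "l *\<^sub>R v + s \<in> ?T" if "0 \<le> v$1" "v$1 \<le> 1" "0 \<le> v$2" "v$2 \<le> 1" for v :: R2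
      unfolding l(2) using that by (intro imageI) (auto simp: mem_box_cart forall_2)
    have I': "l *\<^sub>R v + s + l *\<^sub>R w \<in> ?T" if "0 \<le> (v + w)$1" "(v + w)$1 \<le> 1" "0 \<le> (v + w)$2" "(v + w)$2 \<le> 1" for v w :: R2
      using I[OF that] by (simp add: algebra_simps)
    have "chord_fits T N1 (l / (1 - 2 * a))"
      unfolding fits by (rule exI[of _ "l *\<^sub>R vector [0, 0] + s"], intro conjI; (rule I I')?) (simp_all)
    moreover have "triangle_fits T N1 N2 N3 (l / (1 - a))"
      unfolding fits
    proof (rule conjI)
      show "\<exists>p. p \<in> ?T \<and> p + l *\<^sub>R vector [1, - \<kappa>] \<in> ?T \<and> p + l *\<^sub>R ((1 - \<kappa>) *\<^sub>R ?E) \<in> ?T"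
        by (rule exI[of _ "l *\<^sub>R vector [0, \<kappa>] + s"], intro conjI I I') (use k in simp_all)
      show "\<exists>p. p \<in> ?T \<and> p + l *\<^sub>R vector [- \<kappa>, 1] \<in> ?T \<and> p + l *\<^sub>R ((1 - \<kappa>) *\<^sub>R ?E) \<in> ?T"
        by (rule exI[of _ "l *\<^sub>R vector [\<kappa>, 0] + s"], intro conjI I I') (use k in simp_all)
    qed
    ultimately have "l \<le> C" by (intro C(5))
    moreover have "C \<le> l" using tri(1) vl l(1) by (simp add: power2_le_iff_abs_le)
    ultimately show "vol (Q \<times> T) = c_EHZ (Q \<times> T)^2 / 2" using iff vl by simp
  qed
qed

lemma viterbo_equality_trapezoid:
  fixes M :: "real^2^2"
  assumes M: "invertible M" and a1: "0 < a1" "a1 < 1" and a2: "a2 = a1 \<or> a2 = 1 - a1" and half: "a1 \<noteq> 1/2"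
    and Q: "Q = (\<lambda>x. M *v x + c) ` diamond a1 a2" and T: "convex_body T"
  shows "vol (Q \<times> T) = c_EHZ (Q \<times> T)^2 / 2 \<longleftrightarrow>
    (\<exists>l>0. \<exists>s. T = (\<lambda>v. l *\<^sub>R v + s) ` (\<lambda>x. matrix_inv (transpose M) *v x) ` cbox 0 1)"
proof -
  \<comment> \<open>Reflections of the axes reduce to \<open>a1 = a2 < 1/2\<close> and change the dual square only by a translation.\<close>
  define a where "a = min a1 (1 - a1)"
  have a: "0 < a" "a < 1/2" using a1 half by (auto simp: a_def min_def)
  define e1 e2 :: real where "e1 = (if a1 = a then 1 else -1)" and "e2 = (if a2 = a then 1 else -1)"
  have a12: "a1 = a \<or> a1 = 1 - a" "a2 = a \<or> a2 = 1 - a" using a2 by (auto simp: a_def min_def)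
  define r :: R2 where "r = vector [if a1 = a then 0 else 1, if a2 = a then 0 else 1]"
  define R :: "real^2^2" where "R = vector [vector [e1, 0], vector [0, e2]]"
  have Rv: "R *v x = vector [e1 * x$1, e2 * x$2]" for x by (simp add: R_def matrix_vector_mult_R2)
  have ee: "e1 * e1 = 1" "e2 * e2 = 1" by (simp_all add: e1_def e2_def)
  have RR: "R *v (R *v x) = x" for x by (simp add: Rv vec_eq_iff forall_2 ee flip: mult.assoc)
  have tR: "transpose R = R" by (simp add: R_def transpose_def vec_eq_iff forall_2)
  have iR: "invertible R" using ee by (auto simp: invertible_det_nz det_2 R_def)
  have iM: "invertible (M ** R)" using M iR by (simp add: invertible_mult)
  have Rbox: "(\<lambda>x. R *v x + r) ` cbox 0 1 = cbox 0 1"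
  proof -
    have sub: "R *v x + r \<in> cbox 0 1" if "x \<in> cbox 0 1" for x
      using that by (auto simp: mem_box_cart forall_2 Rv r_def e1_def e2_def)
    have "x = R *v (R *v (x - r)) + r" for x by (simp add: RR)
    moreover have "R *v (x - r) \<in> cbox 0 1" if "x \<in> cbox 0 1" for x
      using that by (auto simp: mem_box_cart forall_2 Rv r_def e1_def e2_def)
    ultimately show ?thesis using sub by blast
  qed
  have dia: "diamond a1 a2 = (\<lambda>x. R *v x + r) ` diamond a a"
  proof -
    have in01: "a \<in> {0..1}" "a1 \<in> {0..1}" "a2 \<in> {0..1}" using a a1 a2 by auto
    have "(\<lambda>x. R *v x + r) ` {vector [0, a], vector [a, 0], vector [1, a], vector [a, 1]} =
        {vector [0, a2], vector [a1, 0], vector [1, a2], vector [a1, 1]}"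
    proof -
      have "e1 = 1 \<and> r$1 = 0 \<and> a1 = a \<or> e1 = -1 \<and> r$1 = 1 \<and> a1 = 1 - a" using a12 by (auto simp: e1_def r_def)
      moreover have "e2 = 1 \<and> r$2 = 0 \<and> a2 = a \<or> e2 = -1 \<and> r$2 = 1 \<and> a2 = 1 - a" using a12 by (auto simp: e2_def r_def)
      moreover have "R *v vector [x, y] + r = vector [e1 * x + r$1, e2 * y + r$2]" for x y
        by (simp add: Rv vec_eq_iff forall_2)
      ultimately show ?thesis by (elim disjE) (simp_all add: insert_commute)
    qed
    then show ?thesis
      unfolding diamond_eq_hull[OF in01(2,3)] diamond_eq_hull[OF in01(1,1)]
        affine_image_convex_hull[OF matrix_vector_mul_linear] by simp
  qed
  have "Q = (\<lambda>x. (M ** R) *v x + (M *v r + c)) ` diamond a a"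
    unfolding Q dia image_image by (simp add: matrix_vector_right_distrib matrix_vector_mul_assoc add.assoc)
  note main = viterbo_equality_trapezoid_normal[OF iM a this T]
  define g where "g = (\<lambda>y. transpose M *v y)"
  define W where "W = (\<lambda>y. matrix_inv (transpose M) *v y)"
  have iT: "invertible (transpose M)" using M by (simp add: invertible_det_nz)
  have gW: "g (W n) = n" and Wg: "W (g n) = n" for n
    using iT by (simp_all add: g_def W_def matrix_vector_mul_assoc matrix_inv_right matrix_inv_left del: transpose_matrix_vector)
  have tM: "transpose (M ** R) *v y = R *v g y" for y
    by (simp add: g_def matrix_transpose_mul tR matrix_vector_mul_assoc del: transpose_matrix_vector)
  have Wl: "W (l *\<^sub>R v + s) = l *\<^sub>R W v + W s" and gl: "g (l *\<^sub>R v + s) = l *\<^sub>R g v + g s" and Rl: "R *v (l *\<^sub>R v + s) = l *\<^sub>R (R *v v) + R *v s" for l v s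
    by (simp_all add: W_def g_def matrix_vector_right_distrib matrix_vector_mult_scaleR del: transpose_matrix_vector)
  \<comment> \<open>The unit square is mapped to itself by \<open>R\<close> followed by the shift
    \<open>r\<close>, so the reflection is absorbed into the translation.\<close>
  have sq: "(\<lambda>v. l *\<^sub>R (R *v v) + s) ` cbox 0 1 = (\<lambda>v. l *\<^sub>R v + (s - l *\<^sub>R r)) ` cbox 0 1" for l s
  proof -
    have "(\<lambda>v. l *\<^sub>R (R *v v) + s) ` cbox 0 1 = (\<lambda>v. l *\<^sub>R v + (s - l *\<^sub>R r)) ` (\<lambda>x. R *v x + r) ` cbox 0 1"
      unfolding image_image by (simp add: algebra_simps)
    then show ?thesis unfolding Rbox .
  qed
  have "(\<exists>s. (\<lambda>y. transpose (M ** R) *v y) ` T = (\<lambda>v. l *\<^sub>R v + s) ` cbox 0 1) \<longleftrightarrow>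
    (\<exists>s. T = (\<lambda>v. l *\<^sub>R v + s) ` W ` cbox 0 1)" for l
  proof
    assume "\<exists>s. (\<lambda>y. transpose (M ** R) *v y) ` T = (\<lambda>v. l *\<^sub>R v + s) ` cbox 0 1"
    then obtain s where "(\<lambda>y. R *v g y) ` T = (\<lambda>v. l *\<^sub>R v + s) ` cbox 0 1" unfolding tM by blast
    then have "(\<lambda>y. W (R *v y)) ` (\<lambda>y. R *v g y) ` T = (\<lambda>y. W (R *v y)) ` (\<lambda>v. l *\<^sub>R v + s) ` cbox 0 1" by simp
    then have "T = (\<lambda>v. W (l *\<^sub>R (R *v v) + R *v s)) ` cbox 0 1" unfolding image_image by (simp add: RR Wg Rl)
    also have "\<dots> = W ` (\<lambda>v. l *\<^sub>R (R *v v) + R *v s) ` cbox 0 1" by (simp add: image_image)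
    also have "\<dots> = (\<lambda>v. l *\<^sub>R v + W (R *v s - l *\<^sub>R r)) ` W ` cbox 0 1" unfolding sq by (simp add: image_image Wl)
    finally show "\<exists>s. T = (\<lambda>v. l *\<^sub>R v + s) ` W ` cbox 0 1" by blast
  next
    assume "\<exists>s. T = (\<lambda>v. l *\<^sub>R v + s) ` W ` cbox 0 1"
    then obtain s where "T = (\<lambda>v. l *\<^sub>R v + s) ` W ` cbox 0 1" by blast
    then have "(\<lambda>y. R *v g y) ` T = (\<lambda>v. l *\<^sub>R (R *v v) + R *v g s) ` cbox 0 1" by (simp add: image_image gl gW Rl)
    then have "(\<lambda>y. transpose (M ** R) *v y) ` T = (\<lambda>v. l *\<^sub>R v + (R *v g s - l *\<^sub>R r)) ` cbox 0 1" unfolding sq tM .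
    then show "\<exists>s. (\<lambda>y. transpose (M ** R) *v y) ` T = (\<lambda>v. l *\<^sub>R v + s) ` cbox 0 1" by blast
  qed
  then show ?thesis unfolding main W_def by simp
qed

section \<open>Vertices of quadrilaterals and the parameters of a trapezoid\<close>

lemma ccw_quad_rotate: "ccw_quad a b c d \<Longrightarrow> ccw_quad b c d a"
  by (simp add: ccw_quad_def)

text \<open>The diagonal through \<open>b\<close> and \<open>d\<close> separates \<open>a\<close>
  strictly from \<open>c\<close>, so \<open>a\<close> is outside the hull of the other three
  vertices.\<close>

lemma ccw_quad_extreme:
  assumes "ccw_quad a b c d"
  shows "a extreme_point_of (convex hull {a, b, c, d})"
proof -
  have "det2 (a - d) (b - a) = det2 (d - b) (a - b)" "det2 (c - b) (d - c) = - det2 (d - b) (c - b)"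
    by (simp_all add: det2_def algebra_simps)
  then have s: "det2 (d - b) (a - b) > 0" "det2 (d - b) (c - b) < 0" using assms by (simp_all add: ccw_quad_def)
  have "{x. det2 (d - b) (x - b) \<le> 0} = {x. inner (vector [- ((d - b)$2), (d - b)$1]) x \<le> det2 (d - b) b}"
    unfolding det2_inner[symmetric] by simp
  then have "convex {x. det2 (d - b) (x - b) \<le> 0}" by (simp only: convex_halfspace_le)
  then have "convex hull {b, c, d} \<subseteq> {x. det2 (d - b) (x - b) \<le> 0}"
    using s(2) by (intro hull_minimal) (auto simp del: det2_diff)
  then have "a \<notin> convex hull {b, c, d}" using s(1) by auto
  then show ?thesis by (intro extreme_point_of_convex_hull_insert) auto
qed

text \<open>Extreme points do not depend on the presentation of the hull. Hence the vertices that
  witness \<open>trapezoid\<close> are images of the vertices of the diamond.\<close>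

lemma ccw_quad_vertices:
  assumes "ccw_quad a b c d" "convex hull {a, b, c, d} = convex hull S"
  shows "a \<in> S" "b \<in> S" "c \<in> S" "d \<in> S"
proof -
  have *: "w \<in> S" if "ccw_quad w x y z" "convex hull {w, x, y, z} = convex hull S" for w x y z
    using ccw_quad_extreme[OF that(1)] extreme_point_of_convex_hull unfolding that(2) by blast
  show "a \<in> S" by (rule *[OF assms])
  show "b \<in> S" by (rule *[OF ccw_quad_rotate[OF assms(1)]]) (use assms(2) in \<open>simp add: insert_commute\<close>)
  show "c \<in> S" by (rule *[OF ccw_quad_rotate[OF ccw_quad_rotate[OF assms(1)]]]) (use assms(2) in \<open>simp add: insert_commute\<close>)
  show "d \<in> S" by (rule *[OF ccw_quad_rotate[OF ccw_quad_rotate[OF ccw_quad_rotate[OF assms(1)]]]])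
     (use assms(2) in \<open>simp add: insert_commute\<close>)
qed

text \<open>At an extreme parameter an end of one diagonal lies on the other diagonal and is
  redundant as a vertex.\<close>

lemma diamond_degenerate:
  assumes "a1 \<in> {0, 1} \<or> a2 \<in> {0, 1}" "a1 \<in> {0..1}" "a2 \<in> {0..1}"
  obtains u v w where "diamond a1 a2 = convex hull {u, v, w}" "det2 (v - u) (w - u) \<noteq> 0"
proof -
  let ?W = "vector [0, a2] :: R2" and ?S = "vector [a1, 0] :: R2" and ?E = "vector [1, a2] :: R2" and ?N = "vector [a1, 1] :: R2"
  note dh = diamond_eq_hull[OF assms(2,3)]
  have red: "convex hull {x, y, z, t} = convex hull {y, z, t}" if "x = (1 - r) *\<^sub>R y + r *\<^sub>R z" "0 \<le> r" "r \<le> 1" for x y z t :: R2 and r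
  proof -
    have "x \<in> convex hull {y, z, t}" unfolding that(1) using that(2,3) by (intro convexD) (auto simp: hull_inc)
    then show ?thesis by (rule hull_redundant)
  qed
  consider "a1 = 0" | "a1 = 1" | "a2 = 0" | "a2 = 1" using assms(1) by auto
  then show thesis
  proof cases
    case 1
    have "diamond a1 a2 = convex hull {?S, ?N, ?E}"
      unfolding dh using red[of ?W a2 ?S ?N ?E] 1 assms by (simp add: insert_commute vec_eq_iff forall_2)
    then show ?thesis by (rule that) (use 1 in \<open>simp add: det2_def\<close>)
  next
    case 2
    have "diamond a1 a2 = convex hull {?S, ?N, ?W}"
      unfolding dh using red[of ?E a2 ?S ?N ?W] 2 assms by (simp add: insert_commute vec_eq_iff forall_2)
    then show ?thesis by (rule that) (use 2 in \<open>simp add: det2_def\<close>)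
  next
    case 3
    have "diamond a1 a2 = convex hull {?W, ?E, ?N}"
      unfolding dh using red[of ?S a1 ?W ?E ?N] 3 assms by (simp add: insert_commute vec_eq_iff forall_2)
    then show ?thesis by (rule that) (use 3 in \<open>simp add: det2_def\<close>)
  next
    case 4
    have "diamond a1 a2 = convex hull {?W, ?E, ?S}"
      unfolding dh using red[of ?N a1 ?W ?E ?S] 4 assms by (simp add: insert_commute vec_eq_iff forall_2)
    then show ?thesis by (rule that) (use 4 in \<open>simp add: det2_def\<close>)
  qed
qed

text \<open>Positive orientation rules out repeated vertices and every labelling except the cyclic
  rotations of \<open>W\<close>, \<open>S\<close>, \<open>E\<close>, \<open>N\<close>. For these,
  parallelism of \<open>WS\<close> and \<open>EN\<close> means \<open>a1 = a2\<close>, and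
  parallelism of \<open>SE\<close> and \<open>NW\<close> means \<open>a1 + a2 = 1\<close>.\<close>

lemma diamond_vertices_parallel:
  fixes W S E N A B C D :: R2
  assumes v: "W = vector [0, a2]" "S = vector [a1, 0]" "E = vector [1, a2]" "N = vector [a1, 1]"
    and a: "0 < a1" "a1 < 1" "0 < a2" "a2 < 1"
    and V: "A \<in> {W, S, E, N}" "B \<in> {W, S, E, N}" "C \<in> {W, S, E, N}" "D \<in> {W, S, E, N}"
    and or: "det2 (B - A) (C - B) > 0" "det2 (C - B) (D - C) > 0" "det2 (D - C) (A - D) > 0" "det2 (A - D) (B - A) > 0"
    and par: "det2 (B - A) (D - C) = 0 \<or> det2 (C - B) (A - D) = 0"
  shows "a2 = a1 \<or> a2 = 1 - a1"
proof -
  define tri where "tri = (\<lambda>X Y Z :: R2. det2 (Y - X) (Z - Y))"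
  have deg: "tri X X Y = 0" "tri X Y X = 0" "tri X Y Y = 0" for X Y
    by (simp_all add: tri_def det2_def algebra_simps)
  \<comment> \<open>Orientations of all 24 ordered triples of distinct vertices.\<close>
  have tab: "tri W S E = a2" "tri E S W = - (a2)" "tri S E W = a2" "tri W E S = - (a2)" "tri E W S = a2" "tri S W E = - (a2)" "tri S E N = 1 - a1" "tri N E S = - (1 - a1)" "tri E N S = 1 - a1" "tri S N E = - (1 - a1)" "tri N S E = 1 - a1" "tri E S N = - (1 - a1)" "tri E N W = 1 - a2" "tri W N E = - (1 - a2)" "tri N W E = 1 - a2" "tri E W N = - (1 - a2)" "tri W E N = 1 - a2" "tri N E W = - (1 - a2)" "tri N W S = a1" "tri S W N = - (a1)" "tri W S N = a1" "tri N S W = - (a1)" "tri S N W = a1" "tri W N S = - (a1)"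
    unfolding tri_def v by (simp_all add: det2_def algebra_simps)
  have pos: "0 < tri A B C" "0 < tri B C D" "0 < tri C D A" "0 < tri D A B"
    using or by (simp_all only: tri_def)
  have "(A, B, C) \<in> {(W, S, E), (S, E, W), (E, W, S), (S, E, N), (E, N, S), (N, S, E), (E, N, W), (N, W, E), (W, E, N), (N, W, S), (W, S, N), (S, N, W)}"
    using V(1-3) pos(1) a by (elim insertE emptyE; simp add: deg tab)
  then have "(A, B, C, D) \<in> {(W, S, E, N), (S, E, N, W), (E, N, W, S), (N, W, S, E)}"
    using V(4) pos(2-4) a by (elim insertE emptyE; simp add: deg tab)
  then show ?thesis
    using par unfolding v by (auto simp: det2_def algebra_simps)
qed

text \<open>Each condition on the shape restricts the parameters: a quadrilateral that is no
  triangle keeps them off the endpoints, a pair of parallel sides relates them, and the midpoint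
  would give a parallelogram.\<close>

lemma diamond_image_trapezoid:
  fixes M :: "real^2^2"
  assumes tr: "trapezoid Q" "\<not> triangle Q" "\<not> parallelogram Q" and M: "invertible M"
    and a: "a1 \<in> {0..1}" "a2 \<in> {0..1}" and Q: "Q = (\<lambda>x. M *v x + c) ` diamond a1 a2"
  shows "0 < a1" "a1 < 1" "a2 = a1 \<or> a2 = 1 - a1" "a1 \<noteq> 1/2"
proof -
  define f where "f = (\<lambda>x. M *v x + c)"
  let ?W = "vector [0, a2] :: R2" and ?S = "vector [a1, 0] :: R2" and ?E = "vector [1, a2] :: R2" and ?N = "vector [a1, 1] :: R2"
  have hull: "f ` (convex hull V) = convex hull (f ` V)" for V
    unfolding f_def by (rule affine_image_convex_hull[OF matrix_vector_mul_linear])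
  define m where "m = det M"
  have m: "m \<noteq> 0" using M by (simp add: m_def invertible_det_nz)
  have fd: "det2 (f x - f y) (f z - f w) = m * det2 (x - y) (z - w)" for x y z w
    unfolding m_def det2_matrix[symmetric] by (simp only: f_def matrix_vector_mult_diff_distrib add_diff_cancel_right)
  have open_a: "0 < a1" "a1 < 1" "0 < a2" "a2 < 1"
  proof -
    have "\<not> (a1 \<in> {0, 1} \<or> a2 \<in> {0, 1})"
    proof
      assume "a1 \<in> {0, 1} \<or> a2 \<in> {0, 1}"
      then obtain u v w where uvw: "diamond a1 a2 = convex hull {u, v, w}" "det2 (v - u) (w - u) \<noteq> 0"
        using diamond_degenerate[OF _ a] by metis
      have "Q = convex hull {f u, f v, f w}" unfolding Q f_def[symmetric] uvw(1) hull by simp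
      moreover have "\<not> collinear {f u, f v, f w}" unfolding collinear_det2 fd using m uvw(2) by simp
      ultimately have "triangle Q" unfolding triangle_def by blast
      then show False using tr(2) by simp
    qed
    then show "0 < a1" "a1 < 1" "0 < a2" "a2 < 1" using a by auto
  qed
  show "0 < a1" "a1 < 1" by fact+
  have Qh: "Q = convex hull (f ` {?W, ?S, ?E, ?N})"
    unfolding Q f_def[symmetric] diamond_eq_hull[OF a] hull ..
  obtain p q r s where ccw: "ccw_quad p q r s" "Q = convex hull {p, q, r, s}"
      "parallel2 (q - p) (s - r) \<or> parallel2 (r - q) (p - s)"
    using tr(1,2) unfolding trapezoid_def by blast
  note V = ccw_quad_vertices[OF ccw(1) ccw(2)[symmetric, unfolded Qh]]
  obtain A where A: "p = f A" "A \<in> {?W, ?S, ?E, ?N}" using V(1) by (rule imageE)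
  obtain B where B: "q = f B" "B \<in> {?W, ?S, ?E, ?N}" using V(2) by (rule imageE)
  obtain C where C: "r = f C" "C \<in> {?W, ?S, ?E, ?N}" using V(3) by (rule imageE)
  obtain D where D: "s = f D" "D \<in> {?W, ?S, ?E, ?N}" using V(4) by (rule imageE)
  note ABCD = A(1) B(1) C(1) D(1) A(2) B(2) C(2) D(2)
  have or: "m * det2 (B - A) (C - B) > 0" "m * det2 (C - B) (D - C) > 0" "m * det2 (D - C) (A - D) > 0" "m * det2 (A - D) (B - A) > 0"
    using ccw(1) unfolding ccw_quad_def ABCD(1-4) fd by blast+
  have par: "det2 (B - A) (D - C) = 0 \<or> det2 (C - B) (A - D) = 0"
    using ccw(3) m unfolding parallel2_def ABCD(1-4) fd by auto
  \<comment> \<open>If \<open>M\<close> reverses orientation, the vertices are read in the opposite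
    order.\<close>
  define \<sigma> where "\<sigma> = sgn m"
  have sg: "\<sigma> = 1 \<or> \<sigma> = -1" using m by (auto simp: \<sigma>_def sgn_if)
  have or': "\<sigma> * x > 0" if "m * x > 0" for x using that by (auto simp: \<sigma>_def sgn_if zero_less_mult_iff)
  note o = or'[OF or(1)] or'[OF or(2)] or'[OF or(3)] or'[OF or(4)]
  show "a2 = a1 \<or> a2 = 1 - a1"
    using sg
  proof
    assume "\<sigma> = 1"
    then show ?thesis
      using diamond_vertices_parallel[OF refl refl refl refl open_a ABCD(5-8) _ _ _ _ par] o by simp
  next
    assume s: "\<sigma> = -1"
    have rev: "det2 (Y - X) (Z - Y) = - det2 (Y - Z) (X - Y)" for X Y Z :: R2
      by (simp add: det2_def algebra_simps)
    have par': "det2 (C - D) (A - B) = 0 \<or> det2 (B - C) (D - A) = 0"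
      using par det2_commute[of "C - D" "A - B"] by (auto simp: det2_def algebra_simps)
    have "det2 (C - D) (B - C) > 0" "det2 (B - C) (A - B) > 0" "det2 (A - B) (D - A) > 0" "det2 (D - A) (C - D) > 0"
      using o rev[of B A C] rev[of C B D] rev[of D C A] rev[of A D B] unfolding s by linarith+
    then show ?thesis
      using diamond_vertices_parallel[OF refl refl refl refl open_a ABCD(8,7,6,5) _ _ _ _ par'] by blast
  qed
  show "a1 \<noteq> 1/2"
  proof
    assume a1: "a1 = 1/2"
    then have a2: "a2 = 1/2" using \<open>a2 = a1 \<or> a2 = 1 - a1\<close> by auto
    have fdiff: "f x - f y = M *v (x - y)" for x y by (simp add: f_def matrix_vector_mult_diff_distrib)
    have "parallelogram Q"
    proof (cases "m > 0")
      case True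
      have "ccw_quad (f ?W) (f ?S) (f ?E) (f ?N)"
        unfolding ccw_quad_def fd using True by (simp add: det2_def a1 a2)
      moreover have "f ?S - f ?W = f ?E - f ?N"
        unfolding fdiff by (rule arg_cong[where f="(*v) M"]) (simp add: vec_eq_iff forall_2 a1 a2)
      moreover have "Q = convex hull {f ?W, f ?S, f ?E, f ?N}" unfolding Qh by simp
      ultimately show ?thesis unfolding parallelogram_def by blast
    next
      case False
      then have "m < 0" using m by simp
      then have "ccw_quad (f ?W) (f ?N) (f ?E) (f ?S)"
        unfolding ccw_quad_def fd by (simp add: det2_def a1 a2)
      moreover have "f ?N - f ?W = f ?E - f ?S"
        unfolding fdiff by (rule arg_cong[where f="(*v) M"]) (simp add: vec_eq_iff forall_2 a1 a2)
      moreover have "Q = convex hull {f ?W, f ?N, f ?E, f ?S}" unfolding Qh by (simp add: insert_commute)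
      ultimately show ?thesis unfolding parallelogram_def by blast
    qed
    then show False using tr(3) by simp
  qed
qed

lemma trapezoid_dual_body:
  fixes M :: "real^2^2"
  assumes "invertible M"
  shows "convex_body ((\<lambda>x. matrix_inv (transpose M) *v x) ` cbox 0 1)"
proof -
  have iT: "invertible (transpose M)" using assms by (simp add: invertible_det_nz)
  have "invertible (matrix_inv (transpose M))"
    unfolding invertible_def using matrix_inv_left[OF iT] matrix_inv_right[OF iT] by blast
  moreover have "convex_body (cbox 0 1 :: R2 set)" by (rule convex_bodyI) (simp_all add: vol_unit_square)
  ultimately show ?thesis using convex_body_matrix_image[of "cbox 0 1" "matrix_inv (transpose M)" 0] by simp
qed

theorem theorem1p2:
  shows
   "(\<forall>D. triangle D \<longrightarrow>
       (\<forall>T\<in>T_Delta D. vol (D \<times> T) = c_EHZ (D \<times> T)^2 / 2) \<and>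
       (\<forall>T. convex_body T \<longrightarrow>
          (vol (D \<times> T) = c_EHZ (D \<times> T)^2 / 2 \<longleftrightarrow>
           (\<exists>l>0. \<exists>s. \<exists>Ts\<in>T_Delta D. T = (\<lambda>v. l *\<^sub>R v + s) ` Ts))))
    \<and>
    (\<forall>S. axis_square S \<longrightarrow>
       (\<forall>a1 a2. a1 \<in> {0..1} \<and> a2 \<in> {0..1} \<longrightarrow>
          vol (S \<times> diamond a1 a2) = c_EHZ (S \<times> diamond a1 a2)^2 / 2) \<and>
       (\<forall>T. convex_body T \<longrightarrow>
          (vol (S \<times> T) = c_EHZ (S \<times> T)^2 / 2 \<longleftrightarrow>
           (\<exists>l>0. \<exists>s. \<exists>a1\<in>{0..1}. \<exists>a2\<in>{0..1}.
              T = (\<lambda>v. l *\<^sub>R v + s) ` diamond a1 a2))))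
    \<and>
    (\<forall>Q (M::real^2^2) c a1 a2.
       trapezoid Q \<and> \<not> triangle Q \<and> \<not> parallelogram Q \<and> invertible M
       \<and> a1 \<in> {0..1} \<and> a2 \<in> {0..1} \<and> Q = (\<lambda>x. M *v x + c) ` diamond a1 a2 \<longrightarrow>
       (let P = (\<lambda>x. matrix_inv (transpose M) *v x) ` cbox 0 1 in
          vol (Q \<times> P) = c_EHZ (Q \<times> P)^2 / 2 \<and>
          (\<forall>T. convex_body T \<longrightarrow>
             (vol (Q \<times> T) = c_EHZ (Q \<times> T)^2 / 2 \<longleftrightarrow>
              (\<exists>l>0. \<exists>s. T = (\<lambda>v. l *\<^sub>R v + s) ` P)))))"
proof (intro conjI allI impI ballI)
  fix D T :: "R2 set" assume D: "triangle D" and T: "T \<in> T_Delta D"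
  have "T = (\<lambda>v. 1 *\<^sub>R v + 0) ` T" by simp
  then show "vol (D \<times> T) = c_EHZ (D \<times> T)^2 / 2"
    unfolding viterbo_equality_triangle[OF D T_Delta_convex_body[OF D T]] using T zero_less_one by blast
next
  fix D T :: "R2 set" assume "triangle D" "convex_body T"
  then show "vol (D \<times> T) = c_EHZ (D \<times> T)^2 / 2 \<longleftrightarrow>
           (\<exists>l>0. \<exists>s. \<exists>Ts\<in>T_Delta D. T = (\<lambda>v. l *\<^sub>R v + s) ` Ts)"
    by (rule viterbo_equality_triangle)
next
  fix S :: "R2 set" and a1 a2 :: real assume S: "axis_square S" and a: "a1 \<in> {0..1} \<and> a2 \<in> {0..1}"
  have "diamond a1 a2 = (\<lambda>v. 1 *\<^sub>R v + 0) ` diamond a1 a2" by simp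
  then show "vol (S \<times> diamond a1 a2) = c_EHZ (S \<times> diamond a1 a2)^2 / 2"
    unfolding viterbo_equality_square[OF S diamond_body(2)[OF conjunct1[OF a] conjunct2[OF a]]]
    using a zero_less_one by blast
next
  fix S T :: "R2 set" assume "axis_square S" "convex_body T"
  then show "vol (S \<times> T) = c_EHZ (S \<times> T)^2 / 2 \<longleftrightarrow>
           (\<exists>l>0. \<exists>s. \<exists>a1\<in>{0..1}. \<exists>a2\<in>{0..1}. T = (\<lambda>v. l *\<^sub>R v + s) ` diamond a1 a2)"
    by (rule viterbo_equality_square)
next
  fix Q :: "R2 set" and c a1 a2 and M :: "real^2^2"
  assume H: "trapezoid Q \<and> \<not> triangle Q \<and> \<not> parallelogram Q \<and> invertible M
       \<and> a1 \<in> {0..1} \<and> a2 \<in> {0..1} \<and> Q = (\<lambda>x. M *v x + c) ` diamond a1 a2"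
  let ?P = "(\<lambda>x. matrix_inv (transpose M) *v x) ` cbox 0 1"
  have M: "invertible M" and Q: "Q = (\<lambda>x. M *v x + c) ` diamond a1 a2" using H by auto
  have par: "0 < a1" "a1 < 1" "a2 = a1 \<or> a2 = 1 - a1" "a1 \<noteq> 1/2"
    using diamond_image_trapezoid[of Q M a1 a2 c] H by blast+
  note iff = viterbo_equality_trapezoid[OF M par Q]
  have "?P = (\<lambda>v. 1 *\<^sub>R v + 0) ` ?P" by simp
  then have "vol (Q \<times> ?P) = c_EHZ (Q \<times> ?P)^2 / 2"
    unfolding iff[OF trapezoid_dual_body[OF M]] using zero_less_one by blast
  then show "let P = ?P in vol (Q \<times> P) = c_EHZ (Q \<times> P)^2 / 2 \<and>
          (\<forall>T. convex_body T \<longrightarrow>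
             (vol (Q \<times> T) = c_EHZ (Q \<times> T)^2 / 2 \<longleftrightarrow>
              (\<exists>l>0. \<exists>s. T = (\<lambda>v. l *\<^sub>R v + s) ` P)))"
    unfolding Let_def using iff by blast
qed

end
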